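(* For every $d\in\mathbb{N}$ and $M\in\mathbb{Z}_{\ge0}$, the moments $\int_{\operatorname{slice}(a,t)}\sum_{i=1}^dx_i^M$ and $\int_{\operatorname{slab}(a,t)}\sum_{i=1}^dx_i^M$ of slices and slabs of the cube $B^d_\infty=[-\tfrac12,\tfrac12]^d$ are piecewise rational functions of $(a,t)\in S^{d-1}\times\mathbb{R}$ whose pieces are supported on the same domains (the maximal slicing chambers) as the rational-function expressions of the respective volume formulas of $\operatorname{slice}(a,t)$ and $\operatorname{slab}(a,t)$. Moreover, for $d\in\{2,3,4\}$ and $M\in\{1,2,3,4\}$, on each such domain the degree of the rational function for the $M$-th moment coincides with the degree of the corresponding volume formula.
   Context: $H(a,t)=\{x:\langle a,x\rangle=\tfrac t2\}$, $\operatorname{slice}(a,t)=B^d_\infty\cap H(a,t)$, $\operatorname{slab}(a,t)=\{x\in B^d_\infty:|\langle a,x\rangle|\le\tfrac t2\}$. Maximal slicing chambers: the sweep arrangement consists of hyperplanes $(v-w)^\perp$ for distinct cube vertices $v,w$; its regions $R_i$ are the components of $S^{d-1}$ minus these hyperplanes; $C_{i,j}=\{(a,t):a\in R_i,\ t\in I_{i,j}(a)\}$ where $I_{i,j}(a)$ are the open intervals of $t>0$ on which $t/2$ lies strictly between consecutive values in the list $0$ and the positive values $\langle a,v\rangle$. The degree of a rational function $p/q$ in reduced form is $\deg p-\deg q$. *)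

theory Defs
  imports "HOL-Analysis.Analysis" "HOL-Library.Poly_Mapping"
begin

section \<open>Slices and slabs of the cube\<close>

definition cube :: "(real^'n) set" where
  "cube = {x. \<forall>i. \<bar>x $ i\<bar> \<le> 1/2}"

definition cube_vertices :: "(real^'n) set" where
  "cube_vertices = {v. \<forall>i. v $ i = 1/2 \<or> v $ i = -1/2}"

definition hyperplane :: "real^'n \<Rightarrow> real \<Rightarrow> (real^'n) set" where
  "hyperplane a t = {x. a \<bullet> x = t/2}"

definition slice :: "real^'n \<Rightarrow> real \<Rightarrow> (real^'n) set" where
  "slice a t = cube \<inter> hyperplane a t"

definition slab :: "real^'n \<Rightarrow> real \<Rightarrow> (real^'n) set" where
  "slab a t = {x \<in> cube. \<bar>a \<bullet> x\<bar> \<le> t/2}"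

text \<open>
  The \<open>(d-1)\<close>-dimensional Lebesgue measure on \<^term>\<open>hyperplane a t\<close> (for \<open>a \<noteq> 0\<close>), in
  orthonormal coordinates with origin at the point of the hyperplane nearest to \<open>0\<close>;
  compare \<open>lborel_eq\<close>. It does not depend on the orthonormal basis that is chosen.
  For \<open>d = 1\<close> the basis is empty and the measure is a unit point mass.
\<close>
definition orthonormal_basis_of :: "(real^'n) set \<Rightarrow> (real^'n) set \<Rightarrow> bool" where
  "orthonormal_basis_of V B \<longleftrightarrow>
     B \<subseteq> V \<and> pairwise orthogonal B \<and> (\<forall>b\<in>B. norm b = 1) \<and> span B = V"

definition hyperplane_lborel :: "real^'n \<Rightarrow> real \<Rightarrow> (real^'n) measure" where
  "hyperplane_lborel a t =
     (let B = (SOME B. orthonormal_basis_of {x. a \<bullet> x = 0} B) in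
      distr (\<Pi>\<^sub>M b\<in>B. lborel) borel
        (\<lambda>c. (t / 2 / (a \<bullet> a)) *\<^sub>R a + (\<Sum>b\<in>B. c b *\<^sub>R b)))"

definition slice_volume :: "real^'n \<Rightarrow> real \<Rightarrow> real" where
  "slice_volume a t = measure (hyperplane_lborel a t) (slice a t)"

definition slab_volume :: "real^'n \<Rightarrow> real \<Rightarrow> real" where
  "slab_volume a t = measure lborel (slab a t)"

definition slice_moment :: "nat \<Rightarrow> real^'n \<Rightarrow> real \<Rightarrow> real" where
  "slice_moment M a t = (LINT x:slice a t|hyperplane_lborel a t. (\<Sum>i\<in>UNIV. (x $ i) ^ M))"

definition slab_moment :: "nat \<Rightarrow> real^'n \<Rightarrow> real \<Rightarrow> real" where
  "slab_moment M a t = (LINT x:slab a t|lborel. (\<Sum>i\<in>UNIV. (x $ i) ^ M))"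


section \<open>Maximal slicing chambers\<close>

definition sweep_hyperplanes :: "(real^'n) set set" where
  "sweep_hyperplanes =
     {{x. (v - w) \<bullet> x = 0} |v w. v \<in> cube_vertices \<and> w \<in> cube_vertices \<and> v \<noteq> w}"

definition sweep_regions :: "(real^'n) set set" where
  "sweep_regions = components (sphere 0 1 - \<Union>sweep_hyperplanes)"

definition levels :: "real^'n \<Rightarrow> real list" where
  "levels a = sorted_list_of_set (insert 0 {a \<bullet> v |v. v \<in> cube_vertices \<and> a \<bullet> v > 0})"

definition slicing_chamber :: "(real^'n) set \<Rightarrow> nat \<Rightarrow> ((real^'n) \<times> real) set" where
  "slicing_chamber R j =
     {(a, t). a \<in> R \<and> Suc j < length (levels a) \<and> levels a ! j < t/2 \<and> t/2 < levels a ! Suc j}"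

text \<open>The empty set arises from indices \<open>j\<close> beyond the last interval.\<close>
definition maximal_slicing_chambers :: "((real^'n) \<times> real) set set" where
  "maximal_slicing_chambers = {slicing_chamber R j |R j. R \<in> sweep_regions} - {{}}"

text \<open>
  The chambers only cover the range \<open>0 < t/2 < max \<langle>a,v\<rangle>\<close>. To speak about functions on all of
  \<open>S\<^sup>d\<^sup>-\<^sup>1 \<times> \<real>\<close> they are completed by the ranges beyond the last level (where the
  slice is empty and the slab is the whole cube) and by the reflections of all these sets
  under \<open>t \<mapsto> -t\<close>.
\<close>
definition outer_pieces :: "((real^'n) \<times> real) set set" where
  "outer_pieces = {{(a, t). a \<in> R \<and> last (levels a) < t/2} |R. R \<in> sweep_regions}"

definition slicing_pieces :: "((real^'n) \<times> real) set set" where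
  "slicing_pieces =
     (let \<P> = maximal_slicing_chambers \<union> outer_pieces
      in \<P> \<union> (\<lambda>P. (\<lambda>(a, t). (a, - t)) ` P) ` \<P>)"


section \<open>Rational functions of \<open>(a,t)\<close>\<close>

text \<open>
  Real polynomials in the variables \<open>a\<^sub>i\<close> (index \<open>Some i\<close>) and \<open>t\<close> (index \<open>None\<close>),
  as finitely supported maps from monomials to coefficients.
\<close>
type_synonym 'n at_poly = "('n option \<Rightarrow>\<^sub>0 nat) \<Rightarrow>\<^sub>0 real"

definition poly_eval :: "'n::finite at_poly \<Rightarrow> real^'n \<Rightarrow> real \<Rightarrow> real" where
  "poly_eval p a t =
     (\<Sum>m\<in>Poly_Mapping.keys p. Poly_Mapping.lookup p m *
        (\<Prod>v\<in>UNIV. (case v of None \<Rightarrow> t | Some i \<Rightarrow> a $ i) ^ Poly_Mapping.lookup m v))"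

text \<open>As for univariate polynomials in the library, the zero polynomial has degree \<open>0\<close>.\<close>
definition total_degree :: "'n::finite at_poly \<Rightarrow> nat" where
  "total_degree p = Max (insert 0 ((\<lambda>m. \<Sum>v\<in>UNIV. Poly_Mapping.lookup m v) ` Poly_Mapping.keys p))"

text \<open>The library's \<open>coprime\<close> needs division operations that this ring does not provide.\<close>
definition poly_coprime :: "'n::finite at_poly \<Rightarrow> 'n at_poly \<Rightarrow> bool" where
  "poly_coprime p q \<longleftrightarrow> (\<forall>r. r dvd p \<longrightarrow> r dvd q \<longrightarrow> r dvd 1)"

definition fraction_on ::
    "((real^'n) \<times> real) set \<Rightarrow> (real^'n \<Rightarrow> real \<Rightarrow> real) \<Rightarrow> 'n at_poly \<Rightarrow> 'n at_poly \<Rightarrow> bool" where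
  "fraction_on P F p q \<longleftrightarrow>
     (\<forall>(a, t)\<in>P. poly_eval q a t \<noteq> 0 \<and> F a t = poly_eval p a t / poly_eval q a t)"

definition piecewise_rational ::
    "((real^'n) \<times> real) set \<Rightarrow> ((real^'n) \<times> real) set set \<Rightarrow> (real^'n \<Rightarrow> real \<Rightarrow> real) \<Rightarrow> bool" where
  "piecewise_rational D \<P> F \<longleftrightarrow>
     finite \<P> \<and> pairwise disjnt \<P> \<and> \<Union>\<P> \<subseteq> D \<and> D \<subseteq> closure (\<Union>\<P>) \<and>
     (\<forall>P\<in>\<P>. \<exists>p q. fraction_on P F p q)"

text \<open>
  Modulo \<open>\<parallel>a\<parallel>\<^sup>2 = 1\<close> a function on a chamber has many rational expressions, of different degrees.
  The expression is unique on the open cone over the chamber: slices and slabs depend only on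
  the ray through \<open>(a,t)\<close>, and for arbitrary \<open>a \<noteq> 0\<close> slab integrals are rational in \<open>(a,t)\<close>
  while slice integrals are \<open>\<parallel>a\<parallel>\<close> times a rational function of \<open>(a,t)\<close>.
\<close>
definition cone_over :: "((real^'n) \<times> real) set \<Rightarrow> ((real^'n) \<times> real) set" where
  "cone_over C = {(r *\<^sub>R a, r * t) |r a t. r > 0 \<and> (a, t) \<in> C}"

definition has_rational_degree ::
    "((real^'n) \<times> real) set \<Rightarrow> (real^'n \<Rightarrow> real \<Rightarrow> real) \<Rightarrow> int \<Rightarrow> bool" where
  "has_rational_degree P F k \<longleftrightarrow>
     (\<exists>p q. poly_coprime p q \<and> fraction_on P F p q) \<and>
     (\<forall>p q. poly_coprime p q \<and> fraction_on P F p q \<longrightarrow>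
        int (total_degree p) - int (total_degree q) = k)"

text \<open>The factor \<open>1 / \<parallel>a\<parallel>\<close> is \<open>1\<close> on the sphere.\<close>
definition slice_degree ::
    "((real^'n) \<times> real) set \<Rightarrow> (real^'n \<Rightarrow> real \<Rightarrow> real) \<Rightarrow> int \<Rightarrow> bool" where
  "slice_degree C F k \<longleftrightarrow> has_rational_degree (cone_over C) (\<lambda>a t. F a t / norm a) k"

definition slab_degree ::
    "((real^'n) \<times> real) set \<Rightarrow> (real^'n \<Rightarrow> real \<Rightarrow> real) \<Rightarrow> int \<Rightarrow> bool" where
  "slab_degree C F k \<longleftrightarrow> has_rational_degree (cone_over C) F k"

end

theory Submission
  imports Defs
begin

text \<open>
  Integrating one coordinate at a time, and by parts where the weight \<open>x\<^sub>i\<^sup>M\<close> occurs, expresses the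
  \<open>M\<close>-th moment of \<open>{x \<in> cube. \<langle>a,x\<rangle> \<le> s}\<close> as a signed sum over the vertices \<open>v\<close> of truncated powers
  of \<open>s - \<langle>a,v\<rangle>\<close>, with coefficients that are rational in \<open>a\<close>. A slab is a difference of two half-spaces.
  By Fubini in orthonormal coordinates whose first axis is the direction of \<open>a\<close>, the slice moment is
  \<open>\<parallel>a\<parallel>\<close> times the derivative in \<open>s\<close>. On a chamber the set of vertices with \<open>\<langle>a,v\<rangle> < s\<close> is constant, so
  there each truncated power is either a power or zero, and the sum is a rational function.

  On the open cone over a chamber the slab expressions are homogeneous of degree \<open>0\<close> and the slice
  expressions (divided by \<open>\<parallel>a\<parallel>\<close>) of degree \<open>-1\<close>, whatever \<open>M\<close> is. The degree of a non-zero homogeneous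
  rational function is its degree of homogeneity. A slab moment may vanish identically, but the zero
  function has degree \<open>0\<close> too. A slice moment does not vanish identically: otherwise, putting \<open>a\<^sub>i = 0\<close>
  and comparing coefficients, the vertices with \<open>\<langle>a,v\<rangle> < s\<close> would sum to \<open>0\<close>, and hence so would
  those with \<open>\<langle>a,v\<rangle> > s > 0\<close>.
\<close>


section \<open>Polynomial functions of \<open>(a,t)\<close>\<close>

text \<open>The vertex formula needs all \<open>a $ i\<close> non-zero and \<open>t/2\<close>
  different from every vertex value. Neither exceptional set meets a chamber: the coordinate axes
  are differences of vertices, so the coordinate hyperplanes are sweep hyperplanes. Differentiating
  in \<open>s\<close> needs continuity of the slice integral; it holds because almost no point of
  the slice lies on the boundary of the cube.

  Chambers are given by components and by positions in a sorted list. They are first recognised as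
  cells cut out by strict linear inequalities in \<open>(a,t)\<close>, from which openness, the cone
  structure and finiteness are immediate.

  No reduced form is ever computed. A fraction \<open>p / q\<close> is tested only along a ray that
  is generic for \<open>p\<close> and \<open>q\<close>, so it is enough that the function is
  homogeneous. Each integration by parts raises a truncated power by one order and divides by one
  factor \<open>a $ i\<close>, which leaves the degree of homogeneity unchanged; this is why
  \<open>M\<close> does not enter it.\<close>

definition coord :: "(real^'n) \<times> real \<Rightarrow> 'n option \<Rightarrow> real" where
  "coord z v = (case v of None \<Rightarrow> snd z | Some i \<Rightarrow> fst z $ i)"

definition monomial_at :: "('n::finite option \<Rightarrow>\<^sub>0 nat) \<Rightarrow> (real^'n) \<times> real \<Rightarrow> real" where
  "monomial_at m z = (\<Prod>v\<in>UNIV. coord z v ^ Poly_Mapping.lookup m v)"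

definition mono_degree :: "('n::finite option \<Rightarrow>\<^sub>0 nat) \<Rightarrow> nat" where
  "mono_degree m = (\<Sum>v\<in>UNIV. Poly_Mapping.lookup m v)"

abbreviation poly_at :: "'n::finite at_poly \<Rightarrow> (real^'n) \<times> real \<Rightarrow> real" where
  "poly_at p z \<equiv> poly_eval p (fst z) (snd z)"

lemma coord_simps [simp]: "coord z None = snd z" "coord z (Some i) = fst z $ i"
  by (auto simp: coord_def)

lemma coord_add: "coord (x + y) v = coord x v + coord y v"
  and coord_scaleR: "coord (s *\<^sub>R x) v = s * coord x v"
  by (auto simp: coord_def split: option.split)

lemma monomial_at_0 [simp]: "monomial_at 0 z = 1"
  by (simp add: monomial_at_def)

lemma monomial_at_add: "monomial_at (m + n) z = monomial_at m z * monomial_at n z"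
  by (simp add: monomial_at_def lookup_add power_add prod.distrib)

lemma monomial_at_scaleR: "monomial_at m (s *\<^sub>R z) = s ^ mono_degree m * monomial_at m z"
  by (simp add: monomial_at_def coord_scaleR power_mult_distrib prod.distrib mono_degree_def power_sum)

lemma poly_at_eq:
  assumes "finite K" "Poly_Mapping.keys p \<subseteq> K"
  shows "poly_at p z = (\<Sum>m\<in>K. Poly_Mapping.lookup p m * monomial_at m z)"
proof -
  have "poly_at p z = (\<Sum>m\<in>Poly_Mapping.keys p. Poly_Mapping.lookup p m * monomial_at m z)"
    by (simp add: poly_eval_def monomial_at_def coord_def)
  also have "\<dots> = (\<Sum>m\<in>K. Poly_Mapping.lookup p m * monomial_at m z)"
    using assms by (intro sum.mono_neutral_left) (auto simp: in_keys_iff)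
  finally show ?thesis .
qed

lemma poly_at_keys:
  "poly_at p z = (\<Sum>m\<in>Poly_Mapping.keys p. Poly_Mapping.lookup p m * monomial_at m z)"
  by (rule poly_at_eq) auto

lemma poly_at_0 [simp]: "poly_at 0 z = 0"
  by (simp add: poly_at_keys)

lemma poly_at_add: "poly_at (p + q) z = poly_at p z + poly_at q z"
  using poly_at_eq[of "Poly_Mapping.keys p \<union> Poly_Mapping.keys q" p z]
    poly_at_eq[of "Poly_Mapping.keys p \<union> Poly_Mapping.keys q" q z]
    poly_at_eq[of "Poly_Mapping.keys p \<union> Poly_Mapping.keys q" "p + q" z]
  by (simp add: Poly_Mapping.keys_add lookup_add algebra_simps sum.distrib)

lemma poly_at_single: "poly_at (Poly_Mapping.single m c) z = c * monomial_at m z"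
  by (simp add: poly_at_eq[of "{m}"])

lemma poly_at_sum: "poly_at (\<Sum>i\<in>I. p i) z = (\<Sum>i\<in>I. poly_at (p i) z)"
  by (induction I rule: infinite_finite_induct) (auto simp: poly_at_add)

lemma poly_mapping_sum_single:
  "p = (\<Sum>m\<in>Poly_Mapping.keys p. Poly_Mapping.single m (Poly_Mapping.lookup p m))"
proof (rule poly_mapping_eqI)
  fix k
  have "(\<Sum>m\<in>Poly_Mapping.keys p. Poly_Mapping.lookup (Poly_Mapping.single m (Poly_Mapping.lookup p m)) k)
      = (\<Sum>m\<in>Poly_Mapping.keys p. if m = k then Poly_Mapping.lookup p m else 0)"
    by (intro sum.cong) (auto simp: lookup_single when_def)
  also have "\<dots> = Poly_Mapping.lookup p k"
    by (auto simp: in_keys_iff)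
  finally show "Poly_Mapping.lookup p k = Poly_Mapping.lookup
      (\<Sum>m\<in>Poly_Mapping.keys p. Poly_Mapping.single m (Poly_Mapping.lookup p m)) k"
    by (simp add: lookup_sum)
qed

lemma poly_at_mult: "poly_at (p * q) z = poly_at p z * poly_at q z"
proof -
  have "p * q = (\<Sum>m\<in>Poly_Mapping.keys p. \<Sum>n\<in>Poly_Mapping.keys q.
      Poly_Mapping.single (m + n) (Poly_Mapping.lookup p m * Poly_Mapping.lookup q n))"
    by (subst poly_mapping_sum_single[of p], subst poly_mapping_sum_single[of q])
      (simp add: sum_product mult_single)
  then show ?thesis
    by (simp add: poly_at_sum poly_at_single poly_at_keys[of p] poly_at_keys[of q]
        sum_product monomial_at_add mult_ac)
qed

text \<open>Only values enter \<open>fraction_on\<close>, so numerators and denominators are handled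
  as functions and built with the closure rules below; \<open>fraction_on_polyfun\<close> chooses
  the underlying \<open>at_poly\<close>.\<close>

definition polyfun :: "((real^'n::finite) \<times> real \<Rightarrow> real) \<Rightarrow> bool" where
  "polyfun f \<longleftrightarrow> (\<exists>p. \<forall>z. f z = poly_at p z)"

lemma polyfun_const [intro, simp]: "polyfun (\<lambda>z. c)"
  unfolding polyfun_def by (rule exI[of _ "Poly_Mapping.single 0 c"]) (simp add: poly_at_single)

lemma polyfun_coord [intro, simp]: "polyfun (\<lambda>z. coord z v)"
  unfolding polyfun_def
proof (rule exI[of _ "Poly_Mapping.single (Poly_Mapping.single v 1) 1"], rule allI)
  fix z :: "(real^'a) \<times> real"
  have "monomial_at (Poly_Mapping.single v 1) z = (\<Prod>w\<in>UNIV. if w = v then coord z w else 1)"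
    unfolding monomial_at_def by (intro prod.cong) (auto simp: lookup_single when_def)
  then show "coord z v = poly_at (Poly_Mapping.single (Poly_Mapping.single v 1) 1) z"
    by (simp add: poly_at_single)
qed

lemma polyfun_snd [intro, simp]: "polyfun snd" and polyfun_nth [intro, simp]: "polyfun (\<lambda>z. fst z $ i)"
  using polyfun_coord[of None] polyfun_coord[of "Some i"] by auto

lemma polyfun_add [intro]: "polyfun f \<Longrightarrow> polyfun g \<Longrightarrow> polyfun (\<lambda>z. f z + g z)"
  unfolding polyfun_def using poly_at_add by metis

lemma polyfun_mult [intro]: "polyfun f \<Longrightarrow> polyfun g \<Longrightarrow> polyfun (\<lambda>z. f z * g z)"
  unfolding polyfun_def using poly_at_mult by metis

lemma polyfun_diff [intro]: "polyfun f \<Longrightarrow> polyfun g \<Longrightarrow> polyfun (\<lambda>z. f z - g z)"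
  using polyfun_add[of f "\<lambda>z. -1 * g z"] polyfun_mult[of "\<lambda>_. -1" g] by simp

lemma polyfun_sum [intro]: "(\<And>i. i \<in> I \<Longrightarrow> polyfun (f i)) \<Longrightarrow> polyfun (\<lambda>z. \<Sum>i\<in>I. f i z)"
  by (induction I rule: infinite_finite_induct) auto

lemma polyfun_prod [intro]: "(\<And>i. i \<in> I \<Longrightarrow> polyfun (f i)) \<Longrightarrow> polyfun (\<lambda>z. \<Prod>i\<in>I. f i z)"
  by (induction I rule: infinite_finite_induct) auto

lemma polyfun_power [intro]: "polyfun f \<Longrightarrow> polyfun (\<lambda>z. f z ^ k)"
  by (induction k) auto

lemma polyfun_divide_const [intro]: "polyfun f \<Longrightarrow> polyfun (\<lambda>z. f z / c)"
  using polyfun_mult[of f "\<lambda>_. inverse c"] by (simp add: field_simps)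

section \<open>Linear independence of monomials and zeros of polynomials on open sets\<close>

definition monosum :: "('n::finite option \<Rightarrow>\<^sub>0 nat) set \<Rightarrow> (('n option \<Rightarrow>\<^sub>0 nat) \<Rightarrow> real) \<Rightarrow> (real^'n) \<times> real \<Rightarrow> real"
  where "monosum K c z = (\<Sum>m\<in>K. c m * monomial_at m z)"

lemma continuous_on_coord [continuous_intros]: "continuous_on S (\<lambda>z. coord z v)"
  by (cases v) (auto intro!: continuous_intros)

lemma continuous_on_monosum: "continuous_on S (monosum K c)"
  unfolding monosum_def monomial_at_def by (intro continuous_intros)

text \<open>Induction on the variables: a polynomial in one further variable that vanishes identically
  has coefficients that vanish identically.\<close>
lemma independent_power_products:
  fixes c :: "('v \<Rightarrow> nat) \<Rightarrow> real"
  assumes "finite V" "finite K" "\<And>m m' v. m \<in> K \<Longrightarrow> m' \<in> K \<Longrightarrow> v \<notin> V \<Longrightarrow> m v = m' v"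
    and "\<And>x. (\<Sum>m\<in>K. c m * (\<Prod>v\<in>V. x v ^ m v)) = 0" and "m \<in> K"
  shows "c m = 0"
  using assms
proof (induction V arbitrary: K m rule: finite_induct)
  case empty
  have "m' = m" if "m' \<in> K" for m'
    using empty.prems(2)[OF that \<open>m \<in> K\<close>] by (intro ext) simp
  then have "K = {m}" using \<open>m \<in> K\<close> by blast
  then show ?case using empty.prems(3) by simp
next
  case (insert w V)
  define k where "k = m w"
  let ?K = "\<lambda>k. {m\<in>K. m w = k}"
  have z: "(\<Sum>m\<in>?K k. c m * (\<Prod>v\<in>V. x v ^ m v)) = 0" for x
  proof -
    define r where "r = (\<Sum>m\<in>K. monom (c m * (\<Prod>v\<in>V. x v ^ m v)) (m w))"
    have "poly r s = 0" for s
    proof -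
      have "poly r s = (\<Sum>m\<in>K. c m * (\<Prod>v\<in>insert w V. (x(w := s)) v ^ m v))"
        unfolding r_def poly_sum
      proof (intro sum.cong refl)
        fix m assume "m \<in> K"
        have "(\<Prod>v\<in>V. (x(w := s)) v ^ m v) = (\<Prod>v\<in>V. x v ^ m v)"
          using insert.hyps by (intro prod.cong) auto
        then show "poly (monom (c m * (\<Prod>v\<in>V. x v ^ m v)) (m w)) s
            = c m * (\<Prod>v\<in>insert w V. (x(w := s)) v ^ m v)"
          using insert.hyps by (simp add: poly_monom)
      qed
      then show ?thesis using insert.prems(3)[of "x(w := s)"] by simp
    qed
    then have "r = 0" using poly_all_0_iff_0 by blast
    then have "coeff r k = 0" by simp
    also have "coeff r k = (\<Sum>m\<in>K. if m w = k then c m * (\<Prod>v\<in>V. x v ^ m v) else 0)"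
      unfolding r_def coeff_sum by (intro sum.cong) auto
    also have "\<dots> = (\<Sum>m\<in>?K k. c m * (\<Prod>v\<in>V. x v ^ m v))"
      using insert.prems(1) by (simp add: sum.If_cases Int_def)
    finally show ?thesis .
  qed
  show ?case
  proof (rule insert.IH[of "?K k"])
    fix m1 m2 v assume "m1 \<in> ?K k" "m2 \<in> ?K k" "v \<notin> V"
    then show "m1 v = m2 v"
      using insert.prems(2)[of m1 m2 v] by (cases "v = w") auto
  next
    show "m \<in> ?K k" using insert.prems(4) k_def by simp
    show "finite (?K k)" using insert.prems(1) by simp
  qed (rule z)
qed

text \<open>Reading monomials as exponent functions is injective, so the independence of power
  products applies to every selection \<open>K\<close> of monomials.\<close>

lemma monosum_nonzero_somewhere:
  assumes "finite K" "m \<in> K" "c m \<noteq> 0"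
  obtains z where "monosum K c z \<noteq> 0"
proof (rule ccontr)
  assume "\<not> thesis"
  then have all0: "monosum K c z = 0" for z using that by blast
  let ?L = "Poly_Mapping.lookup"
  have inj: "inj_on ?L K" by (meson inj_onI poly_mapping_eq_iff)
  have "(c \<circ> inv_into K ?L) (?L m) = 0"
  proof (rule independent_power_products[where V = UNIV and K = "?L ` K"])
    fix x :: "'a option \<Rightarrow> real"
    have "monosum K c (\<chi> i. x (Some i), x None) = (\<Sum>m\<in>?L ` K. (c \<circ> inv_into K ?L) m * (\<Prod>v\<in>UNIV. x v ^ m v))"
    proof -
      have "coord (\<chi> i. x (Some i), x None) v = x v" for v by (cases v) auto
      then show ?thesis
        using inj by (simp add: monosum_def sum.reindex monomial_at_def inv_into_f_f)
    qed
    then show "(\<Sum>m\<in>?L ` K. (c \<circ> inv_into K ?L) m * (\<Prod>v\<in>UNIV. x v ^ m v)) = 0" 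
      using all0 by simp
  next
    show "finite (?L ` K)" "?L m \<in> ?L ` K" using assms(1,2) by auto
  next
    fix m m' v assume "v \<notin> (UNIV :: 'a option set)"
    then show "m v = m' v" by simp
  qed simp
  then show False using assms(2,3) inj by (simp add: inv_into_f_f)
qed

lemma monosum_along_line:
  "\<exists>r. \<forall>s. poly r s = monosum K c (x + s *\<^sub>R y)"
  by (rule exI[of _ "\<Sum>m\<in>K. smult (c m) (\<Prod>v\<in>UNIV. [:coord x v, coord y v:] ^ Poly_Mapping.lookup m v)"])
    (simp add: monosum_def poly_sum poly_prod monomial_at_def coord_add coord_scaleR)

text \<open>Join \<open>u\<close> to a point where the sum is non-zero. On this line it is a
  non-zero univariate polynomial with finitely many roots, whereas infinitely many parameters near
  \<open>0\<close> stay in \<open>U\<close>.\<close>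

lemma monosum_nonzero_in_open:
  assumes "finite K" "m \<in> K" "c m \<noteq> 0" "open U" "u \<in> U"
  obtains z where "z \<in> U" "monosum K c z \<noteq> 0"
proof -
  obtain y where y: "monosum K c y \<noteq> 0" using monosum_nonzero_somewhere[of K m c] assms(1-3) by blast
  obtain r where r: "\<And>s. poly r s = monosum K c (u + s *\<^sub>R (y - u))"
    using monosum_along_line by blast
  have "poly r 1 \<noteq> 0" using y r by simp
  then have "r \<noteq> 0" by auto
  then have fin: "finite {s. poly r s = 0}" by (rule poly_roots_finite)
  have "open ((\<lambda>s. u + s *\<^sub>R (y - u)) -` U)"
    by (intro open_vimage assms continuous_intros)
  moreover have "0 \<in> (\<lambda>s. u + s *\<^sub>R (y - u)) -` U" using assms by simp
  ultimately have "infinite ((\<lambda>s. u + s *\<^sub>R (y - u)) -` U)"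
    by (metis finite_imp_not_open empty_iff)
  then obtain s where "s \<in> (\<lambda>s. u + s *\<^sub>R (y - u)) -` U" "poly r s \<noteq> 0"
    using fin by (metis (mono_tags, lifting) finite_subset mem_Collect_eq subsetI)
  then show thesis using that r by auto
qed

lemma poly_at_monosum: "poly_at p z = monosum (Poly_Mapping.keys p) (Poly_Mapping.lookup p) z"
  by (simp add: poly_at_keys monosum_def)

lemma poly_at_zero_on_open:
  assumes "open U" "u \<in> U" "\<And>z. z \<in> U \<Longrightarrow> poly_at p z = 0"
  shows "p = 0"
proof (rule ccontr)
  assume "p \<noteq> 0"
  then obtain m where m: "m \<in> Poly_Mapping.keys p"
    by (metis all_not_in_conv keys_eq_empty)
  then have "Poly_Mapping.lookup p m \<noteq> 0" by (simp add: in_keys_iff)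
  then obtain z where "z \<in> U" "monosum (Poly_Mapping.keys p) (Poly_Mapping.lookup p) z \<noteq> 0"
    using monosum_nonzero_in_open[of "Poly_Mapping.keys p" m "Poly_Mapping.lookup p" U u] assms m
      finite_keys by blast
  then show False using assms(3) by (simp only: poly_at_monosum)
qed

lemma polyfun_zero_on_open:
  assumes "polyfun f" "open U" "u \<in> U" "\<And>z. z \<in> U \<Longrightarrow> f z = 0"
  shows "f z = 0"
proof -
  obtain p where p: "\<And>z. f z = poly_at p z" using assms(1) unfolding polyfun_def by blast
  then have "p = 0" using poly_at_zero_on_open[OF assms(2,3), of p] assms(4) by simp
  then show ?thesis using p by simp
qed

section \<open>Degrees of rational functions\<close>

text \<open>The univariate polynomial \<open>s \<mapsto> p(s z)\<close>: its coefficient at degree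
  \<open>k\<close> is the homogeneous part of \<open>p\<close> of degree \<open>k\<close>, evaluated
  at \<open>z\<close>.\<close>

definition radial :: "'n::finite at_poly \<Rightarrow> (real^'n) \<times> real \<Rightarrow> real poly" where
  "radial p z = (\<Sum>m\<in>Poly_Mapping.keys p. monom (Poly_Mapping.lookup p m * monomial_at m z) (mono_degree m))"

lemma poly_radial: "poly (radial p z) s = poly_at p (s *\<^sub>R z)"
  by (simp add: radial_def poly_sum poly_monom poly_at_keys[of p "s *\<^sub>R z", simplified]
      monomial_at_scaleR[of _ s z, simplified] mult_ac)

lemma radial_mult: "radial (p * q) z = radial p z * radial q z"
proof -
  have "poly (radial (p * q) z) = poly (radial p z * radial q z)"
    by (rule ext) (simp only: poly_radial poly_at_mult poly_mult)
  then show ?thesis by (simp only: poly_eq_poly_eq_iff)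
qed

lemma total_degree_eq_Max: "total_degree p = Max (insert 0 (mono_degree ` Poly_Mapping.keys p))"
  by (simp add: total_degree_def mono_degree_def)

lemma mono_degree_le_total_degree: "m \<in> Poly_Mapping.keys p \<Longrightarrow> mono_degree m \<le> total_degree p"
  unfolding total_degree_eq_Max by (rule Max_ge) auto

lemma total_degree_attained:
  assumes "p \<noteq> 0"
  obtains m where "m \<in> Poly_Mapping.keys p" "mono_degree m = total_degree p"
proof -
  have ne: "Poly_Mapping.keys p \<noteq> {}" using assms by (simp add: keys_eq_empty)
  have "Max (mono_degree ` Poly_Mapping.keys p) \<in> mono_degree ` Poly_Mapping.keys p"
    using ne by (intro Max_in) auto
  moreover have "total_degree p = Max (mono_degree ` Poly_Mapping.keys p)"
    unfolding total_degree_eq_Max using ne by (subst Max_insert) auto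
  ultimately show thesis using that by auto
qed

lemma degree_radial_le: "degree (radial p z) \<le> total_degree p"
  unfolding radial_def
  by (intro degree_sum_le order_trans[OF degree_monom_le] mono_degree_le_total_degree) auto

text \<open>The coefficient of top degree is a non-zero polynomial in \<open>z\<close>, so it is
  non-zero on an open part of \<open>U\<close>. An open set is returned rather than a point, so that
  several polynomials can be made generic one inside the other.\<close>

lemma degree_radial_generic:
  assumes "p \<noteq> 0" "open U" "U \<noteq> {}"
  shows "\<exists>V. open V \<and> V \<noteq> {} \<and> V \<subseteq> U \<and>
    (\<forall>z\<in>V. degree (radial p z) = total_degree p \<and> poly_at p z \<noteq> 0)"
proof -
  let ?c = "Poly_Mapping.lookup p"
  \<comment> \<open>The keys of the top homogeneous part; \<open>monosum\<close> allows such a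
    subset of the keys.\<close>
  define K where "K = {m\<in>Poly_Mapping.keys p. mono_degree m = total_degree p}"
  obtain m where m: "m \<in> Poly_Mapping.keys p" "mono_degree m = total_degree p"
    using total_degree_attained[OF assms(1)] by blast
  have nz: "?c m \<noteq> 0" and mK: "m \<in> K" using m by (auto simp: in_keys_iff K_def)
  have finK: "finite K" unfolding K_def by simp
  have coeff: "coeff (radial p z) (total_degree p) = monosum K ?c z" for z
  proof -
    have "coeff (radial p z) (total_degree p) =
       (\<Sum>m\<in>Poly_Mapping.keys p. if mono_degree m = total_degree p then ?c m * monomial_at m z else 0)"
      unfolding radial_def coeff_sum by (intro sum.cong) auto
    then show ?thesis unfolding monosum_def K_def by (simp add: sum.If_cases Int_def)
  qed
  obtain u where "u \<in> U" using assms by blast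
  then obtain z1 where z1: "z1 \<in> U" "monosum K ?c z1 \<noteq> 0"
    using monosum_nonzero_in_open[of K m ?c U u] finK mK nz assms by blast
  define V1 where "V1 = U \<inter> {z. monosum K ?c z \<noteq> 0}"
  have op: "open {z. monosum L ?c z \<noteq> 0}" for L
    by (intro open_Collect_neq continuous_on_monosum continuous_intros)
  have V1: "open V1" "z1 \<in> V1" unfolding V1_def using assms op z1 by auto
  then obtain z2 where z2: "z2 \<in> V1" "monosum (Poly_Mapping.keys p) ?c z2 \<noteq> 0"
    using monosum_nonzero_in_open[of "Poly_Mapping.keys p" m ?c V1 z1] m nz finite_keys by blast
  define V where "V = V1 \<inter> {z. monosum (Poly_Mapping.keys p) ?c z \<noteq> 0}"
  have "open V" unfolding V_def using V1(1) op by (rule open_Int)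
  moreover have "V \<noteq> {}" "V \<subseteq> U" using z2 unfolding V_def V1_def by blast+
  moreover have "degree (radial p z) = total_degree p" "poly_at p z \<noteq> 0" if z: "z \<in> V" for z
  proof -
    have "coeff (radial p z) (total_degree p) \<noteq> 0" using z by (simp add: coeff V_def V1_def)
    then show "degree (radial p z) = total_degree p"
      using degree_radial_le[of p z] le_degree[of "radial p z"] by (simp add: order_antisym)
    show "poly_at p z \<noteq> 0" using z unfolding poly_at_monosum V_def by blast
  qed
  ultimately show ?thesis by blast
qed

section \<open>Products, units and reduced fractions of multivariate polynomials\<close>

lemma at_poly_mult_nonzero:
  fixes p q :: "'n::finite at_poly"
  assumes "p \<noteq> 0" "q \<noteq> 0"
  shows "p * q \<noteq> 0"
proof
  assume *: "p * q = 0"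
  obtain V where V: "open V" "V \<noteq> {}" "\<forall>z\<in>V. degree (radial p z) = total_degree p \<and> poly_at p z \<noteq> 0"
    using degree_radial_generic[OF assms(1) open_UNIV UNIV_not_empty] by blast
  obtain W where W: "W \<noteq> {}" "W \<subseteq> V" "\<forall>z\<in>W. degree (radial q z) = total_degree q \<and> poly_at q z \<noteq> 0"
    using degree_radial_generic[OF assms(2) V(1,2)] by blast
  obtain z where "z \<in> W" using W(1) by blast
  then have "poly_at p z * poly_at q z \<noteq> 0" using V(3) W(2,3) by auto
  then show False using * by (metis poly_at_mult poly_at_0)
qed

text \<open>On a ray that is generic for \<open>p\<close>, \<open>q\<close> and \<open>p * q\<close>
  at once, all three total degrees are degrees of univariate polynomials, and those add.\<close>

lemma total_degree_mult:
  fixes p q :: "'n::finite at_poly"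
  assumes "p \<noteq> 0" "q \<noteq> 0"
  shows "total_degree (p * q) = total_degree p + total_degree q"
proof -
  obtain V where V: "open V" "V \<noteq> {}" "\<forall>z\<in>V. degree (radial p z) = total_degree p \<and> poly_at p z \<noteq> 0"
    using degree_radial_generic[OF assms(1) open_UNIV UNIV_not_empty] by blast
  obtain W where W: "open W" "W \<noteq> {}" "W \<subseteq> V"
      "\<forall>z\<in>W. degree (radial q z) = total_degree q \<and> poly_at q z \<noteq> 0"
    using degree_radial_generic[OF assms(2) V(1,2)] by blast
  obtain X where X: "X \<noteq> {}" "X \<subseteq> W"
      "\<forall>z\<in>X. degree (radial (p*q) z) = total_degree (p*q) \<and> poly_at (p*q) z \<noteq> 0"
    using degree_radial_generic[OF at_poly_mult_nonzero[OF assms] W(1,2)] by blast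
  obtain z where z: "z \<in> X" using X by blast
  \<comment> \<open>At \<open>s = 1\<close> the radial polynomial takes the value of the polynomial
    at \<open>z\<close>.\<close>
  have "poly (radial p z) 1 \<noteq> 0" "poly (radial q z) 1 \<noteq> 0"
    using z X(2) W(3,4) V(3) by (auto simp: poly_radial)
  then have "radial p z \<noteq> 0" "radial q z \<noteq> 0" by auto
  then have "degree (radial (p*q) z) = degree (radial p z) + degree (radial q z)"
    by (simp add: radial_mult degree_mult_eq)
  then show ?thesis using z X W(3,4) V(3) by (metis subsetD)
qed

lemma total_degree_1 [simp]: "total_degree 1 = 0" and total_degree_0 [simp]: "total_degree 0 = 0"
  by (auto simp: total_degree_def)

text \<open>Degrees add, so a divisor of \<open>1\<close> has degree \<open>0\<close>; conversely a
  polynomial of degree \<open>0\<close> has the empty monomial as its only key and is a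
  constant.\<close>

lemma at_poly_dvd_1_iff:
  fixes r :: "'n::finite at_poly"
  shows "r dvd 1 \<longleftrightarrow> r \<noteq> 0 \<and> total_degree r = 0"
proof
  assume "r dvd 1"
  then obtain s where s: "1 = r * s" unfolding dvd_def by blast
  then have "r \<noteq> 0" "s \<noteq> 0" by auto
  then have "total_degree r + total_degree s = 0"
    using total_degree_mult[of r s] s by (metis total_degree_1)
  then show "r \<noteq> 0 \<and> total_degree r = 0" using \<open>r \<noteq> 0\<close> by simp
next
  assume r: "r \<noteq> 0 \<and> total_degree r = 0"
  have "m = 0" if "m \<in> Poly_Mapping.keys r" for m
  proof -
    have "mono_degree m = 0" using mono_degree_le_total_degree[OF that] r by simp
    then have "\<forall>v. Poly_Mapping.lookup m v = 0" by (simp add: mono_degree_def)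
    then show ?thesis by (intro poly_mapping_eqI) simp
  qed
  moreover have "Poly_Mapping.keys r \<noteq> {}" using r by (simp add: keys_eq_empty)
  ultimately have k: "Poly_Mapping.keys r = {0}" by blast
  define c where "c = Poly_Mapping.lookup r 0"
  have rc: "r = Poly_Mapping.single 0 c"
    using poly_mapping_sum_single[of r] k by (simp add: c_def)
  then have "c \<noteq> 0" using r by auto
  then have "1 = r * Poly_Mapping.single 0 (1 / c)"
    by (simp add: rc mult_single)
  then show "r dvd 1" by (rule dvdI)
qed

text \<open>A denominator of least total degree is coprime to its numerator: cancelling a common
  factor that is not constant would lower the degree. This replaces a greatest common
  divisor.\<close>

lemma fraction_on_reduced:
  fixes p q :: "'n::finite at_poly"
  assumes "fraction_on P F p q" "P \<noteq> {}"
  obtains p' q' where "poly_coprime p' q'" "fraction_on P F p' q'"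
proof -
  obtain x where x: "fraction_on P F (fst x) (snd x)"
    and "\<forall>y. fraction_on P F (fst y) (snd y) \<longrightarrow> total_degree (snd x) \<le> total_degree (snd y)"
    using ex_has_least_nat[of "\<lambda>y. fraction_on P F (fst y) (snd y)" "(p, q)" "\<lambda>y. total_degree (snd y)"] assms(1)
    unfolding fst_conv snd_conv by blast
  then have least: "total_degree (snd x) \<le> total_degree (snd y)" if "fraction_on P F (fst y) (snd y)" for y
    using that by blast
  define p' where "p' = fst x"
  define q' where "q' = snd x"
  have "r dvd 1" if rp: "r dvd p'" and rq: "r dvd q'" for r
  proof -
    obtain s where s: "p' = r * s" using rp by (rule dvdE)
    obtain t where t: "q' = r * t" using rq by (rule dvdE)
    have ev: "poly_eval p' a u = poly_eval r a u * poly_eval s a u"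
         "poly_eval q' a u = poly_eval r a u * poly_eval t a u" for a u
      using poly_at_mult[of r s "(a, u)"] poly_at_mult[of r t "(a, u)"] s t by auto
    have "fraction_on P F s t"
      using x unfolding fraction_on_def p'_def[symmetric] q'_def[symmetric] ev by auto
    then have le: "total_degree q' \<le> total_degree t"
      using least[of "(s, t)"] by (simp add: q'_def)
    obtain a u where "(a, u) \<in> P" using assms(2) by auto
    then have "poly_eval q' a u \<noteq> 0"
      using x unfolding fraction_on_def q'_def by auto
    then have "q' \<noteq> 0" using poly_at_0[of "(a, u)"] by auto
    then have "r \<noteq> 0" "t \<noteq> 0" using t by auto
    then show ?thesis
      using total_degree_mult[of r t] le t by (simp add: at_poly_dvd_1_iff)
  qed
  then show thesis using that[of p' q'] x by (auto simp: poly_coprime_def p'_def q'_def)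
qed

text \<open>Here \<open>p\<close> vanishes on an open set, so \<open>p = 0\<close>. Everything
  divides \<open>0\<close>, hence coprimality turns \<open>q\<close> itself into a unit.\<close>

lemma has_rational_degree_zero:
  assumes "open P" "P \<noteq> {}" "\<And>a t. (a, t) \<in> P \<Longrightarrow> F a t = 0"
  shows "has_rational_degree P F 0"
  unfolding has_rational_degree_def
proof (intro conjI allI impI)
  have one: "poly_eval 1 a t = 1" "poly_eval 0 a t = 0" for a :: "real^'a" and t
    using poly_at_0[of "(a, t)"] poly_at_single[of 0 1 "(a, t)"] by auto
  have "poly_coprime 0 1" by (auto simp: poly_coprime_def)
  moreover have "fraction_on P F 0 1" using assms(3) by (auto simp: fraction_on_def one)
  ultimately show "\<exists>p q. poly_coprime p q \<and> fraction_on P F p q" by blast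
next
  fix p q :: "'a at_poly" assume *: "poly_coprime p q \<and> fraction_on P F p q"
  obtain z where z: "z \<in> P" using assms by blast
  have "poly_at p z = 0" if "z \<in> P" for z
  proof -
    have "poly_at q z \<noteq> 0 \<and> F (fst z) (snd z) = poly_at p z / poly_at q z"
      using * that unfolding fraction_on_def by (auto split: prod.splits)
    then show ?thesis using assms(3)[of "fst z" "snd z"] that by auto
  qed
  then have "p = 0" using poly_at_zero_on_open[OF assms(1) z] by blast
  then have "q dvd 1" using * unfolding poly_coprime_def by auto
  then show "int (total_degree p) - int (total_degree q) = 0"
    using \<open>p = 0\<close> by (simp add: at_poly_dvd_1_iff)
qed

text \<open>Along a generic ray both sides of \<open>p(sz) q(z) = s\<^sup>k p(z) q(sz)\<close> are univariate polynomials in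
  \<open>s\<close> whose degrees are \<open>total_degree p\<close> and \<open>k + total_degree q\<close>.\<close>
lemma has_rational_degree_homogeneous:
  fixes P :: "((real^'n::finite) \<times> real) set"
  assumes "open P" and cone: "\<And>r z. z \<in> P \<Longrightarrow> r > 0 \<Longrightarrow> r *\<^sub>R z \<in> P"
    and frac: "fraction_on P F p q"
    and hom: "\<And>r a t. (a, t) \<in> P \<Longrightarrow> r > 0 \<Longrightarrow> r ^ l * F (r *\<^sub>R a) (r * t) = r ^ m * F a t"
    and nz: "(a0, t0) \<in> P" "F a0 t0 \<noteq> 0"
  shows "has_rational_degree P F (int m - int l)"
  unfolding has_rational_degree_def
proof (intro conjI allI impI)
  show "\<exists>p q. poly_coprime p q \<and> fraction_on P F p q"
    using fraction_on_reduced[OF frac] nz by blast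
next
  fix p q :: "'n at_poly" assume *: "poly_coprime p q \<and> fraction_on P F p q"
  have fr: "poly_at q z \<noteq> 0" "F (fst z) (snd z) * poly_at q z = poly_at p z" if "z \<in> P" for z
    using * that unfolding fraction_on_def by (auto split: prod.splits)
  have p0: "p \<noteq> 0" and q0: "q \<noteq> 0"
    using fr[OF nz(1)] nz(2) poly_at_0[of "(a0, t0)"] by auto
  have "P \<noteq> {}" using nz by blast
  then obtain V where V: "open V" "V \<noteq> {}" "V \<subseteq> P"
      "\<forall>z\<in>V. degree (radial p z) = total_degree p \<and> poly_at p z \<noteq> 0"
    using degree_radial_generic[OF p0 assms(1)] by blast
  obtain W where W: "W \<noteq> {}" "W \<subseteq> V" "\<forall>z\<in>W. degree (radial q z) = total_degree q \<and> poly_at q z \<noteq> 0"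
    using degree_radial_generic[OF q0 V(1,2)] by blast
  obtain z where z: "z \<in> W" using W by blast
  then have zP: "z \<in> P" and pz: "poly_at p z \<noteq> 0" using V W by auto
  have Fz: "F (fst z) (snd z) \<noteq> 0" using fr(2)[OF zP] pz by auto
  \<comment> \<open>The power \<open>s ^ l\<close> stands on the side of \<open>p\<close>, so that a
    negative degree of homogeneity \<open>m - l\<close> still gives an identity of
    polynomials.\<close>
  define A where "A = monom 1 l * radial p z"
  define B where "B = monom (F (fst z) (snd z)) m * radial q z"
  have "poly A s = poly B s" if "s > 0" for s
  proof -
    have sz: "s *\<^sub>R z \<in> P" using cone zP that by auto
    have "s ^ l * F (s *\<^sub>R fst z) (s * snd z) = s ^ m * F (fst z) (snd z)"
      using hom[of "fst z" "snd z" s] zP that by auto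
    moreover have "F (s *\<^sub>R fst z) (s * snd z) * poly_at q (s *\<^sub>R z) = poly_at p (s *\<^sub>R z)"
      using fr(2)[OF sz] by simp
    ultimately have "s ^ l * poly_at p (s *\<^sub>R z) = s ^ m * F (fst z) (snd z) * poly_at q (s *\<^sub>R z)"
      by (metis mult.assoc)
    then show ?thesis by (simp only: A_def B_def poly_mult poly_monom poly_radial) (simp add: mult_ac)
  qed
  then have "{0<..} \<subseteq> {s. poly (A - B) s = 0}" by auto
  then have "infinite {s. poly (A - B) s = 0}"
    using infinite_Ioi[of "0::real"] finite_subset by blast
  then have "A - B = 0" using poly_roots_finite by blast
  then have "degree A = degree B" by simp
  moreover have rp: "radial p z \<noteq> 0"
    using poly_radial[of p z 1] pz by auto
  moreover have rq: "radial q z \<noteq> 0"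
    using poly_radial[of q z 1] fr(1)[OF zP] by auto
  ultimately have "l + total_degree p = m + total_degree q"
    using bspec[OF V(4), of z] bspec[OF W(3) z] subsetD[OF W(2) z] Fz rp rq
    by (simp add: A_def B_def degree_mult_eq degree_monom_eq)
  then show "int (total_degree p) - int (total_degree q) = int m - int l" by linarith
qed

section \<open>Truncated powers and box integrals\<close>

text \<open>Dividing by \<open>fact n\<close> makes each function the derivative of the next.
  \<open>trunc_pow 0\<close> is a step function with value \<open>1\<close> at \<open>0\<close>, so
  it describes closed half-spaces.\<close>

definition trunc_pow :: "nat \<Rightarrow> real \<Rightarrow> real" where
  "trunc_pow n y = (if y < 0 then 0 else y ^ n / fact n)"

lemma trunc_pow_eq_max: "trunc_pow (Suc n) y = max 0 y ^ Suc n / fact (Suc n)"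
  by (auto simp: trunc_pow_def max_def)

lemma continuous_on_trunc_pow: "continuous_on S (trunc_pow (Suc n))"
  unfolding trunc_pow_eq_max by (intro continuous_intros) auto

lemma trunc_pow_measurable [measurable]: "trunc_pow n \<in> borel_measurable borel"
  unfolding trunc_pow_def by measurable

text \<open>The point \<open>y = 0\<close> is excluded because \<open>trunc_pow 1\<close> has a kink
  there.\<close>

lemma has_field_derivative_trunc_pow:
  assumes "y \<noteq> 0"
  shows "(trunc_pow (Suc n) has_field_derivative trunc_pow n y) (at y)"
proof (cases "y < 0")
  case True
  have "((\<lambda>_. 0) has_field_derivative 0) (at y)" by simp
  moreover have "eventually (\<lambda>z. z < 0) (nhds y)" using True eventually_nhds_in_open[of "{..<0}" y] by auto
  ultimately have "(trunc_pow (Suc n) has_field_derivative 0) (at y)"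
    by (subst DERIV_cong_ev[where g = "\<lambda>_. 0"]) (auto elim!: eventually_mono simp: trunc_pow_def)
  then show ?thesis using True by (simp add: trunc_pow_def)
next
  case False
  have "((\<lambda>z. z ^ Suc n / fact (Suc n)) has_field_derivative (y ^ n / fact n)) (at y)"
  proof -
    have "((\<lambda>z. z ^ Suc n / fact (Suc n)) has_field_derivative (real (Suc n) * y ^ (Suc n - Suc 0) / fact (Suc n))) (at y)"
      by (intro DERIV_cdivide DERIV_pow)
    moreover have "real (Suc n) * y ^ (Suc n - Suc 0) / fact (Suc n) = y ^ n / fact n"
      unfolding fact_Suc by (simp del: of_nat_Suc)
    ultimately show ?thesis by (simp only:)
  qed
  moreover have "eventually (\<lambda>z. z > 0) (nhds y)" using False assms eventually_nhds_in_open[of "{0<..}" y] by auto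
  ultimately have "(trunc_pow (Suc n) has_field_derivative (y ^ n / fact n)) (at y)"
    by (subst DERIV_cong_ev[where g = "\<lambda>z. z ^ Suc n / fact (Suc n)"])
      (auto elim!: eventually_mono simp: trunc_pow_def)
  then show ?thesis using False by (simp add: trunc_pow_def)
qed

lemma trunc_pow_bound: "\<bar>y\<bar> \<le> K \<Longrightarrow> \<bar>trunc_pow n y\<bar> \<le> K ^ n"
proof -
  assume "\<bar>y\<bar> \<le> K"
  then have "\<bar>y\<bar> ^ n \<le> K ^ n" by (intro power_mono) auto
  moreover have "\<bar>trunc_pow n y\<bar> \<le> \<bar>y\<bar> ^ n / 1"
    using mult_left_mono[OF fact_ge_1[of n], of "y ^ n"]
    unfolding trunc_pow_def by (auto simp: divide_le_eq)
  ultimately show ?thesis by simp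
qed

text \<open>The boundary terms of repeatedly integrating \<open>x\<^sup>M\<close> by parts against a truncated power of a
  function with slope \<open>- \<alpha>\<close>.\<close>
definition ibp_term :: "nat \<Rightarrow> nat \<Rightarrow> real \<Rightarrow> real \<Rightarrow> real \<Rightarrow> real" where
  "ibp_term M n \<alpha> x y = (\<Sum>k\<le>M. fact M / fact (M - k) * x ^ (M - k) * trunc_pow (n + k) y / \<alpha> ^ k)"

lemma ibp_term_0 [simp]: "ibp_term 0 n \<alpha> x y = trunc_pow n y"
  by (simp add: ibp_term_def)

text \<open>The product rule gives two terms for each \<open>k\<close>. Differentiating the power of
  \<open>x\<close> in term \<open>k\<close> cancels what the truncated power contributes in term
  \<open>k + 1\<close>, so only the contribution of \<open>k = 0\<close> survives.\<close>

lemma has_field_derivative_ibp_term: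
  assumes "\<alpha> \<noteq> 0" "c - \<alpha> * x \<noteq> 0"
  shows "((\<lambda>x. - ibp_term M (Suc n) \<alpha> x (c - \<alpha> * x) / \<alpha>) has_field_derivative
      x ^ M * trunc_pow n (c - \<alpha> * x)) (at x)"
proof -
  let ?F = "fact :: nat \<Rightarrow> real"
  let ?T = "\<lambda>k. trunc_pow k (c - \<alpha> * x)"
  have T: "((\<lambda>x. trunc_pow (Suc k) (c - \<alpha> * x)) has_field_derivative ?T k * - \<alpha>) (at x)" for k
    by (rule DERIV_chain2[where f = "trunc_pow (Suc k)" and g = "\<lambda>x. c - \<alpha> * x",
          OF has_field_derivative_trunc_pow[OF assms(2)]])
      (auto intro!: derivative_eq_intros)
  have "((\<lambda>x. ibp_term M (Suc n) \<alpha> x (c - \<alpha> * x)) has_field_derivative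
     (\<Sum>k\<le>M. ?F M / ?F (M - k) * (of_nat (M - k) * x ^ (M - k - 1) * ?T (Suc (n + k)) +
         x ^ (M - k) * (?T (n + k) * - \<alpha>)) / \<alpha> ^ k)) (at x)"
    unfolding ibp_term_def add_Suc
  proof (rule DERIV_sum)
    fix k
    have p: "((\<lambda>x. x ^ (M - k)) has_field_derivative of_nat (M - k) * x ^ (M - k - 1)) (at x)"
      using DERIV_pow[of "M - k" x] by simp
    show "((\<lambda>x. ?F M / ?F (M - k) * x ^ (M - k) * trunc_pow (Suc (n + k)) (c - \<alpha> * x) / \<alpha> ^ k)
       has_field_derivative ?F M / ?F (M - k) * (of_nat (M - k) * x ^ (M - k - 1) * ?T (Suc (n + k)) +
         x ^ (M - k) * (?T (n + k) * - \<alpha>)) / \<alpha> ^ k) (at x)"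
      using DERIV_cdivide[OF DERIV_cmult[OF DERIV_mult[OF p T[of "n + k"]], of "?F M / ?F (M - k)"], of "\<alpha> ^ k"]
      by (simp add: mult_ac add.commute)
  qed
  \<comment> \<open>The telescoping form. The \<open>if\<close> supplies the value \<open>0\<close>
    at \<open>Suc M\<close>, where the truncated subtraction \<open>M - Suc M = 0\<close> would
    leave a spurious term.\<close>
  also have "(\<Sum>k\<le>M. ?F M / ?F (M - k) * (of_nat (M - k) * x ^ (M - k - 1) * ?T (Suc (n + k)) +
         x ^ (M - k) * (?T (n + k) * - \<alpha>)) / \<alpha> ^ k)
     = (\<Sum>k\<le>M. (\<lambda>k. if k \<le> M then - (?F M / ?F (M - k) * x ^ (M - k) * ?T (n + k) * \<alpha> / \<alpha> ^ k) else 0) k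
          - (\<lambda>k. if k \<le> M then - (?F M / ?F (M - k) * x ^ (M - k) * ?T (n + k) * \<alpha> / \<alpha> ^ k) else 0) (Suc k))"
  proof (intro sum.cong refl)
    fix k assume "k \<in> {..M}"
    then have k: "k \<le> M" by simp
    show "?F M / ?F (M - k) * (of_nat (M - k) * x ^ (M - k - 1) * ?T (Suc (n + k)) +
         x ^ (M - k) * (?T (n + k) * - \<alpha>)) / \<alpha> ^ k =
       (if k \<le> M then - (?F M / ?F (M - k) * x ^ (M - k) * ?T (n + k) * \<alpha> / \<alpha> ^ k) else 0) -
       (if Suc k \<le> M then - (?F M / ?F (M - Suc k) * x ^ (M - Suc k) * ?T (n + Suc k) * \<alpha> / \<alpha> ^ Suc k) else 0)"
    proof (cases "k = M")
      case False
      then obtain j where j: "M - k = Suc j" using k by (metis Suc_diff_Suc le_neq_implies_less)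
      then have j': "M - Suc k = j" by simp
      have k': "Suc k \<le> M" using k False by simp
      have f: "?F (Suc j) = of_nat (Suc j) * ?F j" by simp
      have n0: "?F j \<noteq> 0" "real (Suc j) \<noteq> 0" by simp_all
      show ?thesis unfolding j j' f using k k' assms(1) n0
        by (simp del: fact_Suc of_nat_Suc add: field_simps)
    qed simp
  qed
  also have "\<dots> = - (x ^ M * ?T n * \<alpha>)"
    by (subst sum_telescope) simp
  finally have "((\<lambda>x. - ibp_term M (Suc n) \<alpha> x (c - \<alpha> * x) / \<alpha>) has_field_derivative
      - (- (x ^ M * ?T n * \<alpha>)) / \<alpha>) (at x)"
    by (intro DERIV_cdivide DERIV_minus)
  then show ?thesis using assms(1) by simp
qed

abbreviation unit_ind :: "real \<Rightarrow> real" where "unit_ind \<equiv> indicator {-1/2..1/2}"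

text \<open>The antiderivative contains only truncated powers of positive order. It is therefore
  continuous, and differentiable except at \<open>c / \<alpha>\<close>, which is enough for the
  strong form of the fundamental theorem.\<close>

lemma trunc_pow_interval_integral:
  assumes "\<alpha> \<noteq> 0"
  shows "(\<integral>x. unit_ind x * (x ^ M * trunc_pow n (c - \<alpha> * x)) \<partial>lborel)
    = (ibp_term M (Suc n) \<alpha> (-1/2) (c + \<alpha> / 2) - ibp_term M (Suc n) \<alpha> (1/2) (c - \<alpha> / 2)) / \<alpha>"
proof -
  let ?f = "\<lambda>x. x ^ M * trunc_pow n (c - \<alpha> * x)"
  let ?G = "\<lambda>x. - ibp_term M (Suc n) \<alpha> x (c - \<alpha> * x) / \<alpha>"
  have "continuous_on {-1/2..1/2} ?G"
    unfolding ibp_term_def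
    by (intro continuous_intros continuous_on_compose2[OF continuous_on_trunc_pow[of UNIV]])
      (use assms in \<open>auto intro!: continuous_intros continuous_on_compose2[OF continuous_on_trunc_pow[of UNIV]]\<close>)
  then have "(?f has_integral (?G (1/2) - ?G (-1/2))) {-1/2..1/2}"
  proof (intro fundamental_theorem_of_calculus_strong[where S = "{c / \<alpha>}"])
    fix x assume "x \<in> {-1/2..1/2} - {c / \<alpha>}"
    then have "c - \<alpha> * x \<noteq> 0" using assms by (auto simp: field_simps)
    from has_field_derivative_ibp_term[OF assms this]
    show "(?G has_vector_derivative ?f x) (at x)"
      by (simp add: has_real_derivative_iff_has_vector_derivative)
  qed auto
  then have I: "integral {-1/2..1/2} ?f = ?G (1/2) - ?G (-1/2)" by (rule integral_unique)
  \<comment> \<open>Boundedness yields Lebesgue integrability, so that the gauge integral just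
    computed is also the Lebesgue integral.\<close>
  have bound: "\<bar>?f x\<bar> \<le> 1 * (\<bar>c\<bar> + \<bar>\<alpha>\<bar>) ^ n" if "x \<in> {-1/2..1/2}" for x
    unfolding abs_mult
  proof (intro mult_mono trunc_pow_bound)
    have x: "\<bar>x\<bar> \<le> 1" using that by auto
    then show "\<bar>x ^ M\<bar> \<le> 1" by (simp add: power_abs power_le_one)
    have "\<bar>\<alpha> * x\<bar> \<le> \<bar>\<alpha>\<bar>" using x by (simp add: abs_mult mult_left_le)
    then show "\<bar>c - \<alpha> * x\<bar> \<le> \<bar>c\<bar> + \<bar>\<alpha>\<bar>" by linarith
  qed auto
  have "set_integrable lborel {-1/2..1/2} ?f"
    unfolding set_integrable_def
  proof (rule integrableI_bounded_set_indicator[where B = "1 * (\<bar>c\<bar> + \<bar>\<alpha>\<bar>) ^ n"])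
    show "AE x in lborel. x \<in> {- 1 / 2..1 / 2} \<longrightarrow> norm (?f x) \<le> 1 * (\<bar>c\<bar> + \<bar>\<alpha>\<bar>) ^ n"
      using bound by (intro AE_I2) (simp only: real_norm_def, blast)
  qed auto
  from set_borel_integral_eq_integral(2)[OF this] I show ?thesis
    by (simp add: set_lebesgue_integral_def diff_divide_distrib)
qed


section \<open>Vertex sums for integrals over the unit box\<close>

interpretation lborel_product: product_sigma_finite "\<lambda>_::'i. lborel :: real measure"
  by standard

lemma integrable_on_unit_box:
  fixes g :: "('i \<Rightarrow> real) \<Rightarrow> real"
  assumes "finite I" and [measurable]: "g \<in> borel_measurable (PiM I (\<lambda>_. lborel))"
    and bound: "\<And>x. (\<And>j. j \<in> I \<Longrightarrow> \<bar>x j\<bar> \<le> 1/2) \<Longrightarrow> \<bar>g x\<bar> \<le> K"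
  shows "integrable (PiM I (\<lambda>_. lborel)) (\<lambda>x. (\<Prod>j\<in>I. unit_ind (x j)) * g x)"
proof (rule Bochner_Integration.integrable_bound)
  show "integrable (PiM I (\<lambda>_. lborel)) (\<lambda>x. \<bar>K\<bar> * (\<Prod>j\<in>I. unit_ind (x j)))"
    by (intro integrable_mult_right lborel_product.product_integrable_prod assms(1)) simp
  show "AE x in PiM I (\<lambda>_. lborel). norm ((\<Prod>j\<in>I. unit_ind (x j)) * g x)
      \<le> norm (\<bar>K\<bar> * (\<Prod>j\<in>I. unit_ind (x j)))"
  proof (rule AE_I2)
    fix x :: "'i \<Rightarrow> real"
    show "norm ((\<Prod>j\<in>I. unit_ind (x j)) * g x) \<le> norm (\<bar>K\<bar> * (\<Prod>j\<in>I. unit_ind (x j)))"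
    proof (cases "\<forall>j\<in>I. x j \<in> {-1/2..1/2}")
      case True
      then have "\<bar>g x\<bar> \<le> K" by (intro bound) (auto simp: abs_le_iff)
      then show ?thesis by (simp add: abs_mult mult.commute mult_right_mono)
    next
      case False
      then obtain j where "j \<in> I" "unit_ind (x j) = 0" by (auto simp: indicator_def)
      then have "(\<Prod>j\<in>I. unit_ind (x j)) = (0::real)" using assms(1) by (metis prod_zero)
      then show ?thesis by simp
    qed
  qed
qed simp

text \<open>A vertex is indexed by the set of its coordinates equal to \<open>1/2\<close>. Then
  \<open>- 2 * corner S j\<close> is the sign from the bounds of the \<open>j\<close>-th integral:
  plus at the lower end, minus at the upper end.\<close>

definition corner :: "'i set \<Rightarrow> 'i \<Rightarrow> real" where
  "corner S j = (if j \<in> S then 1/2 else -1/2)"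

lemma abs_scalar_prod_le:
  fixes x a :: "'i \<Rightarrow> real"
  assumes "\<And>j. j \<in> I \<Longrightarrow> \<bar>x j\<bar> \<le> 1/2"
  shows "\<bar>s - (\<Sum>j\<in>I. a j * x j)\<bar> \<le> \<bar>s\<bar> + (\<Sum>j\<in>I. \<bar>a j\<bar>)"
proof -
  have "\<bar>\<Sum>j\<in>I. a j * x j\<bar> \<le> (\<Sum>j\<in>I. \<bar>a j * x j\<bar>)" by (rule sum_abs)
  also have "\<dots> \<le> (\<Sum>j\<in>I. \<bar>a j\<bar>)"
    using assms by (intro sum_mono) (force simp: abs_mult intro: mult_left_le)
  finally show ?thesis by linarith
qed

lemma integrable_trunc_pow_box:
  fixes a :: "'i \<Rightarrow> real"
  assumes "finite I" "J \<subseteq> I" 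
  shows "integrable (PiM I (\<lambda>_. lborel))
     (\<lambda>x. (\<Prod>j\<in>I. unit_ind (x j)) * ((\<Sum>i\<in>J. x i ^ M) * trunc_pow n (s - (\<Sum>j\<in>I. a j * x j))))"
proof (rule integrable_on_unit_box[OF assms(1)])
  show "(\<lambda>x. (\<Sum>i\<in>J. x i ^ M) * trunc_pow n (s - (\<Sum>j\<in>I. a j * x j))) \<in> borel_measurable (PiM I (\<lambda>_. lborel))"
    using assms(2) by (auto intro!: measurable_compose[OF _ trunc_pow_measurable] borel_measurable_times
      borel_measurable_sum borel_measurable_power borel_measurable_diff)
  fix x :: "'i \<Rightarrow> real" assume x: "\<And>j. j \<in> I \<Longrightarrow> \<bar>x j\<bar> \<le> 1/2"
  show "\<bar>(\<Sum>i\<in>J. x i ^ M) * trunc_pow n (s - (\<Sum>j\<in>I. a j * x j))\<bar> \<le>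
      of_nat (card J) * (\<bar>s\<bar> + (\<Sum>j\<in>I. \<bar>a j\<bar>)) ^ n"
    unfolding abs_mult
  proof (intro mult_mono trunc_pow_bound abs_scalar_prod_le x)
    have "\<bar>\<Sum>i\<in>J. x i ^ M\<bar> \<le> (\<Sum>i\<in>J. \<bar>x i ^ M\<bar>)" by (rule sum_abs)
    also have "\<dots> \<le> (\<Sum>i\<in>J. 1)"
    proof (intro sum_mono)
      fix i assume "i \<in> J"
      then have "\<bar>x i\<bar> \<le> 1/2" using x assms(2) by auto
      then show "\<bar>x i ^ M\<bar> \<le> 1" by (simp add: power_abs power_le_one)
    qed
    finally show "\<bar>\<Sum>i\<in>J. x i ^ M\<bar> \<le> of_nat (card J)" by simp
  qed auto
qed

lemma integrable_trunc_pow_box0: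
  fixes a :: "'i \<Rightarrow> real"
  assumes "finite I"
  shows "integrable (PiM I (\<lambda>_. lborel))
     (\<lambda>x. (\<Prod>j\<in>I. unit_ind (x j)) * trunc_pow n (s - (\<Sum>j\<in>I. a j * x j)))"
proof (rule integrable_on_unit_box[OF assms])
  show "(\<lambda>x. trunc_pow n (s - (\<Sum>j\<in>I. a j * x j))) \<in> borel_measurable (PiM I (\<lambda>_. lborel))"
    by (auto intro!: measurable_compose[OF _ trunc_pow_measurable] borel_measurable_times
      borel_measurable_sum borel_measurable_diff)
  show "\<bar>trunc_pow n (s - (\<Sum>j\<in>I. a j * x j))\<bar> \<le> (\<bar>s\<bar> + (\<Sum>j\<in>I. \<bar>a j\<bar>)) ^ n"
    if "\<And>j. j \<in> I \<Longrightarrow> \<bar>x j\<bar> \<le> 1/2" for x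
    by (intro trunc_pow_bound abs_scalar_prod_le that)
qed

text \<open>Fubini in coordinate \<open>i\<close>: the inner integral is known by parts, its two
  boundary terms live on the facets \<open>x i = -1/2\<close> and \<open>x i = 1/2\<close>, and
  there the level \<open>s\<close> is shifted by \<open>a i / 2\<close>.\<close>

lemma box_integral_insert:
  fixes a :: "'i \<Rightarrow> real"
  assumes "finite I" "i \<notin> I" "a i \<noteq> 0"
  shows "(\<integral>x. (\<Prod>j\<in>insert i I. unit_ind (x j)) * (x i ^ M * trunc_pow n (s - (\<Sum>j\<in>insert i I. a j * x j)))
       \<partial>PiM (insert i I) (\<lambda>_. lborel))
   = (\<integral>x. (\<Prod>j\<in>I. unit_ind (x j)) * ((ibp_term M (Suc n) (a i) (-1/2) ((s + a i / 2) - (\<Sum>j\<in>I. a j * x j))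
        - ibp_term M (Suc n) (a i) (1/2) ((s - a i / 2) - (\<Sum>j\<in>I. a j * x j))) / a i) \<partial>PiM I (\<lambda>_. lborel))"
proof (subst lborel_product.product_integral_insert[OF assms(1,2)])
  show "integrable (Pi\<^sub>M (insert i I) (\<lambda>_. lborel))
     (\<lambda>x. (\<Prod>j\<in>insert i I. unit_ind (x j)) * (x i ^ M * trunc_pow n (s - (\<Sum>j\<in>insert i I. a j * x j))))"
    using integrable_trunc_pow_box[of "insert i I" "{i}" M n s a] assms(1) by simp
  show "(\<integral>x. (\<integral>y. (\<Prod>j\<in>insert i I. unit_ind ((x(i := y)) j)) *
        ((x(i := y)) i ^ M * trunc_pow n (s - (\<Sum>j\<in>insert i I. a j * (x(i := y)) j))) \<partial>lborel) \<partial>PiM I (\<lambda>_. lborel))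
   = (\<integral>x. (\<Prod>j\<in>I. unit_ind (x j)) * ((ibp_term M (Suc n) (a i) (-1/2) ((s + a i / 2) - (\<Sum>j\<in>I. a j * x j))
        - ibp_term M (Suc n) (a i) (1/2) ((s - a i / 2) - (\<Sum>j\<in>I. a j * x j))) / a i) \<partial>PiM I (\<lambda>_. lborel))"
  proof (intro Bochner_Integration.integral_cong refl)
    fix x :: "'i \<Rightarrow> real"
    let ?c = "s - (\<Sum>j\<in>I. a j * x j)"
    have 1: "(\<Prod>j\<in>I. unit_ind ((x(i := y)) j)) = (\<Prod>j\<in>I. unit_ind (x j))" for y
      using assms(2) by (intro prod.cong) auto
    have 2: "(\<Sum>j\<in>I. a j * (x(i := y)) j) = (\<Sum>j\<in>I. a j * x j)" for y
      using assms(2) by (intro sum.cong) auto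
    have "(\<integral>y. (\<Prod>j\<in>insert i I. unit_ind ((x(i := y)) j)) *
        ((x(i := y)) i ^ M * trunc_pow n (s - (\<Sum>j\<in>insert i I. a j * (x(i := y)) j))) \<partial>lborel)
      = (\<integral>y. (\<Prod>j\<in>I. unit_ind (x j)) * (unit_ind y * (y ^ M * trunc_pow n (?c - a i * y))) \<partial>lborel)"
      using assms(1,2) by (intro Bochner_Integration.integral_cong refl)
        (simp only: prod.insert sum.insert 1 2 fun_upd_same mult_ac diff_diff_eq add.commute not_False_eq_True)
    also have "\<dots> = (\<Prod>j\<in>I. unit_ind (x j)) * ((ibp_term M (Suc n) (a i) (-1/2) (?c + a i / 2)
        - ibp_term M (Suc n) (a i) (1/2) (?c - a i / 2)) / a i)"
      using trunc_pow_interval_integral[OF assms(3), of M n ?c] by simp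
    also have "?c + a i / 2 = (s + a i / 2) - (\<Sum>j\<in>I. a j * x j)" by simp
    also have "?c - a i / 2 = (s - a i / 2) - (\<Sum>j\<in>I. a j * x j)" by simp
    finally show "(\<integral>y. (\<Prod>j\<in>insert i I. unit_ind ((x(i := y)) j)) *
        ((x(i := y)) i ^ M * trunc_pow n (s - (\<Sum>j\<in>insert i I. a j * (x(i := y)) j))) \<partial>lborel)
      = (\<Prod>j\<in>I. unit_ind (x j)) * ((ibp_term M (Suc n) (a i) (-1/2) ((s + a i / 2) - (\<Sum>j\<in>I. a j * x j))
        - ibp_term M (Suc n) (a i) (1/2) ((s - a i / 2) - (\<Sum>j\<in>I. a j * x j))) / a i)" .
  qed
qed

lemma sum_Pow_insert:
  fixes f :: "'i set \<Rightarrow> real"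
  assumes "finite I" "i \<notin> I"
  shows "(\<Sum>S\<in>Pow (insert i I). f S) = (\<Sum>S\<in>Pow I. f S + f (insert i S))"
proof -
  have "inj_on (insert i) (Pow I)" using assms(2) by (auto simp: inj_on_def)
  moreover have "Pow I \<inter> insert i ` Pow I = {}" using assms(2) by auto
  ultimately show ?thesis
    using assms(1) by (simp add: Pow_insert sum.union_disjoint sum.reindex sum.distrib)
qed

text \<open>Merges the vertex sums of two opposite facets into the vertex sum of the larger box; it
  closes each integration step.\<close>

lemma sum_Pow_corner_insert:
  fixes a :: "'i \<Rightarrow> real" and g :: "real \<Rightarrow> real \<Rightarrow> real"
  assumes "finite I" "i \<notin> I"
  shows "(\<Sum>S\<in>Pow (insert i I). (\<Prod>j\<in>insert i I. - 2 * corner S j)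
        * g (corner S i) (s - (\<Sum>j\<in>insert i I. a j * corner S j)))
    = (\<Sum>S\<in>Pow I. (\<Prod>j\<in>I. - 2 * corner S j) * g (-1/2) ((s + a i / 2) - (\<Sum>j\<in>I. a j * corner S j)))
    - (\<Sum>S\<in>Pow I. (\<Prod>j\<in>I. - 2 * corner S j) * g (1/2) ((s - a i / 2) - (\<Sum>j\<in>I. a j * corner S j)))"
proof -
  have "(\<Prod>j\<in>insert i I. - 2 * corner S j) * g (corner S i) (s - (\<Sum>j\<in>insert i I. a j * corner S j))
      + (\<Prod>j\<in>insert i I. - 2 * corner (insert i S) j) * g (corner (insert i S) i) (s - (\<Sum>j\<in>insert i I. a j * corner (insert i S) j))
    = (\<Prod>j\<in>I. - 2 * corner S j) * g (-1/2) ((s + a i / 2) - (\<Sum>j\<in>I. a j * corner S j))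
    - (\<Prod>j\<in>I. - 2 * corner S j) * g (1/2) ((s - a i / 2) - (\<Sum>j\<in>I. a j * corner S j))"
    if "S \<in> Pow I" for S
  proof -
    have S: "corner S i = -1/2" "corner (insert i S) i = 1/2" using that assms(2) by (auto simp: corner_def)
    have P: "(\<Prod>j\<in>I. - 2 * corner (insert i S) j) = (\<Prod>j\<in>I. - 2 * corner S j)"
      using assms(2) by (intro prod.cong) (auto simp: corner_def)
    have Q: "(\<Sum>j\<in>I. a j * corner (insert i S) j) = (\<Sum>j\<in>I. a j * corner S j)"
      using assms(2) by (intro sum.cong) (auto simp: corner_def)
    show ?thesis unfolding prod.insert[OF assms] sum.insert[OF assms] P Q S by (simp add: algebra_simps)
  qed
  then show ?thesis by (simp add: sum_Pow_insert[OF assms] sum_subtractf)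
qed

text \<open>Every coordinate integrated raises the order by one, so the induction needs all orders
  \<open>n\<close>. For \<open>n = 0\<close> this is the inclusion-exclusion formula for the volume
  cut off a cube by a half-space.\<close>

lemma box_integral_trunc_pow:
  fixes a :: "'i \<Rightarrow> real"
  assumes "finite I" "\<And>j. j \<in> I \<Longrightarrow> a j \<noteq> 0"
  shows "(\<integral>x. (\<Prod>j\<in>I. unit_ind (x j)) * trunc_pow n (s - (\<Sum>j\<in>I. a j * x j)) \<partial>PiM I (\<lambda>_. lborel))
    = (\<Sum>S\<in>Pow I. (\<Prod>j\<in>I. - 2 * corner S j) * trunc_pow (n + card I) (s - (\<Sum>j\<in>I. a j * corner S j)))
      / (\<Prod>j\<in>I. a j)"
  using assms
proof (induction I arbitrary: n s rule: finite_induct)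
  case empty
  show ?case by (simp add: PiM_empty lebesgue_integral_count_space_finite)
next
  case (insert i I)
  have ai: "a i \<noteq> 0" using insert.prems by simp
  let ?J = "\<lambda>c. \<integral>x. (\<Prod>j\<in>I. unit_ind (x j)) * trunc_pow (Suc n) (c - (\<Sum>j\<in>I. a j * x j)) \<partial>PiM I (\<lambda>_. lborel)"
  let ?V = "\<lambda>c. \<Sum>S\<in>Pow I. (\<Prod>j\<in>I. - 2 * corner S j) * trunc_pow (Suc n + card I) (c - (\<Sum>j\<in>I. a j * corner S j))"
  have J: "?J c = ?V c / (\<Prod>j\<in>I. a j)" for c
    using insert.IH[of "Suc n" c] insert.prems by simp
  have int: "integrable (PiM I (\<lambda>_. lborel)) (\<lambda>x. (\<Prod>j\<in>I. unit_ind (x j)) * trunc_pow (Suc n) (c - (\<Sum>j\<in>I. a j * x j)))" for c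
    by (rule integrable_trunc_pow_box0[OF insert.hyps(1)])
  have "(\<integral>x. (\<Prod>j\<in>insert i I. unit_ind (x j)) * trunc_pow n (s - (\<Sum>j\<in>insert i I. a j * x j)) \<partial>PiM (insert i I) (\<lambda>_. lborel))
     = (\<integral>x. ((\<Prod>j\<in>I. unit_ind (x j)) * trunc_pow (Suc n) ((s + a i / 2) - (\<Sum>j\<in>I. a j * x j))
        - (\<Prod>j\<in>I. unit_ind (x j)) * trunc_pow (Suc n) ((s - a i / 2) - (\<Sum>j\<in>I. a j * x j))) / a i \<partial>PiM I (\<lambda>_. lborel))"
    using box_integral_insert[OF insert.hyps, of a 0 n s, OF ai] by (simp add: algebra_simps diff_divide_distrib)
  also have "\<dots> = (?J (s + a i / 2) - ?J (s - a i / 2)) / a i"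
    using Bochner_Integration.integral_diff[OF int int] by simp
  also have "\<dots> = (?V (s + a i / 2) - ?V (s - a i / 2)) / (\<Prod>j\<in>insert i I. a j)"
    unfolding J using insert.hyps by (simp add: diff_divide_distrib mult.commute)
  also have "?V (s + a i / 2) - ?V (s - a i / 2) = (\<Sum>S\<in>Pow (insert i I). (\<Prod>j\<in>insert i I. - 2 * corner S j) *
      trunc_pow (n + card (insert i I)) (s - (\<Sum>j\<in>insert i I. a j * corner S j)))"
    using sum_Pow_corner_insert[OF insert.hyps, of "\<lambda>_. trunc_pow (Suc n + card I)" s a] insert.hyps by simp
  finally show ?case .
qed

lemma box_integral_ibp_term:
  fixes a :: "'i \<Rightarrow> real"
  assumes "finite I" "\<And>j. j \<in> I \<Longrightarrow> a j \<noteq> 0"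
  shows "integrable (PiM I (\<lambda>_. lborel)) (\<lambda>x. (\<Prod>j\<in>I. unit_ind (x j)) * ibp_term M n \<alpha> v (s - (\<Sum>j\<in>I. a j * x j)))"
    and "(\<integral>x. (\<Prod>j\<in>I. unit_ind (x j)) * ibp_term M n \<alpha> v (s - (\<Sum>j\<in>I. a j * x j)) \<partial>PiM I (\<lambda>_. lborel))
    = (\<Sum>S\<in>Pow I. (\<Prod>j\<in>I. - 2 * corner S j) * ibp_term M (n + card I) \<alpha> v (s - (\<Sum>j\<in>I. a j * corner S j)))
      / (\<Prod>j\<in>I. a j)"
proof -
  let ?g = "\<lambda>k x. (\<Prod>j\<in>I. unit_ind (x j)) * trunc_pow (n + k) (s - (\<Sum>j\<in>I. a j * x j))"
  let ?c = "\<lambda>k. fact M / fact (M - k) * v ^ (M - k) / \<alpha> ^ k"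
  have eq: "(\<Prod>j\<in>I. unit_ind (x j)) * ibp_term M n \<alpha> v (s - (\<Sum>j\<in>I. a j * x j)) = (\<Sum>k\<le>M. ?c k * ?g k x)" for x
    unfolding ibp_term_def sum_distrib_left by (intro sum.cong) (auto simp: field_simps)
  have int: "integrable (PiM I (\<lambda>_. lborel)) (?g k)" for k
    by (rule integrable_trunc_pow_box0[OF assms(1)])
  show "integrable (PiM I (\<lambda>_. lborel)) (\<lambda>x. (\<Prod>j\<in>I. unit_ind (x j)) * ibp_term M n \<alpha> v (s - (\<Sum>j\<in>I. a j * x j)))"
    unfolding eq by (intro Bochner_Integration.integrable_sum integrable_mult_right int)
  have "(\<integral>x. (\<Prod>j\<in>I. unit_ind (x j)) * ibp_term M n \<alpha> v (s - (\<Sum>j\<in>I. a j * x j)) \<partial>PiM I (\<lambda>_. lborel))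
     = (\<Sum>k\<le>M. ?c k * integral\<^sup>L (PiM I (\<lambda>_. lborel)) (?g k))"
    unfolding eq
    by (subst Bochner_Integration.integral_sum[OF integrable_mult_right[OF int]])
      (simp only: integral_mult_right_zero)
  also have "\<dots> = (\<Sum>k\<le>M. ?c k * ((\<Sum>S\<in>Pow I. (\<Prod>j\<in>I. - 2 * corner S j) *
      trunc_pow (n + k + card I) (s - (\<Sum>j\<in>I. a j * corner S j))) / (\<Prod>j\<in>I. a j)))"
    using box_integral_trunc_pow[OF assms] by simp
  also have "\<dots> = (\<Sum>S\<in>Pow I. (\<Sum>k\<le>M. ?c k * ((\<Prod>j\<in>I. - 2 * corner S j) *
      trunc_pow (n + k + card I) (s - (\<Sum>j\<in>I. a j * corner S j))))) / (\<Prod>j\<in>I. a j)"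
    by (subst sum.swap) (simp add: sum_distrib_left sum_divide_distrib)
  also have "(\<Sum>S\<in>Pow I. (\<Sum>k\<le>M. ?c k * ((\<Prod>j\<in>I. - 2 * corner S j) *
      trunc_pow (n + k + card I) (s - (\<Sum>j\<in>I. a j * corner S j)))))
     = (\<Sum>S\<in>Pow I. (\<Prod>j\<in>I. - 2 * corner S j) * ibp_term M (n + card I) \<alpha> v (s - (\<Sum>j\<in>I. a j * corner S j)))"
    unfolding ibp_term_def sum_distrib_left by (intro sum.cong) (auto simp: field_simps)
  finally show "(\<integral>x. (\<Prod>j\<in>I. unit_ind (x j)) * ibp_term M n \<alpha> v (s - (\<Sum>j\<in>I. a j * x j)) \<partial>PiM I (\<lambda>_. lborel))
    = (\<Sum>S\<in>Pow I. (\<Prod>j\<in>I. - 2 * corner S j) * ibp_term M (n + card I) \<alpha> v (s - (\<Sum>j\<in>I. a j * corner S j)))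
      / (\<Prod>j\<in>I. a j)" .
qed

text \<open>Coordinate \<open>i\<close> is integrated before all others: this turns
  \<open>x i ^ M\<close> into constants, and the remaining integrand is a combination of truncated
  powers without weights.\<close>

lemma box_halfspace_moment:
  fixes a :: "'i \<Rightarrow> real"
  assumes "finite I" "i \<in> I" "\<And>j. j \<in> I \<Longrightarrow> a j \<noteq> 0"
  shows "(\<integral>x. (\<Prod>j\<in>I. unit_ind (x j)) * (x i ^ M * trunc_pow 0 (s - (\<Sum>j\<in>I. a j * x j))) \<partial>PiM I (\<lambda>_. lborel))
    = (\<Sum>S\<in>Pow I. (\<Prod>j\<in>I. - 2 * corner S j) * ibp_term M (card I) (a i) (corner S i) (s - (\<Sum>j\<in>I. a j * corner S j)))
      / (\<Prod>j\<in>I. a j)"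
proof -
  define J where "J = I - {i}"
  have J: "I = insert i J" "finite J" "i \<notin> J" using assms by (auto simp: J_def)
  have ai: "a i \<noteq> 0" and aJ: "\<And>j. j \<in> J \<Longrightarrow> a j \<noteq> 0" using assms J by auto
  let ?g = "\<lambda>v c x. (\<Prod>j\<in>J. unit_ind (x j)) * ibp_term M 1 (a i) v (c - (\<Sum>j\<in>J. a j * x j))"
  let ?V = "\<lambda>v c. \<Sum>S\<in>Pow J. (\<Prod>j\<in>J. - 2 * corner S j) * ibp_term M (1 + card J) (a i) v (c - (\<Sum>j\<in>J. a j * corner S j))"
  have "(\<integral>x. (\<Prod>j\<in>I. unit_ind (x j)) * (x i ^ M * trunc_pow 0 (s - (\<Sum>j\<in>I. a j * x j))) \<partial>PiM I (\<lambda>_. lborel))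
     = (\<integral>x. (?g (-1/2) (s + a i / 2) x - ?g (1/2) (s - a i / 2) x) / a i \<partial>PiM J (\<lambda>_. lborel))"
    unfolding J(1) using box_integral_insert[OF J(2,3), of a M 0 s, OF ai]
    by (simp add: right_diff_distrib)
  also have "\<dots> = (integral\<^sup>L (PiM J (\<lambda>_. lborel)) (?g (-1/2) (s + a i / 2)) - integral\<^sup>L (PiM J (\<lambda>_. lborel)) (?g (1/2) (s - a i / 2))) / a i"
    using Bochner_Integration.integral_diff[OF box_integral_ibp_term(1)[OF J(2) aJ] box_integral_ibp_term(1)[OF J(2) aJ]] by simp
  also have "\<dots> = (?V (-1/2) (s + a i / 2) - ?V (1/2) (s - a i / 2)) / (\<Prod>j\<in>insert i J. a j)"
  proof -
    have "integral\<^sup>L (PiM J (\<lambda>_. lborel)) (?g v c) = ?V v c / (\<Prod>j\<in>J. a j)" for v c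
      by (rule box_integral_ibp_term(2)[OF J(2) aJ])
    then show ?thesis using J(2,3) by (simp only: prod.insert) (simp add: diff_divide_distrib mult.commute)
  qed
  also have "?V (-1/2) (s + a i / 2) - ?V (1/2) (s - a i / 2) = (\<Sum>S\<in>Pow (insert i J). (\<Prod>j\<in>insert i J. - 2 * corner S j) *
      ibp_term M (card (insert i J)) (a i) (corner S i) (s - (\<Sum>j\<in>insert i J. a j * corner S j)))"
    using sum_Pow_corner_insert[OF J(2,3), of "\<lambda>v. ibp_term M (1 + card J) (a i) v" s a] J by simp
  finally show ?thesis unfolding J(1) .
qed

section \<open>Orthonormal coordinates\<close>

lemma nn_integral_lborel_translate:
  fixes g :: "'a::euclidean_space \<Rightarrow> ennreal"
  assumes [measurable]: "g \<in> borel_measurable borel"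
  shows "(\<integral>\<^sup>+x. g (c + x) \<partial>lborel) = (\<integral>\<^sup>+x. g x \<partial>lborel)"
  using nn_integral_distr[of "(+) c" lborel borel g] lborel_distr_plus[of c] by simp

lemma nn_integral_lborel_reflect:
  fixes g :: "'a::euclidean_space \<Rightarrow> ennreal"
  assumes [measurable]: "g \<in> borel_measurable borel"
  shows "(\<integral>\<^sup>+x. g (c - x) \<partial>lborel) = (\<integral>\<^sup>+x. g x \<partial>lborel)"
proof -
  have "lborel = density (distr lborel borel (\<lambda>x::'a. c - x)) (\<lambda>_. 1)"
    using lborel_affine[of "-1" c] by simp
  then have "lborel = distr lborel borel (\<lambda>x::'a. c - x)" by (simp add: density_1)
  then have "(\<integral>\<^sup>+x. g x \<partial>lborel) = (\<integral>\<^sup>+x. g x \<partial>distr lborel borel (\<lambda>x::'a. c - x))" by simp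
  also have "\<dots> = (\<integral>\<^sup>+x. g (c - x) \<partial>lborel)" by (rule nn_integral_distr) auto
  finally show ?thesis by simp
qed

text \<open>Up to a constant, Lebesgue measure is the only translation-invariant measure; the
  constant is \<open>1\<close> because an isometry preserves the unit ball.\<close>
lemma distr_lborel_orthogonal:
  fixes f :: "'a::euclidean_space \<Rightarrow> 'a"
  assumes f: "orthogonal_transformation f"
  shows "distr lborel borel f = lborel"
proof (rule measure_eqI)
  fix A assume "A \<in> sets (distr lborel borel f)"
  then have A [measurable]: "A \<in> sets borel" by simp
  have lin: "linear f" using f orthogonal_transformation_linear by blast
  have [measurable]: "f \<in> borel_measurable borel"
    using lin by (intro borel_measurable_continuous_onI linear_continuous_on linear_conv_bounded_linear[THEN iffD1])
  define Q :: "'a set" where "Q = ball 0 1"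
  have [measurable]: "Q \<in> sets borel" by (simp add: Q_def)
  have fQ: "indicator Q (f x) = (indicator Q x :: ennreal)" for x
    using f by (simp add: Q_def indicator_def orthogonal_transformation_norm)
  let ?A = "indicator A :: 'a \<Rightarrow> ennreal" and ?Q = "indicator Q :: 'a \<Rightarrow> ennreal"
  \<comment> \<open>The double integral of \<open>?A (f x) * ?Q (f x + y)\<close> is evaluated in
    both orders. Between them \<open>x\<close> is translated by a preimage of \<open>- y\<close>,
    which moves the shift from \<open>?Q\<close> to \<open>?A\<close>.\<close>
  have "(\<integral>\<^sup>+x. ?A (f x) \<partial>lborel) * emeasure lborel Q
      = (\<integral>\<^sup>+x. (\<integral>\<^sup>+y. ?A (f x) * ?Q (f x + y) \<partial>lborel) \<partial>lborel)"
    using nn_integral_lborel_translate[of ?Q]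
    by (simp add: nn_integral_cmult nn_integral_multc)
  also have "\<dots> = (\<integral>\<^sup>+y. (\<integral>\<^sup>+x. ?A (f x) * ?Q (f x + y) \<partial>lborel) \<partial>lborel)"
    by (rule lborel_pair.Fubini') measurable
  also have "\<dots> = (\<integral>\<^sup>+y. (\<integral>\<^sup>+x. ?A (f x - y) * ?Q (f x) \<partial>lborel) \<partial>lborel)"
  proof (rule nn_integral_cong)
    fix y :: 'a
    obtain z where z: "f z = - y" using orthogonal_transformation_surj[OF f] by (metis surjD)
    have "(\<integral>\<^sup>+x. ?A (f x) * ?Q (f x + y) \<partial>lborel) = (\<integral>\<^sup>+x. ?A (f (z + x)) * ?Q (f (z + x) + y) \<partial>lborel)"
      by (rule nn_integral_lborel_translate[symmetric]) measurable
    then show "(\<integral>\<^sup>+x. ?A (f x) * ?Q (f x + y) \<partial>lborel) = (\<integral>\<^sup>+x. ?A (f x - y) * ?Q (f x) \<partial>lborel)"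
      by (simp add: linear_add[OF lin] z)
  qed
  also have "\<dots> = (\<integral>\<^sup>+x. (\<integral>\<^sup>+y. ?A (f x - y) * ?Q (f x) \<partial>lborel) \<partial>lborel)"
    by (rule lborel_pair.Fubini'[symmetric]) measurable
  also have "\<dots> = (\<integral>\<^sup>+x. emeasure lborel A * ?Q x \<partial>lborel)"
    using nn_integral_lborel_reflect[of ?A] by (simp add: nn_integral_multc fQ)
  also have "\<dots> = emeasure lborel A * emeasure lborel Q"
    by (simp add: nn_integral_cmult)
  finally have *: "(\<integral>\<^sup>+x. ?A (f x) \<partial>lborel) * emeasure lborel Q = emeasure lborel A * emeasure lborel Q" .
  have "emeasure lborel Q \<noteq> \<infinity>" using emeasure_lborel_ball_finite[of "0::'a" 1] by (auto simp: Q_def)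
  moreover have "emeasure lborel Q \<noteq> 0"
  proof
    assume "emeasure lborel Q = 0"
    then have "Q \<in> null_sets lborel" by (intro null_setsI) simp_all
    then have "negligible Q" by (simp add: negligible_iff_null_sets null_sets_completionI)
    then show False using open_not_negligible[of Q] by (simp add: Q_def)
  qed
  ultimately have "(\<integral>\<^sup>+x. ?A (f x) \<partial>lborel) = emeasure lborel A"
    using * mult_divide_eq_ennreal[of "emeasure lborel Q"] unfolding infinity_ennreal_def by metis
  moreover have "(\<integral>\<^sup>+x. ?A x \<partial>distr lborel borel f) = (\<integral>\<^sup>+x. ?A (f x) \<partial>lborel)"
    by (rule nn_integral_distr) simp_all
  ultimately show "emeasure (distr lborel borel f) A = emeasure lborel A" by simp
qed simp

lemma borel_measurable_vec:
  fixes g :: "'a \<Rightarrow> 'n::finite \<Rightarrow> real"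
  assumes "\<And>i. (\<lambda>c. g c i) \<in> borel_measurable M"
  shows "(\<lambda>c. \<chi> i. g c i) \<in> borel_measurable M"
  by (subst borel_measurable_euclidean_space) (use assms in \<open>auto simp: Basis_vec_def inner_axis\<close>)

text \<open>The product measures to be compared are indexed by basis vectors instead of coordinates,
  hence the bijection \<open>\<pi>\<close>.\<close>

lemma distr_PiM_lborel_vec:
  assumes "bij_betw \<pi> (UNIV :: 'n::finite set) B"
  shows "distr (PiM B (\<lambda>_. lborel)) borel (\<lambda>c. \<chi> i. c (\<pi> i)) = (lborel :: (real^'n) measure)"
proof (rule lborel_eqI[symmetric])
  have finB: "finite B" using bij_betw_finite[OF assms] by simp
  have inB: "\<pi> i \<in> B" for i using assms by (auto simp: bij_betw_def)
  have [measurable]: "(\<lambda>c. \<chi> i. c (\<pi> i)) \<in> PiM B (\<lambda>_. lborel) \<rightarrow>\<^sub>M (borel :: (real^'n) measure)"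
    using inB by (intro borel_measurable_vec) auto
  fix l u :: "real^'n" assume lu: "\<And>b. b \<in> Basis \<Longrightarrow> l \<bullet> b \<le> u \<bullet> b"
  have lu': "l $ i \<le> u $ i" for i using lu[OF axis_in_Basis_iff[THEN iffD2], of 1 i] by (simp add: inner_axis)
  define \<rho> where "\<rho> = the_inv_into UNIV \<pi>"
  have inj: "inj \<pi>" using assms by (auto simp: bij_betw_def)
  have \<rho>: "\<rho> (\<pi> i) = i" for i using inj by (simp add: \<rho>_def the_inv_into_f_f)
  have img: "B = \<pi> ` UNIV" using assms by (auto simp: bij_betw_def)
  have "(\<lambda>c. \<chi> i. c (\<pi> i)) -` box l u \<inter> space (PiM B (\<lambda>_. lborel)) = PiE B (\<lambda>b. {l $ \<rho> b <..< u $ \<rho> b})"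
    unfolding img by (auto simp: space_PiM mem_box_cart \<rho> PiE_iff)
  then have "emeasure (distr (PiM B (\<lambda>_. lborel)) borel (\<lambda>c. \<chi> i. c (\<pi> i))) (box l u)
     = (\<Prod>b\<in>B. emeasure lborel {l $ \<rho> b <..< u $ \<rho> b})"
    using finB by (subst emeasure_distr) (auto simp: lborel_product.emeasure_PiM)
  also have "\<dots> = (\<Prod>i\<in>UNIV. ennreal (u $ i - l $ i))"
    unfolding img using inj lu' by (subst prod.reindex) (auto simp: \<rho>)
  also have "\<dots> = ennreal (\<Prod>i\<in>UNIV. u $ i - l $ i)"
    using lu' by (intro prod_ennreal) simp
  also have "(\<Prod>i\<in>UNIV. u $ i - l $ i) = (\<Prod>b\<in>Basis. (u - l) \<bullet> b)"
  proof -
    have eq: "Basis = (\<lambda>i. axis i 1 :: real^'n) ` UNIV" by (auto simp: Basis_vec_def)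
    have inj: "inj (\<lambda>i. axis i 1 :: real^'n)" by (auto simp: inj_on_def axis_eq_axis)
    show ?thesis unfolding eq prod.reindex[OF inj] by (simp add: inner_axis)
  qed
  finally show "emeasure (distr (PiM B (\<lambda>_. lborel)) borel (\<lambda>c. \<chi> i. c (\<pi> i))) (box l u)
     = ennreal (\<Prod>b\<in>Basis. (u - l) \<bullet> b)" .
qed simp

text \<open>The parametrisation is the standard one followed by the orthogonal map that sends the
  \<open>i\<close>-th axis to \<open>\<pi> i\<close>, and this map preserves Lebesgue
  measure.\<close>

lemma distr_PiM_orthonormal_basis:
  fixes B :: "(real^'n) set"
  assumes "orthonormal_basis_of UNIV B"
  shows "distr (PiM B (\<lambda>_. lborel)) borel (\<lambda>c. \<Sum>b\<in>B. c b *\<^sub>R b) = lborel"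
proof -
  have po: "pairwise orthogonal B" and n1: "\<And>b. b \<in> B \<Longrightarrow> norm b = 1" and sp: "span B = UNIV"
    using assms by (auto simp: orthonormal_basis_of_def)
  have "0 \<notin> B" using n1 by force
  then have ind: "independent B" using po pairwise_orthogonal_independent by blast
  then have fin: "finite B" using independent_imp_finite by blast
  have "card B = CARD('n)"
    using ind sp by (metis basis_card_eq_dim dim_UNIV subset_UNIV top_greatest DIM_cart DIM_real mult.right_neutral)
  then obtain \<pi> where \<pi>: "bij_betw \<pi> (UNIV :: 'n set) B"
    using fin by (metis finite_same_card_bij finite)
  define f where "f x = (\<Sum>i\<in>UNIV. x $ i *\<^sub>R \<pi> i)" for x :: "real^'n"
  have inB: "\<pi> i \<in> B" for i using \<pi> by (auto simp: bij_betw_def)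
  have inner: "\<pi> i \<bullet> \<pi> j = (if i = j then 1 else 0)" for i j
  proof (cases "i = j")
    case True then show ?thesis using n1[OF inB[of i]] by (simp add: norm_eq_1)
  next
    case False
    then have "\<pi> i \<noteq> \<pi> j" using \<pi> by (auto simp: bij_betw_def inj_on_def)
    then show ?thesis using False po inB by (auto simp: pairwise_def orthogonal_def)
  qed
  have "f x \<bullet> f y = x \<bullet> y" for x y
  proof -
    have "f x \<bullet> f y = (\<Sum>i\<in>UNIV. \<Sum>j\<in>UNIV. x $ i * (y $ j * (\<pi> i \<bullet> \<pi> j)))"
      unfolding f_def inner_sum_left inner_sum_right by (subst sum.swap) (simp add: mult_ac)
    also have "\<dots> = (\<Sum>i\<in>UNIV. x $ i * y $ i)"
      unfolding inner by (simp add: if_distrib cong: if_cong)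
    finally show ?thesis by (simp add: inner_vec_def)
  qed
  moreover have "linear f"
    unfolding f_def by (intro linearI) (simp_all add: scaleR_add_left sum.distrib scaleR_sum_right)
  ultimately have orth: "orthogonal_transformation f" by (simp add: orthogonal_transformation_def)
  have [measurable]: "f \<in> borel_measurable borel"
    using \<open>linear f\<close> by (intro borel_measurable_continuous_onI linear_continuous_on linear_conv_bounded_linear[THEN iffD1])
  have [measurable]: "(\<lambda>c. \<chi> i. c (\<pi> i)) \<in> PiM B (\<lambda>_. lborel) \<rightarrow>\<^sub>M (borel :: (real^'n) measure)"
    using inB by (intro borel_measurable_vec) auto
  have comp: "f (\<chi> i. c (\<pi> i)) = (\<Sum>b\<in>B. c b *\<^sub>R b)" for c
    unfolding f_def using sum.reindex_bij_betw[OF \<pi>, of "\<lambda>b. c b *\<^sub>R b"] by simp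
  have "distr (PiM B (\<lambda>_. lborel)) borel (\<lambda>c. f (\<chi> i. c (\<pi> i)))
     = distr (distr (PiM B (\<lambda>_. lborel)) borel (\<lambda>c. \<chi> i. c (\<pi> i))) borel f"
    by (subst distr_distr) (auto simp: comp_def)
  also have "\<dots> = lborel" by (simp only: distr_PiM_lborel_vec[OF \<pi>] distr_lborel_orthogonal[OF orth])
  finally show ?thesis by (simp only: comp)
qed

section \<open>Moments of slabs and slices\<close>

text \<open>For \<open>n = CARD('n)\<close> this is the moment of the part of the cube with
  \<open>a \<bullet> x \<le> s\<close>. The order \<open>n\<close> is a parameter because
  differentiating in \<open>s\<close> lowers it by one.\<close>

definition moment_formula :: "nat \<Rightarrow> nat \<Rightarrow> real^'n \<Rightarrow> real \<Rightarrow> real" where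
  "moment_formula M n a s = (\<Sum>i\<in>UNIV. (\<Sum>S\<in>UNIV. (\<Prod>j\<in>UNIV. - 2 * corner S j) *
      ibp_term M n (a $ i) (corner S i) (s - (\<Sum>j\<in>UNIV. a $ j * corner S j))) / (\<Prod>j\<in>UNIV. a $ j))"

abbreviation power_sum :: "nat \<Rightarrow> real^'n \<Rightarrow> real" where
  "power_sum M x \<equiv> \<Sum>i\<in>UNIV. (x $ i) ^ M"

definition cube_power :: "nat \<Rightarrow> real^'n \<Rightarrow> real" where
  "cube_power M x = indicator cube x * power_sum M x"

lemma cube_nth_bound: "x \<in> cube \<Longrightarrow> \<bar>x $ i\<bar> \<le> 1/2"
  by (simp add: cube_def)

lemma cube_eq_cbox: "cube = (cbox (\<chi> i. -1/2) (\<chi> i. 1/2) :: (real^'n) set)"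
proof -
  have "\<bar>y\<bar> \<le> 1/2 \<longleftrightarrow> -1/2 \<le> y \<and> y \<le> 1/2" for y :: real by auto
  then show ?thesis unfolding cube_def by (intro set_eqI) (simp only: mem_box_cart vec_lambda_beta mem_Collect_eq)
qed

lemma measurable_cube [measurable]: "cube \<in> sets (borel :: (real^'n) measure)"
  by (simp add: cube_eq_cbox)

lemma power_sum_continuous: "continuous_on UNIV (power_sum M)"
  by (intro continuous_intros)

lemma power_sum_measurable [measurable]: "power_sum M \<in> borel_measurable borel"
  by (rule borel_measurable_continuous_onI[OF power_sum_continuous])

lemma cube_power_measurable [measurable]: "cube_power M \<in> borel_measurable borel"
  unfolding cube_power_def by measurable

lemma power_sum_bound:
  fixes x :: "real^'n" assumes "x \<in> cube" shows "\<bar>power_sum M x\<bar> \<le> CARD('n)"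
proof -
  have "\<bar>power_sum M x\<bar> \<le> (\<Sum>i\<in>UNIV. \<bar>(x $ i) ^ M\<bar>)" by (rule sum_abs)
  also have "\<dots> \<le> (\<Sum>i\<in>(UNIV::'n set). 1)"
  proof (rule sum_mono)
    fix i show "\<bar>(x $ i) ^ M\<bar> \<le> 1"
      using cube_nth_bound[OF assms, of i] by (simp add: power_abs power_le_one)
  qed
  finally show ?thesis by simp
qed

lemma cube_power_bound: "\<bar>cube_power M (x :: real^'n)\<bar> \<le> real CARD('n) * indicator cube x"
  using power_sum_bound[of x M] by (auto simp: cube_power_def indicator_def)

lemma emeasure_cube_finite: "emeasure lborel (cube :: (real^'n) set) < \<infinity>"
  unfolding cube_eq_cbox by (rule emeasure_lborel_cbox_finite)

lemma integrable_cube_power_mult: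
  fixes h :: "real^'n \<Rightarrow> real"
  assumes [measurable]: "h \<in> borel_measurable borel" and "\<And>x. \<bar>h x\<bar> \<le> 1"
  shows "integrable lborel (\<lambda>x. cube_power M x * h x)"
proof (rule Bochner_Integration.integrable_bound)
  show "integrable lborel (\<lambda>x::real^'n. real CARD('n) * indicator cube x :: real)"
    by (intro integrable_mult_right integrable_real_indicator emeasure_cube_finite) simp
  show "AE x in lborel. norm (cube_power M x * h x) \<le> norm (real CARD('n) * indicator cube x :: real)"
  proof (rule AE_I2)
    fix x :: "real^'n"
    have "\<bar>cube_power M x\<bar> * \<bar>h x\<bar> \<le> (real CARD('n) * indicator cube x) * 1"
      using cube_power_bound assms(2) by (intro mult_mono) auto
    then show "norm (cube_power M x * h x) \<le> norm (real CARD('n) * indicator cube x :: real)"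
      by (simp add: abs_mult)
  qed
qed simp

lemma halfspace_moment:
  fixes a :: "real^'n"
  assumes "\<And>i. a $ i \<noteq> 0"
  shows "(\<integral>x. cube_power M x * trunc_pow 0 (s - a \<bullet> x) \<partial>lborel) = moment_formula M CARD('n) a s"
proof -
  let ?P = "PiM (UNIV :: 'n set) (\<lambda>_. lborel :: real measure)"
  have [measurable]: "(\<lambda>c. \<chi> i. c i) \<in> ?P \<rightarrow>\<^sub>M (borel :: (real^'n) measure)"
    by (intro borel_measurable_vec) auto
  have [measurable]: "(\<lambda>x. trunc_pow 0 (s - a \<bullet> x)) \<in> borel_measurable borel"
    by (intro measurable_compose[OF _ trunc_pow_measurable]) measurable
  have ind: "indicator cube (\<chi> i. c i) = (\<Prod>j\<in>(UNIV::'n set). unit_ind (c j))" for c :: "'n \<Rightarrow> real"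
  proof (cases "\<forall>j. \<bar>c j\<bar> \<le> 1/2")
    case True
    have "-1/2 \<le> c j \<and> c j \<le> 1/2" for j using True[rule_format, of j] by linarith
    then have "unit_ind (c j) = 1" for j by (simp add: indicator_def)
    then show ?thesis using True by (simp add: cube_def)
  next
    case False
    then obtain j where "\<not> \<bar>c j\<bar> \<le> 1/2" by blast
    then have "unit_ind (c j) = 0" unfolding abs_le_iff by (auto simp: indicator_def)
    then have "(\<Prod>j\<in>(UNIV::'n set). unit_ind (c j)) = 0" by (intro prod_zero) auto
    then show ?thesis using False by (simp add: cube_def)
  qed
  have "(\<integral>x. cube_power M x * trunc_pow 0 (s - a \<bullet> x) \<partial>lborel)
    = (\<integral>x. cube_power M x * trunc_pow 0 (s - a \<bullet> x) \<partial>distr ?P borel (\<lambda>c. \<chi> i. c i))"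
    using distr_PiM_lborel_vec[OF bij_betw_id, where 'n = 'n] by (simp only: id_apply)
  also have "\<dots> = (\<integral>c. cube_power M (\<chi> i. c i) * trunc_pow 0 (s - a \<bullet> (\<chi> i. c i)) \<partial>?P)"
    by (rule integral_distr) measurable
  also have "\<dots> = (\<integral>c. (\<Sum>i\<in>UNIV. (\<Prod>j\<in>UNIV. unit_ind (c j)) *
      (c i ^ M * trunc_pow 0 (s - (\<Sum>j\<in>UNIV. a $ j * c j)))) \<partial>?P)"
    by (intro Bochner_Integration.integral_cong)
      (simp_all add: cube_power_def ind inner_vec_def sum_distrib_left sum_distrib_right mult.assoc)
  also have "\<dots> = (\<Sum>i\<in>UNIV. \<integral>c. (\<Prod>j\<in>UNIV. unit_ind (c j)) *
      (c i ^ M * trunc_pow 0 (s - (\<Sum>j\<in>UNIV. a $ j * c j))) \<partial>?P)"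
    using integrable_trunc_pow_box[of "UNIV :: 'n set" "{i}" M 0 s "\<lambda>j. a $ j" for i]
    by (intro Bochner_Integration.integral_sum) simp
  also have "\<dots> = moment_formula M CARD('n) a s"
    unfolding moment_formula_def
    using box_halfspace_moment[of "UNIV :: 'n set" _ "\<lambda>j. a $ j" M s] assms by simp
  finally show ?thesis .
qed

lemma AE_lborel_not_hyperplane:
  fixes a :: "real^'n" assumes "a \<noteq> 0" shows "AE x in lborel. a \<bullet> x \<noteq> c"
proof (rule AE_I')
  have "{x. a \<bullet> x = c} \<in> null_sets (completion lborel)"
    using negligible_hyperplane[of a c] assms by (simp add: negligible_iff_null_sets)
  moreover have "{x. a \<bullet> x = c} \<in> sets lborel" by (simp add: closed_hyperplane borel_closed)
  ultimately show "{x. a \<bullet> x = c} \<in> null_sets lborel" by (simp add: null_sets_completion_iff)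
qed auto

lemma slab_moment_formula:
  fixes a :: "real^'n"
  assumes nz: "\<And>i. a $ i \<noteq> 0" and "t \<ge> 0"
  shows "slab_moment M a t = moment_formula M CARD('n) a (t/2) - moment_formula M CARD('n) a (- t/2)"
proof -
  have "a \<noteq> 0" using nz by auto
  have [measurable]: "(\<lambda>x. trunc_pow 0 (s - a \<bullet> x)) \<in> borel_measurable borel" for s
    by (intro measurable_compose[OF _ trunc_pow_measurable]) measurable
  have [measurable]: "slab a t \<in> sets borel"
  proof -
    have "closed (slab a t)"
      unfolding slab_def cube_eq_cbox Collect_conj_eq Collect_mem_eq
      by (intro closed_Int closed_cbox closed_Collect_le continuous_intros)
    then show ?thesis by simp
  qed
  have int: "integrable lborel (\<lambda>x. cube_power M x * trunc_pow 0 (s - a \<bullet> x))" for s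
    by (rule integrable_cube_power_mult) (auto simp: trunc_pow_def)
  have "slab_moment M a t = (\<integral>x. indicator (slab a t) x * power_sum M x \<partial>lborel)"
    by (simp add: slab_moment_def set_lebesgue_integral_def)
  also have "\<dots> = (\<integral>x. cube_power M x * trunc_pow 0 (t/2 - a \<bullet> x) - cube_power M x * trunc_pow 0 (- t/2 - a \<bullet> x) \<partial>lborel)"
  \<comment> \<open>The subtracted half-space is closed and takes away the face
    \<open>a \<bullet> x = - t/2\<close>, which belongs to the slab; it is a null set.\<close>
  proof (rule integral_cong_AE)
    show "AE x in lborel. indicator (slab a t) x * power_sum M x =
        cube_power M x * trunc_pow 0 (t/2 - a \<bullet> x) - cube_power M x * trunc_pow 0 (- t/2 - a \<bullet> x)"
      using AE_lborel_not_hyperplane[OF \<open>a \<noteq> 0\<close>, of "- t/2"]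
    proof eventually_elim
      case (elim x)
      then show ?case using assms(2)
        by (auto simp: cube_power_def slab_def trunc_pow_def indicator_def)
    qed
  qed measurable
  also have "\<dots> = moment_formula M CARD('n) a (t/2) - moment_formula M CARD('n) a (- t/2)"
    unfolding Bochner_Integration.integral_diff[OF int int] halfspace_moment[OF nz] ..
  finally show ?thesis .
qed

lemma slab_moment_negative: "t < 0 \<Longrightarrow> slab_moment M a t = 0"
proof -
  assume "t < 0"
  then have "slab a t = {}" by (auto simp: slab_def)
  then show ?thesis by (simp add: slab_moment_def set_lebesgue_integral_def)
qed

text \<open>For \<open>M = 0\<close> the integrand is the constant \<open>CARD('n)\<close>. Both
  volumes are thus zeroth moments up to this factor and need no treatment of their own.\<close>

lemma integral_card_indicator:
  "(\<integral>x. indicator A x *\<^sub>R (\<Sum>i\<in>(UNIV::'n::finite set). (x $ i) ^ 0) \<partial>N) = CARD('n) * measure N (A \<inter> space N)"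
  by (simp add: mult.commute[of "indicator A _"])

lemma slab_volume_eq: "slab_volume a t = slab_moment 0 (a :: real^'n) t / CARD('n)"
  unfolding slab_moment_def set_lebesgue_integral_def integral_card_indicator
  by (simp add: slab_volume_def)

lemma slice_volume_eq: "slice_volume a t = slice_moment 0 (a :: real^'n) t / CARD('n)"
  unfolding slice_moment_def set_lebesgue_integral_def integral_card_indicator
  by (simp add: slice_volume_def hyperplane_lborel_def Let_def)

text \<open>Fubini in the coordinate \<open>b1\<close>, whose coefficient is non-zero: each fibre
  contains at most one point.\<close>

lemma AE_PiM_lborel_not_hyperplane:
  fixes \<beta> :: "'i \<Rightarrow> real"
  assumes "finite B" "b1 \<in> B" "\<beta> b1 \<noteq> 0"
  shows "AE c in PiM B (\<lambda>_. lborel). (\<Sum>b\<in>B. c b * \<beta> b) \<noteq> q"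
proof -
  define B0 where "B0 = B - {b1}"
  have B: "B = insert b1 B0" "finite B0" "b1 \<notin> B0" using assms by (auto simp: B0_def)
  let ?N = "{c \<in> space (PiM B (\<lambda>_. lborel)). (\<Sum>b\<in>B. c b * \<beta> b) = q}"
  have [measurable]: "?N \<in> sets (PiM B (\<lambda>_. lborel))" by measurable
  have "emeasure (PiM B (\<lambda>_. lborel)) ?N
     = (\<integral>\<^sup>+c. (\<integral>\<^sup>+y. indicator ?N (c(b1 := y)) \<partial>lborel) \<partial>PiM B0 (\<lambda>_. lborel))"
    unfolding nn_integral_indicator[symmetric, OF \<open>?N \<in> _\<close>] unfolding B(1)
    by (rule lborel_product.product_nn_integral_insert[OF B(2,3)]) (simp flip: B(1))
  also have "\<dots> = (\<integral>\<^sup>+c. 0 \<partial>PiM B0 (\<lambda>_. lborel :: real measure))"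
  proof (rule nn_integral_cong)
    fix c :: "'i \<Rightarrow> real"
    have "(\<Sum>b\<in>B. (c(b1 := y)) b * \<beta> b) = y * \<beta> b1 + (\<Sum>b\<in>B0. c b * \<beta> b)" for y
    proof -
      have "(\<Sum>b\<in>B0. (c(b1 := y)) b * \<beta> b) = (\<Sum>b\<in>B0. c b * \<beta> b)"
        using B(3) by (intro sum.cong) auto
      then show ?thesis unfolding B(1) using B(2,3) by simp
    qed
    then have "indicator ?N (c(b1 := y)) \<le> (indicator {(q - (\<Sum>b\<in>B0. c b * \<beta> b)) / \<beta> b1} y :: ennreal)" for y
      using assms(3) by (auto simp: indicator_def field_simps)
    then have "(\<integral>\<^sup>+y. indicator ?N (c(b1 := y)) \<partial>lborel)
        \<le> (\<integral>\<^sup>+y. indicator {(q - (\<Sum>b\<in>B0. c b * \<beta> b)) / \<beta> b1} y \<partial>lborel)"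
      by (intro nn_integral_mono)
    also have "\<dots> = 0" by simp
    finally show "(\<integral>\<^sup>+y. indicator ?N (c(b1 := y)) \<partial>lborel) = 0" by simp
  qed
  finally have "?N \<in> null_sets (PiM B (\<lambda>_. lborel))" by (intro null_setsI) simp_all
  then show ?thesis by (rule AE_I') auto
qed

section \<open>Slice moments as derivatives of half-space moments\<close>

lemma has_field_derivative_ibp_term_snd:
  assumes "y \<noteq> 0"
  shows "((\<lambda>y. ibp_term M (Suc n) \<alpha> v y) has_field_derivative ibp_term M n \<alpha> v y) (at y)"
  unfolding ibp_term_def add_Suc
  by (intro DERIV_sum DERIV_cdivide DERIV_cmult has_field_derivative_trunc_pow assms)

lemma has_field_derivative_moment_formula:
  fixes a :: "real^'n"
  assumes "\<And>S. s \<noteq> (\<Sum>j\<in>UNIV. a $ j * corner S j)"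
  shows "(moment_formula M (Suc n) a has_field_derivative moment_formula M n a s) (at s)"
  unfolding moment_formula_def
proof (intro DERIV_sum DERIV_cdivide DERIV_cmult)
  fix i and S :: "'n set"
  have "((\<lambda>s. s - (\<Sum>j\<in>UNIV. a $ j * corner S j)) has_field_derivative 1) (at s)"
    by (auto intro!: derivative_eq_intros)
  moreover have "s - (\<Sum>j\<in>UNIV. a $ j * corner S j) \<noteq> 0" using assms[of S] by simp
  ultimately show "((\<lambda>s. ibp_term M (Suc n) (a $ i) (corner S i) (s - (\<Sum>j\<in>UNIV. a $ j * corner S j)))
      has_field_derivative ibp_term M n (a $ i) (corner S i) (s - (\<Sum>j\<in>UNIV. a $ j * corner S j))) (at s)"
    using DERIV_chain2[where f = "ibp_term M (Suc n) (a $ i) (corner S i)"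
        and g = "\<lambda>s. s - (\<Sum>j\<in>UNIV. a $ j * corner S j)" and Db = 1] has_field_derivative_ibp_term_snd by simp
qed

lemma orthonormal_basis_of_exists: "subspace V \<Longrightarrow> \<exists>B. orthonormal_basis_of V B"
  unfolding orthonormal_basis_of_def using orthonormal_basis_subspace[of V] by metis

lemma orthonormal_basis_of_finite:
  assumes "orthonormal_basis_of V B" shows "finite B"
proof -
  have "0 \<notin> B" using assms by (force simp: orthonormal_basis_of_def)
  then have "independent B" using assms pairwise_orthogonal_independent by (auto simp: orthonormal_basis_of_def)
  then show ?thesis using independent_imp_finite by blast
qed

lemma orthonormal_basis_of_insert_normal:
  fixes a :: "real^'n"
  assumes "a \<noteq> 0" "orthonormal_basis_of {x. a \<bullet> x = 0} B"
  shows "a /\<^sub>R norm a \<notin> B" "orthonormal_basis_of UNIV (insert (a /\<^sub>R norm a) B)"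
proof -
  let ?b = "a /\<^sub>R norm a"
  have B: "B \<subseteq> {x. a \<bullet> x = 0}" "pairwise orthogonal B" "\<forall>b\<in>B. norm b = 1" "span B = {x. a \<bullet> x = 0}"
    using assms(2) by (auto simp: orthonormal_basis_of_def)
  show "?b \<notin> B" using B(1) assms(1) by auto
  have "x \<in> span (insert ?b B)" for x
  proof -
    have "x - ((a \<bullet> x) / (a \<bullet> a)) *\<^sub>R a \<in> span B" using assms(1) B(4) by (simp add: inner_diff_right)
    moreover have "norm a *\<^sub>R ?b = a" using assms(1) by simp
    ultimately have "x - ((a \<bullet> x) / (a \<bullet> a) * norm a) *\<^sub>R ?b \<in> span B"
      by (simp only: scaleR_scaleR[symmetric])
    then show ?thesis unfolding span_insert by blast
  qed
  moreover have "orthogonal ?b x" "orthogonal x ?b" if "x \<in> B" for x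
    using B(1) that by (auto simp: orthogonal_def inner_commute)
  ultimately show "orthonormal_basis_of UNIV (insert ?b B)"
    using B assms(1) by (auto simp: orthonormal_basis_of_def pairwise_insert)
qed

lemma integrable_PiM_box:
  assumes "finite B"
  shows "integrable (PiM B (\<lambda>_. lborel)) (\<lambda>c. \<Prod>b\<in>B. indicator {-R..R::real} (c b) :: real)"
  by (intro lborel_product.product_integrable_prod assms integrable_real_indicator)
    (simp_all add: emeasure_lborel_Icc_eq)

text \<open>The basis \<open>B\<close> is arbitrary here, so the results apply to the one selected
  by \<open>SOME\<close> in \<open>hyperplane_lborel\<close>.\<close>

locale normal_coordinates =
  fixes a :: "real^'n" and B :: "(real^'n) set" and M :: nat
  assumes a_nth: "\<And>i. a $ i \<noteq> 0" and B: "orthonormal_basis_of {x. a \<bullet> x = 0} B"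
begin

definition "P = PiM B (\<lambda>_. lborel :: real measure)"
definition "b0 = a /\<^sub>R norm a"
definition pt :: "real \<Rightarrow> (real^'n \<Rightarrow> real) \<Rightarrow> real^'n" where
  "pt \<tau> c = \<tau> *\<^sub>R b0 + (\<Sum>b\<in>B. c b *\<^sub>R b)"
text \<open>The slice moment as a function of the signed distance \<open>\<tau>\<close> of the
  hyperplane from the origin.\<close>

definition G :: "real \<Rightarrow> real" where "G \<tau> = (\<integral>c. cube_power M (pt \<tau> c) \<partial>P)"
text \<open>Radius of a ball that contains the cube, a crude bound obtained from the sum of the
  absolute coordinates.\<close>

definition "R = real CARD('n)"

lemma a_nonzero: "a \<noteq> 0" using a_nth[of undefined] by auto

lemma finite_B: "finite B" using B by (rule orthonormal_basis_of_finite)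

lemma b0_notin_B: "b0 \<notin> B"
  using orthonormal_basis_of_insert_normal(1)[OF a_nonzero B] by (simp add: b0_def)

lemma basis: "orthonormal_basis_of UNIV (insert b0 B)"
  using orthonormal_basis_of_insert_normal(2)[OF a_nonzero B] by (simp add: b0_def)

lemma inner_a_pt: "a \<bullet> pt \<tau> c = \<tau> * norm a"
proof -
  have "a \<bullet> b = 0" if "b \<in> B" for b using B that by (auto simp: orthonormal_basis_of_def)
  moreover have "a \<bullet> b0 = norm a" using a_nonzero by (simp add: b0_def dot_square_norm power2_eq_square)
  ultimately show ?thesis by (simp add: pt_def inner_add_right inner_sum_right)
qed

lemma inner_B_pt: "b \<in> B \<Longrightarrow> b \<bullet> pt \<tau> c = c b"
proof -
  assume b: "b \<in> B"
  have "b \<bullet> b' = (if b' = b then 1 else 0)" if "b' \<in> B" for b'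
    using B b that by (auto simp: orthonormal_basis_of_def pairwise_def orthogonal_def norm_eq_1)
  then have "(\<Sum>b'\<in>B. c b' * (b \<bullet> b')) = (\<Sum>b'\<in>B. if b' = b then c b' else 0)" by (intro sum.cong) auto
  moreover have "b \<bullet> b0 = 0" using B b by (auto simp: b0_def orthonormal_basis_of_def inner_commute)
  ultimately show ?thesis using b finite_B by (simp add: pt_def inner_add_right inner_sum_right)
qed

lemma measurable_sum_B [measurable]: "(\<lambda>c. \<Sum>b\<in>B. c b *\<^sub>R b) \<in> P \<rightarrow>\<^sub>M (borel :: (real^'n) measure)"
  unfolding P_def by measurable

lemma measurable_pt [measurable]: "(\<lambda>(\<tau>, c). pt \<tau> c) \<in> lborel \<Otimes>\<^sub>M P \<rightarrow>\<^sub>M borel"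
  unfolding pt_def by measurable

lemma measurable_pt2 [measurable]: "pt \<tau> \<in> P \<rightarrow>\<^sub>M borel"
  unfolding pt_def by measurable

sublocale P: sigma_finite_measure P
  unfolding P_def using finite_B by (rule lborel_product.sigma_finite)

lemma G_measurable [measurable]: "G \<in> borel_measurable lborel"
  unfolding G_def by measurable

lemma norm_cube: "x \<in> cube \<Longrightarrow> norm (x :: real^'n) \<le> R"
proof -
  assume "x \<in> cube"
  then have "(\<Sum>i\<in>UNIV. \<bar>x $ i\<bar>) \<le> (\<Sum>i\<in>(UNIV :: 'n set). 1)"
    by (intro sum_mono order_trans[OF cube_nth_bound]) simp_all
  then show ?thesis using norm_le_l1_cart[of x] by (simp add: R_def)
qed

text \<open>A bound independent of \<open>\<tau>\<close>, as dominated convergence requires. Each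
  \<open>c b\<close> is the inner product of the point with a unit vector, hence bounded on the
  cube.\<close>

lemma pt_dominated:
  "\<bar>cube_power M (pt \<tau> c)\<bar> \<le> R * (\<Prod>b\<in>B. indicator {-R..R} (c b))"
proof (cases "pt \<tau> c \<in> cube")
  case True
  have "c b \<in> {-R..R}" if "b \<in> B" for b
  proof -
    have "\<bar>c b\<bar> \<le> norm b * norm (pt \<tau> c)"
      unfolding inner_B_pt[OF that, symmetric, of c \<tau>] by (rule Cauchy_Schwarz_ineq2)
    also have "\<dots> \<le> R" using norm_cube[OF True] B that by (auto simp: orthonormal_basis_of_def)
    finally show ?thesis by auto
  qed
  then have "(\<Prod>b\<in>B. indicator {-R..R} (c b)) = (1::real)" by (intro prod.neutral) auto
  then show ?thesis using cube_power_bound[of M "pt \<tau> c"] True by (simp add: R_def)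
next
  case False
  then show ?thesis by (simp add: cube_power_def prod_nonneg R_def)
qed

lemma integrable_bound_P: "integrable P (\<lambda>c. R * (\<Prod>b\<in>B. indicator {-R..R} (c b)))"
  unfolding P_def by (intro integrable_mult_right integrable_PiM_box finite_B)

lemma integrable_pt: "integrable P (\<lambda>c. cube_power M (pt \<tau> c))"
proof (rule Bochner_Integration.integrable_bound[OF integrable_bound_P])
  show "AE c in P. norm (cube_power M (pt \<tau> c)) \<le> norm (R * (\<Prod>b\<in>B. indicator {-R..R} (c b)))"
    using pt_dominated[of \<tau>] by (intro AE_I2) (simp only: real_norm_def, rule order_trans[OF _ abs_ge_self])
qed measurable

lemma G_bound: "\<bar>G \<tau>\<bar> \<le> (\<integral>c. R * (\<Prod>b\<in>B. indicator {-R..R} (c b)) \<partial>P)"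
proof -
  have "\<bar>G \<tau>\<bar> \<le> (\<integral>c. \<bar>cube_power M (pt \<tau> c)\<bar> \<partial>P)"
    unfolding G_def by (rule integral_abs_bound)
  also have "\<dots> \<le> (\<integral>c. R * (\<Prod>b\<in>B. indicator {-R..R} (c b)) \<partial>P)"
    by (intro integral_mono integrable_abs integrable_pt integrable_bound_P pt_dominated)
  finally show ?thesis .
qed

lemma G_zero: "\<tau> < - R \<Longrightarrow> G \<tau> = 0"
proof -
  assume \<tau>: "\<tau> < - R"
  have "pt \<tau> c \<notin> cube" for c
  proof
    assume "pt \<tau> c \<in> cube"
    have "\<bar>\<tau>\<bar> * norm a \<le> norm a * norm (pt \<tau> c)"
      using Cauchy_Schwarz_ineq2[of a "pt \<tau> c"] by (simp add: inner_a_pt abs_mult)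
    then have "\<bar>\<tau>\<bar> \<le> norm (pt \<tau> c)" using a_nonzero by (simp add: mult.commute)
    then show False using norm_cube[OF \<open>pt \<tau> c \<in> cube\<close>] \<tau> by linarith
  qed
  then show ?thesis by (simp add: G_def cube_power_def)
qed

text \<open>Inside the slice, \<open>x $ i = q\<close> is a hyperplane unless the
  \<open>i\<close>-th coordinate is constant there. In that case \<open>a\<close> is parallel to the
  \<open>i\<close>-th axis, which forces dimension one because all \<open>a $ j\<close> are
  non-zero; the slice is then a single point, and it is not a vertex by assumption.\<close>

lemma pt_boundary_null:
  assumes "\<And>S. \<tau> * norm a \<noteq> (\<Sum>j\<in>UNIV. a $ j * corner S j)" and q: "\<bar>q\<bar> = 1/2"
  shows "AE c in P. pt \<tau> c $ i \<noteq> q"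
proof -
  have nth: "pt \<tau> c $ i = \<tau> * b0 $ i + (\<Sum>b\<in>B. c b * b $ i)" for c
    by (simp add: pt_def)
  show ?thesis
  proof (cases "\<exists>b\<in>B. b $ i \<noteq> 0")
    case True
    then obtain b1 where "b1 \<in> B" "b1 $ i \<noteq> 0" by blast
    from AE_PiM_lborel_not_hyperplane[OF finite_B this(1), of "\<lambda>b. b $ i" "q - \<tau> * b0 $ i", OF this(2)]
    show ?thesis unfolding P_def nth by eventually_elim auto
  next
    case False
    have sub: "x $ i = 0" if "a \<bullet> x = 0" for x
    proof -
      have "x \<in> span B" using B that by (auto simp: orthonormal_basis_of_def)
      then have "axis i 1 \<bullet> x = 0"
        using orthogonal_to_span[of x B "axis i 1"] False by (simp add: orthogonal_def inner_axis')
      then show ?thesis by (simp add: inner_axis')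
    qed
    have one: "j = i" for j
    proof (rule ccontr)
      assume "j \<noteq> i"
      have "a \<bullet> (a $ j *\<^sub>R axis i 1 - a $ i *\<^sub>R axis j 1) = 0"
        by (simp add: inner_diff_right inner_axis)
      from sub[OF this] show False using \<open>j \<noteq> i\<close> a_nth[of j] by (simp add: axis_def)
    qed
    then have UN: "UNIV = {i}" by auto
    have "pt \<tau> c $ i \<noteq> q" for c
    proof
      assume *: "pt \<tau> c $ i = q"
      have "a $ i * pt \<tau> c $ i = \<tau> * norm a" using inner_a_pt[of \<tau> c] by (simp add: inner_vec_def UN)
      moreover have "corner (if q > 0 then {i} else {}) i = q" using q by (auto simp: corner_def)
      ultimately show False using assms(1)[of "if q > 0 then {i} else {}"] * by (simp add: UN)
    qed
    then show ?thesis by simp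
  qed
qed

text \<open>Off the boundary of the cube the integrand is continuous in \<open>\<tau>\<close>, and
  almost every point of the slice is off it.\<close>

lemma isCont_G:
  assumes "\<And>S. \<tau> * norm a \<noteq> (\<Sum>j\<in>UNIV. a $ j * corner S j)"
  shows "isCont G \<tau>"
  unfolding continuous_at_sequentially comp_def
proof (intro allI impI)
  fix X assume X: "X \<longlonglongrightarrow> \<tau>"
  have ae: "AE c in P. \<forall>i. pt \<tau> c $ i \<noteq> 1/2 \<and> pt \<tau> c $ i \<noteq> -1/2"
    using pt_boundary_null[OF assms, of "1/2"] pt_boundary_null[OF assms, of "-1/2"]
    by (simp add: AE_all_countable AE_conj_iff)
  show "(\<lambda>n. G (X n)) \<longlonglongrightarrow> G \<tau>"
    unfolding G_def
  proof (rule integral_dominated_convergence[OF _ _ integrable_bound_P])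
    show "AE c in P. norm (cube_power M (pt (X n) c)) \<le> R * (\<Prod>b\<in>B. indicator {-R..R} (c b))" for n
      using pt_dominated by auto
    show "AE c in P. (\<lambda>n. cube_power M (pt (X n) c)) \<longlonglongrightarrow> cube_power M (pt \<tau> c)"
      using ae
    proof eventually_elim
      case (elim c)
      have pt: "(\<lambda>n. pt (X n) c) \<longlonglongrightarrow> pt \<tau> c" unfolding pt_def by (intro tendsto_intros X)
      have ps: "(\<lambda>n. power_sum M (pt (X n) c)) \<longlonglongrightarrow> power_sum M (pt \<tau> c)"
        by (intro tendsto_intros pt)
      have "eventually (\<lambda>n. indicator cube (pt (X n) c) = (indicator cube (pt \<tau> c) :: real)) sequentially"
      proof (cases "pt \<tau> c \<in> cube")
        case True
        have "\<bar>pt \<tau> c $ i\<bar> < 1/2" for i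
          using cube_nth_bound[OF True, of i] elim[rule_format, of i] by linarith
        moreover have "(\<lambda>n. \<bar>pt (X n) c $ i\<bar>) \<longlonglongrightarrow> \<bar>pt \<tau> c $ i\<bar>" for i by (intro tendsto_intros pt)
        ultimately have "eventually (\<lambda>n. \<bar>pt (X n) c $ i\<bar> < 1/2) sequentially" for i
          using order_tendstoD(2) by blast
        then have "eventually (\<lambda>n. \<forall>i. \<bar>pt (X n) c $ i\<bar> < 1/2) sequentially"
          by (intro eventually_all_finite) simp
        then have "eventually (\<lambda>n. pt (X n) c \<in> cube) sequentially"
          by (rule eventually_mono) (simp add: cube_def less_imp_le)
        then show ?thesis
          by (rule eventually_mono) (use True in simp)
      next
        case False
        then obtain i where "\<bar>pt \<tau> c $ i\<bar> > 1/2" by (auto simp: cube_def not_le)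
        moreover have "(\<lambda>n. \<bar>pt (X n) c $ i\<bar>) \<longlonglongrightarrow> \<bar>pt \<tau> c $ i\<bar>" by (intro tendsto_intros pt)
        ultimately have "eventually (\<lambda>n. \<bar>pt (X n) c $ i\<bar> > 1/2) sequentially"
          using order_tendstoD(1) by blast
        then have "eventually (\<lambda>n. pt (X n) c \<notin> cube) sequentially"
          by (rule eventually_mono) (meson cube_nth_bound not_le)
        then show ?thesis
          by (rule eventually_mono) (use False in simp)
      qed
      then have "(\<lambda>n. indicator cube (pt (X n) c) :: real) \<longlonglongrightarrow> indicator cube (pt \<tau> c)"
        by (rule tendsto_eventually)
      then show ?case unfolding cube_power_def by (intro tendsto_mult ps)
    qed
  qed measurable
qed

text \<open>A function of \<open>a \<bullet> x\<close> is constant on every slice, so after Fubini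
  the inner integral is \<open>G\<close>.\<close>

lemma integral_in_coordinates:
  fixes h :: "real \<Rightarrow> real"
  assumes [measurable]: "h \<in> borel_measurable borel" and h: "\<And>x. \<bar>h x\<bar> \<le> 1"
  shows "(\<integral>x. cube_power M x * h (a \<bullet> x) \<partial>lborel) = (\<integral>\<tau>. G \<tau> * h (\<tau> * norm a) \<partial>lborel)"
proof -
  let ?Q = "PiM (insert b0 B) (\<lambda>_. lborel :: real measure)"
  let ?g = "\<lambda>x::real^'n. cube_power M x * h (a \<bullet> x)"
  let ?s = "\<lambda>c. \<Sum>b\<in>insert b0 B. c b *\<^sub>R b"
  have [measurable]: "?s \<in> ?Q \<rightarrow>\<^sub>M (borel :: (real^'n) measure)" by measurable
  have lb: "distr ?Q borel ?s = lborel" by (rule distr_PiM_orthonormal_basis[OF basis])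
  have "integrable lborel ?g" by (rule integrable_cube_power_mult) (auto simp: h)
  then have "integrable (distr ?Q borel ?s) ?g" by (simp only: lb)
  then have int: "integrable ?Q (\<lambda>c. ?g (?s c))" by (subst (asm) integrable_distr_eq) auto
  have s: "?s (merge {b0} B (x, y)) = pt (x b0) y" for x y
  proof -
    have "(\<Sum>b\<in>B. merge {b0} B (x, y) b *\<^sub>R b) = (\<Sum>b\<in>B. y b *\<^sub>R b)"
      using b0_notin_B by (intro sum.cong) (auto simp: merge_def)
    then show ?thesis using finite_B b0_notin_B by (simp add: pt_def merge_def)
  qed
  have "integral\<^sup>L lborel ?g = integral\<^sup>L (distr ?Q borel ?s) ?g" by (simp only: lb)
  also have "\<dots> = (\<integral>c. ?g (?s c) \<partial>?Q)" by (rule integral_distr) auto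
  also have "\<dots> = (\<integral>x. (\<integral>y. ?g (?s (merge {b0} B (x, y))) \<partial>P) \<partial>PiM {b0} (\<lambda>_. lborel))"
    unfolding P_def using lborel_product.product_integral_fold[of "{b0}" B "\<lambda>c. ?g (?s c)"]
      finite_B b0_notin_B int by simp
  also have "\<dots> = (\<integral>x. G (x b0) * h (x b0 * norm a) \<partial>PiM {b0} (\<lambda>_. lborel))"
    unfolding s inner_a_pt G_def by simp
  also have "\<dots> = (\<integral>\<tau>. G \<tau> * h (\<tau> * norm a) \<partial>lborel)"
    by (rule lborel_product.product_integral_singleton) measurable
  finally show ?thesis .
qed

text \<open>\<open>G\<close> vanishes below \<open>- R\<close>, so any \<open>L \<le> - R\<close>
  can serve as lower limit in place of minus infinity.\<close>

lemma moment_formula_eq_integral: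
  assumes "L \<le> - R" "L \<le> s / norm a"
  shows "G integrable_on {L..s / norm a}" "moment_formula M CARD('n) a s = integral {L..s / norm a} G"
proof -
  have "set_integrable lborel {L..s / norm a} G"
    unfolding set_integrable_def
    by (rule integrableI_bounded_set_indicator[where B = "\<integral>c. R * (\<Prod>b\<in>B. indicator {-R..R} (c b)) \<partial>P"])
      (use G_bound in \<open>auto simp: emeasure_lborel_Icc_eq\<close>)
  note hk = set_borel_integral_eq_integral[OF this]
  show "G integrable_on {L..s / norm a}" by (rule hk(1))
  have "moment_formula M CARD('n) a s = (\<integral>x. cube_power M x * (\<lambda>y. trunc_pow 0 (s - y)) (a \<bullet> x) \<partial>lborel)"
    using halfspace_moment[OF a_nth] by simp
  also have "\<dots> = (\<integral>\<tau>. G \<tau> * trunc_pow 0 (s - \<tau> * norm a) \<partial>lborel)"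
    by (rule integral_in_coordinates) (auto simp: trunc_pow_def)
  also have "\<dots> = (\<integral>\<tau>. indicator {L..s / norm a} \<tau> * G \<tau> \<partial>lborel)"
  proof (rule Bochner_Integration.integral_cong[OF refl])
    fix \<tau>
    show "G \<tau> * trunc_pow 0 (s - \<tau> * norm a) = indicator {L..s / norm a} \<tau> * G \<tau>"
      using G_zero[of \<tau>] assms a_nonzero by (auto simp: trunc_pow_def indicator_def field_simps)
  qed
  also have "\<dots> = integral {L..s / norm a} G" using hk(2) by (simp add: set_lebesgue_integral_def)
  finally show "moment_formula M CARD('n) a s = integral {L..s / norm a} G" .
qed

text \<open>The half-space moment is differentiated at \<open>s\<close> in two ways: as an integral
  of the function \<open>G\<close>, continuous there, and as a vertex sum. The chain rule for
  \<open>s / norm a\<close> produces the factor \<open>norm a\<close>.\<close>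

lemma G_eq_moment_formula:
  assumes "\<And>S. s \<noteq> (\<Sum>j\<in>UNIV. a $ j * corner S j)"
  shows "G (s / norm a) = norm a * moment_formula M (CARD('n) - 1) a s"
proof -
  define \<tau> where "\<tau> = s / norm a"
  have na: "norm a > 0" using a_nonzero by simp
  \<comment> \<open>Besides \<open>L \<le> - R\<close>, the point \<open>\<tau>\<close> has to be
    interior to the interval from \<open>L\<close> to \<open>\<tau> + 1\<close>.\<close>
  define L where "L = min (- R) (\<tau> - 1)"
  have "isCont G \<tau>" using assms na by (intro isCont_G) (simp add: \<tau>_def)
  moreover have "G integrable_on {L..\<tau> + 1}"
    using moment_formula_eq_integral(1)[of L "(\<tau> + 1) * norm a"] na by (simp add: L_def min_def)
  ultimately have "((\<lambda>u. integral {L..u} G) has_vector_derivative G \<tau>) (at \<tau> within ({L..\<tau> + 1} - {}))"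
    by (intro integral_has_vector_derivative_continuous_at)
      (auto simp: L_def intro: continuous_at_imp_continuous_within)
  moreover have "at \<tau> within ({L..\<tau> + 1} - {}) = at \<tau>"
    by (rule at_within_interior) (auto simp: L_def min_def)
  ultimately have "((\<lambda>u. integral {L..u} G) has_field_derivative G \<tau>) (at \<tau>)"
    by (simp add: has_real_derivative_iff_has_vector_derivative)
  moreover have "((\<lambda>s. s / norm a) has_field_derivative 1 / norm a) (at s)"
    using a_nonzero by (auto intro!: derivative_eq_intros)
  ultimately have "((\<lambda>s. integral {L..s / norm a} G) has_field_derivative G \<tau> * (1 / norm a)) (at s)"
    using DERIV_chain2[where f = "\<lambda>u. integral {L..u} G" and g = "\<lambda>s. s / norm a"] \<tau>_def by blast
  moreover have "eventually (\<lambda>s. s \<in> {L * norm a<..}) (nhds s)"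
  proof (rule eventually_nhds_in_open)
    have "L < \<tau>" by (auto simp: L_def min_def)
    then show "s \<in> {L * norm a<..}" using na by (simp add: \<tau>_def pos_less_divide_eq)
  qed simp
  then have "eventually (\<lambda>s. moment_formula M CARD('n) a s = integral {L..s / norm a} G) (nhds s)"
  proof (rule eventually_mono)
    fix s assume "s \<in> {L * norm a<..}"
    then have "L \<le> s / norm a" using na by (simp add: pos_le_divide_eq)
    then show "moment_formula M CARD('n) a s = integral {L..s / norm a} G"
      by (intro moment_formula_eq_integral(2)) (simp_all add: L_def)
  qed
  ultimately have "(moment_formula M CARD('n) a has_field_derivative G \<tau> * (1 / norm a)) (at s)"
    by (subst DERIV_cong_ev) auto
  moreover have "(moment_formula M CARD('n) a has_field_derivative moment_formula M (CARD('n) - 1) a s) (at s)"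
    using has_field_derivative_moment_formula[OF assms, of M "CARD('n) - 1"] by simp
  ultimately have "G \<tau> * (1 / norm a) = moment_formula M (CARD('n) - 1) a s" by (rule DERIV_unique)
  then show ?thesis using na by (simp add: \<tau>_def field_simps)
qed

end

lemma slice_moment_formula:
  fixes a :: "real^'n"
  assumes "\<And>i. a $ i \<noteq> 0" "\<And>S. t / 2 \<noteq> (\<Sum>j\<in>UNIV. a $ j * corner S j)"
  shows "slice_moment M a t = norm a * moment_formula M (CARD('n) - 1) a (t / 2)"
proof -
  define B where "B = (SOME B. orthonormal_basis_of {x. a \<bullet> x = 0} B)"
  have "orthonormal_basis_of {x. a \<bullet> x = 0} B"
    unfolding B_def by (intro someI_ex[OF orthonormal_basis_of_exists] subspace_hyperplane)
  then interpret normal_coordinates a B M using assms(1) by unfold_locales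
  have na: "norm a > 0" using a_nonzero by simp
  let ?\<tau> = "t / 2 / norm a"
  have pt: "(t / 2 / (a \<bullet> a)) *\<^sub>R a + (\<Sum>b\<in>B. c b *\<^sub>R b) = pt ?\<tau> c" for c
  proof -
    have "t / 2 / (a \<bullet> a) = t / 2 / norm a * inverse (norm a)"
      by (simp only: dot_square_norm power2_eq_square divide_inverse inverse_mult_distrib mult.assoc)
    then show ?thesis by (simp only: pt_def b0_def scaleR_scaleR)
  qed
  have H: "hyperplane_lborel a t = distr P borel (pt ?\<tau>)"
    unfolding hyperplane_lborel_def Let_def B_def[symmetric] P_def pt ..
  have "closed (slice a t)"
    unfolding slice_def hyperplane_def cube_eq_cbox
    by (intro closed_Int closed_cbox closed_hyperplane)
  then have [measurable]: "slice a t \<in> sets borel" by simp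
  have "slice_moment M a t = (\<integral>x. indicator (slice a t) x * power_sum M x \<partial>distr P borel (pt ?\<tau>))"
    by (simp add: slice_moment_def set_lebesgue_integral_def H)
  also have "\<dots> = (\<integral>c. indicator (slice a t) (pt ?\<tau> c) * power_sum M (pt ?\<tau> c) \<partial>P)"
    by (rule integral_distr) measurable
  also have "\<dots> = G ?\<tau>"
    unfolding G_def using na
    by (intro Bochner_Integration.integral_cong)
      (auto simp: cube_power_def slice_def hyperplane_def inner_a_pt indicator_def)
  also have "\<dots> = norm a * moment_formula M (CARD('n) - 1) a (t / 2)"
    by (rule G_eq_moment_formula[OF assms(2)])
  finally show ?thesis .
qed

section \<open>Slicing chambers as sign cells\<close>

definition vertex :: "'n set \<Rightarrow> real^'n" where
  "vertex S = (\<chi> j. corner S j)"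

lemma inner_vertex: "a \<bullet> vertex S = (\<Sum>j\<in>UNIV. a $ j * corner S j)"
  by (simp add: vertex_def inner_vec_def)

lemma vertex_Compl: "vertex (- S) = - vertex S"
  by (simp add: vertex_def corner_def vec_eq_iff)

lemma inj_vertex: "inj (vertex :: 'n::finite set \<Rightarrow> real^'n)"
proof (rule injI)
  fix S T :: "'n set" assume "vertex S = vertex T"
  then have "\<forall>j. corner S j = corner T j" by (simp add: vertex_def vec_eq_iff)
  then have "j \<in> S \<longleftrightarrow> j \<in> T" for j by (auto simp: corner_def split: if_splits dest!: spec[of _ j])
  then show "S = T" by blast
qed

lemma cube_vertices_eq: "cube_vertices = range vertex"
proof (intro set_eqI iffI)
  fix v :: "real^'n" assume v: "v \<in> cube_vertices"
  have "v = vertex {j. v $ j = 1/2}"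
    using v by (auto simp: cube_vertices_def vertex_def corner_def vec_eq_iff)
  then show "v \<in> range vertex" by blast
qed (auto simp: cube_vertices_def vertex_def corner_def split: if_splits)

definition separating :: "real^'n \<Rightarrow> bool" where
  "separating a \<longleftrightarrow> (\<forall>S T. S \<noteq> T \<longrightarrow> a \<bullet> vertex S \<noteq> a \<bullet> vertex T)"

text \<open>Implications suffice: a separating \<open>b\<close> compares any two distinct vertices
  strictly, so the converse is forced.\<close>

definition same_order :: "real^'n \<Rightarrow> real^'n \<Rightarrow> bool" where
  "same_order b a \<longleftrightarrow> (\<forall>S T. b \<bullet> vertex S < b \<bullet> vertex T \<longrightarrow> a \<bullet> vertex S < a \<bullet> vertex T)"

lemma separating_same_order:
  assumes "separating b" "same_order b a"
  shows "separating a" "a \<bullet> vertex S < a \<bullet> vertex T \<longleftrightarrow> b \<bullet> vertex S < b \<bullet> vertex T"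
proof -
  show "separating a" using assms unfolding separating_def same_order_def by (metis less_irrefl linorder_less_linear)
  show "a \<bullet> vertex S < a \<bullet> vertex T \<longleftrightarrow> b \<bullet> vertex S < b \<bullet> vertex T"
    using assms unfolding separating_def same_order_def by (metis less_asym linorder_less_linear)
qed

lemma separating_nonzero:
  assumes "separating a" shows "a \<noteq> 0"
  using assms unfolding separating_def by (metis UNIV_not_empty inner_zero_left)

text \<open>The vertices of \<open>{i}\<close> and \<open>{}\<close> differ by the
  \<open>i\<close>-th axis vector. Hence the vertex formulas apply throughout every chamber.\<close>

lemma separating_nth_nonzero:
  assumes "separating a" shows "a $ i \<noteq> 0"
proof -
  have "a \<bullet> vertex {i} \<noteq> a \<bullet> vertex {}" using assms unfolding separating_def by blast
  moreover have "vertex {i} - vertex {} = (axis i 1 :: real^'a)"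
    by (auto simp: vertex_def corner_def vec_eq_iff axis_def)
  then have "a \<bullet> vertex {i} - a \<bullet> vertex {} = a $ i"
    by (metis inner_diff_right inner_axis mult.right_neutral inner_real_def)
  ultimately show ?thesis by auto
qed

text \<open>The sign of a vertex value is the outcome of comparing the vertex with its
  antipode.\<close>

lemma same_order_pos:
  assumes "separating b" "same_order b a"
  shows "0 < a \<bullet> vertex S \<longleftrightarrow> 0 < b \<bullet> vertex S"
  using separating_same_order(2)[OF assms, of "- S" S] by (simp add: vertex_Compl)

lemma sweep_complement_eq:
  "sphere 0 1 - \<Union>sweep_hyperplanes = {a :: real^'n. norm a = 1 \<and> separating a}"
proof -
  have "x \<in> \<Union>sweep_hyperplanes \<longleftrightarrow> (\<exists>S T. S \<noteq> T \<and> x \<bullet> vertex S = x \<bullet> vertex T)" for x :: "real^'n"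
  proof
    assume "x \<in> \<Union>sweep_hyperplanes"
    then obtain S T where "vertex S \<noteq> (vertex T :: real^'n)" "(vertex S - vertex T) \<bullet> x = 0"
      unfolding sweep_hyperplanes_def cube_vertices_eq by blast
    then show "\<exists>S T. S \<noteq> T \<and> x \<bullet> vertex S = x \<bullet> vertex T"
      by (intro exI[of _ S] exI[of _ T]) (auto simp: inner_diff_right inner_commute)
  next
    assume "\<exists>S T. S \<noteq> T \<and> x \<bullet> vertex S = x \<bullet> vertex T"
    then obtain S T where ST: "S \<noteq> T" "x \<bullet> vertex S = x \<bullet> vertex T" by blast
    then have "vertex S \<noteq> (vertex T :: real^'n)" using inj_vertex by (auto dest: injD)
    moreover have "x \<in> {x. (vertex S - vertex T) \<bullet> x = 0}"
      using ST(2) by (simp add: inner_diff_right inner_commute)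
    ultimately show "x \<in> \<Union>sweep_hyperplanes"
      unfolding sweep_hyperplanes_def cube_vertices_eq by blast
  qed
  then show ?thesis
    unfolding separating_def set_eq_iff Diff_iff mem_sphere_0 mem_Collect_eq by blast
qed

definition region_of :: "real^'n \<Rightarrow> (real^'n) set" where
  "region_of b = {a. norm a = 1 \<and> same_order b a}"

lemma same_order_refl: "same_order b b" by (simp add: same_order_def)

lemma same_order_sym: "separating b \<Longrightarrow> same_order b a \<Longrightarrow> same_order a b"
  using separating_same_order(2) unfolding same_order_def by blast

lemma same_order_trans: "same_order b a \<Longrightarrow> same_order a c \<Longrightarrow> same_order b c"
  unfolding same_order_def by blast

lemma same_order_scaleR: "r > 0 \<Longrightarrow> same_order b (r *\<^sub>R a) \<longleftrightarrow> same_order b a"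
  by (simp add: same_order_def)

lemma same_order_halfspaces:
  "{a. same_order b a} = (\<Inter>(S,T)\<in>{(S,T). b \<bullet> vertex S < b \<bullet> vertex T}. {a. (vertex S - vertex T) \<bullet> a < 0})"
  by (auto simp: same_order_def inner_diff_right inner_commute)

text \<open>The vectors with a prescribed vertex order form a convex cone, and radial projection to
  the sphere is continuous.\<close>

lemma connected_region_of:
  assumes "separating b" shows "connected (region_of b)"
proof -
  have "convex {a. same_order b a}"
    unfolding same_order_halfspaces by (intro convex_INT) (auto intro: convex_halfspace_lt)
  then have "connected {a. same_order b a}" by (rule convex_connected)
  moreover have nz: "a \<noteq> 0" if "same_order b a" for a
    using separating_nonzero separating_same_order(1)[OF assms that] by blast
  then have "continuous_on {a. same_order b a} (\<lambda>a. a /\<^sub>R norm a)"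
    by (intro continuous_intros) auto
  ultimately have "connected ((\<lambda>a. a /\<^sub>R norm a) ` {a. same_order b a})"
    by (rule connected_continuous_image[rotated])
  also have "(\<lambda>a. a /\<^sub>R norm a) ` {a. same_order b a} = region_of b"
  proof (intro set_eqI iffI)
    fix x assume "x \<in> (\<lambda>a. a /\<^sub>R norm a) ` {a. same_order b a}"
    then show "x \<in> region_of b" using nz by (auto simp: region_of_def same_order_scaleR)
  next
    fix x assume "x \<in> region_of b"
    then show "x \<in> (\<lambda>a. a /\<^sub>R norm a) ` {a. same_order b a}"
      by (intro image_eqI[of _ _ x]) (auto simp: region_of_def)
  qed
  finally show ?thesis .
qed

text \<open>A connected set on which the order of two vertices changes contains a point where their
  values agree, and such a point lies on a sweep hyperplane. So each component carries one vertex
  order; the converse inclusion is the connectedness of \<open>region_of b\<close>.\<close>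

lemma sweep_regions_eq: "sweep_regions = {region_of b |b :: real^'n. norm b = 1 \<and> separating b}"
proof -
  let ?X = "{a :: real^'n. norm a = 1 \<and> separating a}"
  have "connected_component_set ?X b = region_of b" if b: "b \<in> ?X" for b
  proof
    have "region_of b \<subseteq> ?X" using separating_same_order(1) b by (auto simp: region_of_def)
    then show "region_of b \<subseteq> connected_component_set ?X b"
      using b by (intro connected_component_maximal connected_region_of) (auto simp: region_of_def same_order_refl)
    show "connected_component_set ?X b \<subseteq> region_of b"
    proof
      fix a assume a: "a \<in> connected_component_set ?X b"
      let ?C = "connected_component_set ?X b"
      have sub: "?C \<subseteq> ?X" by (rule connected_component_subset)
      have bC: "b \<in> ?C" using b by (simp add: connected_component_refl)
      have "a \<bullet> vertex S < a \<bullet> vertex T" if "b \<bullet> vertex S < b \<bullet> vertex T" for S T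
      proof (rule ccontr)
        assume *: "\<not> a \<bullet> vertex S < a \<bullet> vertex T"
        have "\<exists>z\<in>?C. (vertex T - vertex S) \<bullet> z = 0"
        proof (rule connected_ivt_hyperplane[OF connected_connected_component a bC])
          show "(vertex T - vertex S) \<bullet> a \<le> 0" "0 \<le> (vertex T - vertex S) \<bullet> b"
            using * that by (simp_all add: inner_diff_right inner_commute)
        qed
        then obtain z where "z \<in> ?C" "z \<bullet> vertex T = z \<bullet> vertex S"
          by (auto simp: inner_diff_right inner_commute)
        moreover have "S \<noteq> T" using that by auto
        moreover have "separating z" using sub \<open>z \<in> ?C\<close> by blast
        ultimately show False unfolding separating_def by metis
      qed
      then show "a \<in> region_of b" using sub a by (auto simp: region_of_def same_order_def)
    qed
  qed
  then show ?thesis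
    unfolding sweep_regions_def sweep_complement_eq components_def by (auto simp: image_iff)
qed

section \<open>Cells of the arrangement of walls in \<open>(a,t)\<close>-space\<close>

definition generic :: "(real^'n) \<times> real \<Rightarrow> bool" where
  "generic z \<longleftrightarrow> separating (fst z) \<and> snd z \<noteq> 0 \<and> (\<forall>S. fst z \<bullet> vertex S \<noteq> snd z / 2)"

text \<open>Every condition on \<open>z\<close> is a strict inequality whose direction is read off
  from \<open>g\<close>. The set is therefore open and invariant under positive scaling, and for
  generic \<open>g\<close> it is the sign cell that contains \<open>g\<close>.\<close>

definition cone_cell :: "(real^'n) \<times> real \<Rightarrow> ((real^'n) \<times> real) set" where
  "cone_cell g = {z. same_order (fst g) (fst z) \<and>
     (\<forall>S. (fst g \<bullet> vertex S < snd g / 2 \<longrightarrow> fst z \<bullet> vertex S < snd z / 2) \<and>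
          (\<not> fst g \<bullet> vertex S < snd g / 2 \<longrightarrow> snd z / 2 < fst z \<bullet> vertex S)) \<and>
     (snd g > 0 \<longrightarrow> snd z > 0) \<and> (\<not> snd g > 0 \<longrightarrow> snd z < 0)}"

definition cell :: "(real^'n) \<times> real \<Rightarrow> ((real^'n) \<times> real) set" where
  "cell g = {z \<in> cone_cell g. norm (fst z) = 1}"

lemma open_cone_cell: "open (cone_cell (g :: (real^'n) \<times> real))"
proof -
  have "open {z. snd z > (0::real)}" "open {z. snd z < (0::real)}"
      "open {z :: (real^'n) \<times> real. fst z \<bullet> vertex S < snd z / 2}"
      "open {z :: (real^'n) \<times> real. snd z / 2 < fst z \<bullet> vertex S}"
      "open {z :: (real^'n) \<times> real. fst z \<bullet> vertex S < fst z \<bullet> vertex T}" for S T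
    by (auto intro!: open_Collect_less continuous_intros)
  note op = this
  have "cone_cell g = (\<Inter>(S,T)\<in>{(S,T). fst g \<bullet> vertex S < fst g \<bullet> vertex T}. {z. fst z \<bullet> vertex S < fst z \<bullet> vertex T})
    \<inter> (\<Inter>S. if fst g \<bullet> vertex S < snd g / 2 then {z. fst z \<bullet> vertex S < snd z / 2} else {z. snd z / 2 < fst z \<bullet> vertex S})
    \<inter> (if snd g > 0 then {z. snd z > 0} else {z. snd z < 0})"
    by (auto simp: cone_cell_def same_order_def)
  also have "open \<dots>"
  proof (intro open_Int open_INT ballI)
    show "open (if snd g > 0 then {z. snd z > 0} else {z. snd z < 0} :: ((real^'n) \<times> real) set)"
      by (auto intro!: open_Collect_less continuous_intros)
    show "open (if fst g \<bullet> vertex S < snd g / 2 then {z. fst z \<bullet> vertex S < snd z / 2}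
        else {z. snd z / 2 < fst z \<bullet> vertex S} :: ((real^'n) \<times> real) set)" for S
      by (cases "fst g \<bullet> vertex S < snd g / 2") (simp_all only: if_True if_False op)
  qed (auto intro: op)
  finally show ?thesis .
qed

lemma cone_cell_scaleR: "z \<in> cone_cell g \<Longrightarrow> r > 0 \<Longrightarrow> r *\<^sub>R z \<in> cone_cell g"
proof -
  assume z: "z \<in> cone_cell g" and r: "r > 0"
  have "r * x < r * y / 2 \<longleftrightarrow> x < y / 2" "r * y / 2 < r * x \<longleftrightarrow> y / 2 < x" for x y :: real
    using r mult_less_cancel_left_pos[of r x "y/2"] mult_less_cancel_left_pos[of r "y/2" x] by auto
  then have "fst (r *\<^sub>R z) \<bullet> vertex S < snd (r *\<^sub>R z) / 2 \<longleftrightarrow> fst z \<bullet> vertex S < snd z / 2"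
    "snd (r *\<^sub>R z) / 2 < fst (r *\<^sub>R z) \<bullet> vertex S \<longleftrightarrow> snd z / 2 < fst z \<bullet> vertex S" for S
    by simp_all
  moreover have "same_order (fst g) (fst (r *\<^sub>R z)) \<longleftrightarrow> same_order (fst g) (fst z)"
    "snd (r *\<^sub>R z) > 0 \<longleftrightarrow> snd z > 0" "snd (r *\<^sub>R z) < 0 \<longleftrightarrow> snd z < 0"
    using r by (simp_all add: same_order_scaleR zero_less_mult_iff mult_less_0_iff)
  ultimately show ?thesis using z unfolding cone_cell_def mem_Collect_eq by presburger
qed

lemma generic_in_cone_cell: "generic g \<Longrightarrow> g \<in> cone_cell g"
  unfolding cone_cell_def generic_def mem_Collect_eq using same_order_refl linorder_less_linear by metis

lemma generic_in_cell: "generic g \<Longrightarrow> norm (fst g) = 1 \<Longrightarrow> g \<in> cell g"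
  by (simp add: cell_def generic_in_cone_cell)

lemma cone_cell_generic:
  assumes "generic g" "z \<in> cone_cell g"
  shows "generic z" "fst z \<bullet> vertex S < snd z / 2 \<longleftrightarrow> fst g \<bullet> vertex S < snd g / 2" "0 < snd z \<longleftrightarrow> 0 < snd g"
proof -
  have so: "same_order (fst g) (fst z)"
    and lt: "fst g \<bullet> vertex S < snd g / 2 \<Longrightarrow> fst z \<bullet> vertex S < snd z / 2"
    and gt: "\<not> fst g \<bullet> vertex S < snd g / 2 \<Longrightarrow> snd z / 2 < fst z \<bullet> vertex S"
    and t: "snd g > 0 \<Longrightarrow> snd z > 0" "\<not> snd g > 0 \<Longrightarrow> snd z < 0" for S
    using assms(2) unfolding cone_cell_def mem_Collect_eq by blast+
  have "fst z \<bullet> vertex S \<noteq> snd z / 2" for S using lt[of S] gt[of S] by (metis less_irrefl)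
  moreover have "snd z \<noteq> 0" using t by (metis less_irrefl)
  ultimately show "generic z"
    using separating_same_order(1)[OF _ so] assms(1) unfolding generic_def by blast
  show "fst z \<bullet> vertex S < snd z / 2 \<longleftrightarrow> fst g \<bullet> vertex S < snd g / 2"
    using lt[of S] gt[of S] by (meson less_asym)
  show "0 < snd z \<longleftrightarrow> 0 < snd g" using t by (meson less_asym)
qed

lemma cone_cell_eq:
  assumes "generic g" "z \<in> cone_cell g" shows "cone_cell z = cone_cell g"
proof -
  have so: "same_order (fst g) (fst z)" using assms(2) by (simp add: cone_cell_def)
  then have "same_order (fst z) a \<longleftrightarrow> same_order (fst g) a" for a
    using same_order_sym[OF _ so] same_order_trans assms(1) unfolding generic_def by blast
  then show ?thesis unfolding cone_cell_def using cone_cell_generic(2,3)[OF assms] by simp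
qed

lemma cell_eq: "generic g \<Longrightarrow> z \<in> cell g \<Longrightarrow> cell z = cell g"
  unfolding cell_def using cone_cell_eq[of g z] by simp

text \<open>Normalising the first component leads from the cone back to the cell; degrees may thus
  be computed on the open set \<open>cone_cell g\<close>.\<close>

lemma cone_over_cell:
  assumes "generic g" shows "cone_over (cell g) = cone_cell g"
proof (intro set_eqI iffI)
  fix z assume "z \<in> cone_over (cell g)"
  then obtain r a t where "z = (r *\<^sub>R a, r * t)" "r > 0" "(a, t) \<in> cell g" by (auto simp: cone_over_def)
  then show "z \<in> cone_cell g" using cone_cell_scaleR[of "(a, t)" g r] by (auto simp: cell_def)
next
  fix z assume z: "z \<in> cone_cell g"
  have n: "norm (fst z) > 0"
    using cone_cell_generic(1)[OF assms z] separating_nonzero by (auto simp: generic_def)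
  define r where "r = norm (fst z)"
  have "inverse r *\<^sub>R z \<in> cell g"
    using n cone_cell_scaleR[OF z, of "inverse r"] by (simp add: cell_def r_def)
  then have "(inverse r *\<^sub>R fst z, inverse r * snd z) \<in> cell g" by (cases z) simp
  moreover have "z = (r *\<^sub>R (inverse r *\<^sub>R fst z), r * (inverse r * snd z))"
    using n by (simp add: r_def prod_eq_iff)
  moreover have "r > 0" using n by (simp add: r_def)
  ultimately show "z \<in> cone_over (cell g)" unfolding cone_over_def by blast
qed

text \<open>Replaces a position in the sorted list by the number of smaller elements, which can be
  compared between different vectors \<open>a\<close>.\<close>

lemma sorted_list_between_iff:
  fixes A :: "real set"
  assumes "finite A"
  defines "xs \<equiv> sorted_list_of_set A"
  shows "Suc j < length xs \<and> xs ! j < y \<and> y < xs ! Suc j \<longleftrightarrow>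
    y \<notin> A \<and> (\<exists>x\<in>A. y < x) \<and> card {x\<in>A. x < y} = Suc j"
proof -
  have sorted: "sorted_wrt (<) xs" and dist: "distinct xs" and set: "set xs = A"
    using assms by (auto simp: xs_def strict_sorted_list_of_set)
  have mono: "xs ! i < xs ! k" if "i < k" "k < length xs" for i k
    using sorted that by (simp add: sorted_wrt_nth_less)
  have card_take: "card (set (take k xs)) = k" if "k \<le> length xs" for k
    using that dist by (simp add: distinct_card)
  have mem_take: "x \<in> set (take k xs) \<longleftrightarrow> (\<exists>i<k. i < length xs \<and> x = xs ! i)" for x k
    by (auto simp: in_set_conv_nth)
  show ?thesis
  proof
    assume l: "Suc j < length xs \<and> xs ! j < y \<and> y < xs ! Suc j"
    have lt: "xs ! i < y" if "i < Suc j" for i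
      using mono[of i j] that l by (cases "i = j") (auto intro: less_trans)
    have gt: "y < xs ! i" if "Suc j \<le> i" "i < length xs" for i
      using mono[of "Suc j" i] that l by (cases "i = Suc j") (auto intro: less_trans)
    have "{x\<in>A. x < y} = set (take (Suc j) xs)"
    proof (intro set_eqI iffI)
      fix x assume "x \<in> {x\<in>A. x < y}"
      then obtain i where "i < length xs" "x = xs ! i" "x < y"
        unfolding set[symmetric] by (auto simp: in_set_conv_nth)
      then show "x \<in> set (take (Suc j) xs)" unfolding mem_take using gt[of i] by (cases "i < Suc j") auto
    next
      fix x assume "x \<in> set (take (Suc j) xs)"
      then show "x \<in> {x\<in>A. x < y}" unfolding mem_take set[symmetric] using lt by auto
    qed
    moreover have "y \<notin> A"
    proof
      assume "y \<in> A"
      then obtain i where "i < length xs" "y = xs ! i" unfolding set[symmetric] by (auto simp: in_set_conv_nth)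
      then show False using lt[of i] gt[of i] by (cases "i < Suc j") auto
    qed
    moreover have "xs ! Suc j \<in> A" using l set nth_mem by blast
    ultimately show "y \<notin> A \<and> (\<exists>x\<in>A. y < x) \<and> card {x\<in>A. x < y} = Suc j"
      using l card_take[of "Suc j"] by auto
  next
    assume r: "y \<notin> A \<and> (\<exists>x\<in>A. y < x) \<and> card {x\<in>A. x < y} = Suc j"
    then obtain x where "x \<in> A" "y < x" by blast
    then have "x \<in> A - {x\<in>A. x < y}" by simp
    then have "{x\<in>A. x < y} \<subset> A" by blast
    then have len: "Suc j < length xs"
      using psubset_card_mono[OF assms(1), of "{x\<in>A. x < y}"] r distinct_card[OF dist] set by simp
    have "xs ! j < y"
    proof (rule ccontr)
      \<comment> \<open>In this case only list entries with index below \<open>j\<close> lie below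
        \<open>y\<close>, too few for the assumed count.\<close>
      assume "\<not> xs ! j < y"
      then have "y \<le> xs ! i" if "j \<le> i" "i < length xs" for i
        using mono[of j i] that by (cases "i = j") auto
      then have "i < j" if "i < length xs" "xs ! i < y" for i using that by (meson not_less)
      note small = this
      have "x \<in> set (take j xs)" if "x \<in> A" "x < y" for x
      proof -
        obtain i where "i < length xs" "x = xs ! i"
          using \<open>x \<in> A\<close> unfolding set[symmetric] in_set_conv_nth by metis
        then show ?thesis using small[of i] \<open>x < y\<close> unfolding mem_take by metis
      qed
      then have "{x\<in>A. x < y} \<subseteq> set (take j xs)" by (intro subsetI) simp
      then have "Suc j \<le> j" using card_mono[of "set (take j xs)" "{x\<in>A. x < y}"] r card_take[of j] len by simp
      then show False by simp
    qed
    moreover have "y < xs ! Suc j"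
    proof (rule ccontr)
      \<comment> \<open>In this case the entries with indices \<open>0\<close> to
        \<open>Suc j\<close> all lie below \<open>y\<close>, one too many.\<close>
      assume "\<not> y < xs ! Suc j"
      moreover have "xs ! Suc j \<noteq> y" using r set len nth_mem by metis
      ultimately have small: "xs ! i < y" if "i < Suc (Suc j)" for i
        using mono[of i "Suc j"] that len by (cases "i = Suc j") auto
      have "set (take (Suc (Suc j)) xs) \<subseteq> {x\<in>A. x < y}"
      proof
        fix x assume "x \<in> set (take (Suc (Suc j)) xs)"
        then obtain i where "i < Suc (Suc j)" "i < length xs" "x = xs ! i" unfolding mem_take by metis
        then show "x \<in> {x\<in>A. x < y}" using small[of i] set nth_mem[of i xs] by simp
      qed
      then have "Suc (Suc j) \<le> Suc j"
        using card_mono[of "{x\<in>A. x < y}" "set (take (Suc (Suc j)) xs)"] r card_take[of "Suc (Suc j)"] len assms(1) by simp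
      then show False by simp
    qed
    ultimately show "Suc j < length xs \<and> xs ! j < y \<and> y < xs ! Suc j" using len by simp
  qed
qed

section \<open>Identification of chambers and outer pieces with cells\<close>

definition positive_levels :: "real^'n \<Rightarrow> real set" where
  "positive_levels a = {a \<bullet> v |v. v \<in> cube_vertices \<and> a \<bullet> v > 0}"

lemma positive_levels_iff: "x \<in> positive_levels a \<longleftrightarrow> 0 < x \<and> (\<exists>S. x = a \<bullet> vertex S)"
  unfolding positive_levels_def cube_vertices_eq by blast

lemma finite_positive_levels: "finite (positive_levels a)"
proof -
  have "positive_levels a \<subseteq> range (\<lambda>S. a \<bullet> vertex S)" using positive_levels_iff by blast
  then show ?thesis by (rule finite_subset) simp
qed

lemma levels_eq: "levels a = sorted_list_of_set (insert 0 (positive_levels a))"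
  by (simp add: levels_def positive_levels_def)

definition lower_positive :: "real^'n \<Rightarrow> real \<Rightarrow> 'n set set" where
  "lower_positive a y = {S. 0 < a \<bullet> vertex S \<and> a \<bullet> vertex S < y}"

text \<open>The extra level \<open>0\<close> accounts for the difference between
  \<open>Suc j\<close> list elements and \<open>j\<close> vertices. Since \<open>a\<close> is
  separating, different vertices have different levels, so counting vertices is counting
  levels.\<close>

lemma between_levels_iff:
  assumes "separating a"
  shows "Suc j < length (levels a) \<and> levels a ! j < y \<and> y < levels a ! Suc j \<longleftrightarrow>
    0 < y \<and> (\<forall>S. a \<bullet> vertex S \<noteq> y) \<and> (\<exists>S. y < a \<bullet> vertex S) \<and> card (lower_positive a y) = j"
proof -
  let ?A = "insert 0 (positive_levels a)"
  have fin: "finite ?A" using finite_positive_levels by simp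
  have eq: "Suc j < length (levels a) \<and> levels a ! j < y \<and> y < levels a ! Suc j \<longleftrightarrow>
      y \<notin> ?A \<and> (\<exists>x\<in>?A. y < x) \<and> card {x\<in>?A. x < y} = Suc j"
    unfolding levels_eq by (rule sorted_list_between_iff[OF fin])
  show ?thesis
  proof (cases "0 < y")
    case True
    have "{x\<in>?A. x < y} = insert 0 ((\<lambda>S. a \<bullet> vertex S) ` lower_positive a y)"
      using True by (auto simp: positive_levels_iff lower_positive_def)
    moreover have "0 \<notin> (\<lambda>S. a \<bullet> vertex S) ` lower_positive a y" by (auto simp: lower_positive_def)
    moreover have "inj_on (\<lambda>S. a \<bullet> vertex S) (lower_positive a y)"
      using assms unfolding separating_def inj_on_def by metis
    ultimately have "card {x\<in>?A. x < y} = Suc (card (lower_positive a y))"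
      by (simp add: card_image)
    moreover have "y \<notin> ?A \<longleftrightarrow> (\<forall>S. a \<bullet> vertex S \<noteq> y)" using True by (auto simp: positive_levels_iff)
    moreover have "(\<exists>x\<in>?A. y < x) \<longleftrightarrow> (\<exists>S. y < a \<bullet> vertex S)"
    proof
      assume "\<exists>S. y < a \<bullet> vertex S"
      then obtain S where "y < a \<bullet> vertex S" by blast
      then show "\<exists>x\<in>?A. y < x" using True
        by (intro bexI[of _ "a \<bullet> vertex S"]) (auto simp: positive_levels_iff intro: less_trans)
    qed (use True in \<open>auto simp: positive_levels_iff\<close>)
    ultimately show ?thesis unfolding eq using True by simp
  next
    case False
    then have "{x\<in>?A. x < y} = {}" by (auto simp: positive_levels_iff)
    then have "card {x\<in>?A. x < y} = 0" by (simp only: card.empty)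
    then show ?thesis unfolding eq using False by simp
  qed
qed

lemma last_levels_less_iff: "last (levels a) < y \<longleftrightarrow> 0 < y \<and> (\<forall>S. a \<bullet> vertex S < y)"
proof -
  let ?A = "insert 0 (positive_levels a)"
  let ?xs = "levels a"
  have set: "set ?xs = ?A" unfolding levels_eq by (intro set_sorted_list_of_set finite.insertI finite_positive_levels)
  have so: "sorted ?xs" unfolding levels_eq by (rule sorted_sorted_list_of_set)
  have ne: "?xs \<noteq> []" using set by auto
  have "last ?xs \<in> ?A" using ne set last_in_set by blast
  moreover have "x \<le> last ?xs" if x: "x \<in> ?A" for x
  proof -
    obtain i where "i < length ?xs" "x = ?xs ! i" using x unfolding set[symmetric] in_set_conv_nth by metis
    then show ?thesis using so ne by (simp add: last_conv_nth sorted_nth_mono)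
  qed
  ultimately have "last ?xs < y \<longleftrightarrow> (\<forall>x\<in>?A. x < y)" by (meson le_less_trans)
  also have "\<dots> \<longleftrightarrow> 0 < y \<and> (\<forall>S. a \<bullet> vertex S < y)"
  proof
    assume *: "\<forall>x\<in>?A. x < y"
    have "a \<bullet> vertex S < y" for S
    proof (cases "0 < a \<bullet> vertex S")
      case True
      then have "a \<bullet> vertex S \<in> ?A" by (auto simp: positive_levels_iff)
      then show ?thesis using * by blast
    next
      case False
      then show ?thesis using * by auto
    qed
    then show "0 < y \<and> (\<forall>S. a \<bullet> vertex S < y)" using * by simp
  qed (auto simp: positive_levels_iff)
  finally show ?thesis .
qed

text \<open>The points covered by the chambers; the last clause keeps \<open>t/2\<close> below the
  largest level and so excludes the outer pieces.\<close>

definition inner_generic :: "(real^'n) \<times> real \<Rightarrow> bool" where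
  "inner_generic g \<longleftrightarrow> generic g \<and> norm (fst g) = 1 \<and> 0 < snd g \<and> (\<exists>S. snd g / 2 < fst g \<bullet> vertex S)"

lemma mem_slicing_chamber_iff:
  assumes "separating b"
  shows "z \<in> slicing_chamber (region_of b) j \<longleftrightarrow>
    inner_generic z \<and> same_order b (fst z) \<and> card (lower_positive (fst z) (snd z / 2)) = j"
proof (cases z)
  case (Pair a t)
  show ?thesis
  proof (cases "same_order b a")
    case True
    note sep = separating_same_order(1)[OF assms True]
    show ?thesis
      unfolding slicing_chamber_def Pair mem_Collect_eq case_prod_conv between_levels_iff[OF sep]
        inner_generic_def generic_def region_of_def fst_conv snd_conv
      using True sep by auto
  next
    case False
    then show ?thesis unfolding Pair slicing_chamber_def region_of_def by simp
  qed
qed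

lemma inner_generic_in_cell: "inner_generic g \<Longrightarrow> g \<in> cell g"
  by (auto simp: inner_generic_def intro: generic_in_cell)

text \<open>The index \<open>j\<close> records only how many positive vertices lie below the level.
  These vertices form initial segments of one common order, so two such sets are comparable by
  inclusion and, being equally large, equal.\<close>

lemma slicing_chamber_eq_cell:
  assumes g: "inner_generic g" and sep: "separating b" and mem: "g \<in> slicing_chamber (region_of b) j"
  shows "slicing_chamber (region_of b) j = cell g"
proof (intro set_eqI iffI)
  have gen: "generic g" and so: "same_order b (fst g)" and cj: "card (lower_positive (fst g) (snd g / 2)) = j"
    using g mem by (auto simp: inner_generic_def mem_slicing_chamber_iff[OF sep])
  have sepg: "separating (fst g)" using gen by (simp add: generic_def)
  fix z
  assume "z \<in> slicing_chamber (region_of b) j"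
  then have z: "inner_generic z" "same_order b (fst z)" "card (lower_positive (fst z) (snd z / 2)) = j"
    by (auto simp: mem_slicing_chamber_iff[OF sep])
  have zg: "same_order (fst g) (fst z)" using same_order_sym[OF sep so] same_order_trans z(2) by blast
  have genz: "generic z" using z(1) by (simp add: inner_generic_def)
  let ?N = "\<lambda>z. lower_positive (fst z) (snd z / 2)"
  have pos: "0 < fst z \<bullet> vertex S \<longleftrightarrow> 0 < fst g \<bullet> vertex S" for S
    by (rule same_order_pos[OF sepg zg])
  have ord: "fst z \<bullet> vertex S < fst z \<bullet> vertex T \<longleftrightarrow> fst g \<bullet> vertex S < fst g \<bullet> vertex T" for S T
    by (rule separating_same_order(2)[OF sepg zg])
  have nez: "fst z \<bullet> vertex S \<noteq> snd z / 2" and neg: "fst g \<bullet> vertex S \<noteq> snd g / 2" for S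
    using genz gen unfolding generic_def by blast+
  have "?N z \<subseteq> ?N g \<or> ?N g \<subseteq> ?N z"
  proof (rule ccontr)
    assume "\<not> ?thesis"
    then obtain S T where S: "S \<in> ?N z" "S \<notin> ?N g" and T: "T \<in> ?N g" "T \<notin> ?N z" by blast
    have "snd g / 2 < fst g \<bullet> vertex S" using S pos neg[of S] unfolding lower_positive_def mem_Collect_eq
      by (metis linorder_less_linear)
    moreover have "fst g \<bullet> vertex T < snd g / 2" using T by (simp add: lower_positive_def)
    ultimately have "fst z \<bullet> vertex T < fst z \<bullet> vertex S" unfolding ord by (rule less_trans[rotated])
    moreover have "fst z \<bullet> vertex S < snd z / 2" using S by (simp add: lower_positive_def)
    moreover have "0 < fst z \<bullet> vertex T" using T pos by (simp add: lower_positive_def)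
    ultimately show False using T(2) unfolding lower_positive_def mem_Collect_eq by (meson less_trans)
  qed
  then have N: "?N z = ?N g"
    using card_subset_eq[of "?N g" "?N z"] card_subset_eq[of "?N z" "?N g"] z(3) cj by auto
  have tz: "0 < snd z" "0 < snd g" using z(1) g by (auto simp: inner_generic_def)
  have lt: "fst z \<bullet> vertex S < snd z / 2 \<longleftrightarrow> fst g \<bullet> vertex S < snd g / 2" for S
  proof (cases "0 < fst z \<bullet> vertex S")
    case True
    then show ?thesis using N pos unfolding lower_positive_def set_eq_iff mem_Collect_eq by metis
  next
    case False
    then have "\<not> 0 < fst g \<bullet> vertex S" using pos by simp
    then have "fst z \<bullet> vertex S < snd z / 2" "fst g \<bullet> vertex S < snd g / 2" using False tz by linarith+
    then show ?thesis by simp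
  qed
  have gt: "snd z / 2 < fst z \<bullet> vertex S" if "\<not> fst g \<bullet> vertex S < snd g / 2" for S
    using lt[of S] nez[of S] that by (metis linorder_less_linear)
  show "z \<in> cell g"
    unfolding cell_def cone_cell_def using zg lt gt tz z(1) by (simp add: inner_generic_def)
next
  have gen: "generic g" and so: "same_order b (fst g)" and cj: "card (lower_positive (fst g) (snd g / 2)) = j"
    using g mem by (auto simp: inner_generic_def mem_slicing_chamber_iff[OF sep])
  have sepg: "separating (fst g)" using gen by (simp add: generic_def)
  fix z assume "z \<in> cell g"
  then have zc: "z \<in> cone_cell g" and nz: "norm (fst z) = 1" by (auto simp: cell_def)
  note z = cone_cell_generic[OF gen zc]
  have zg: "same_order (fst g) (fst z)" using zc by (simp add: cone_cell_def)
  have "lower_positive (fst z) (snd z / 2) = lower_positive (fst g) (snd g / 2)"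
    unfolding lower_positive_def z(2) same_order_pos[OF sepg zg] ..
  moreover obtain S where "snd g / 2 < fst g \<bullet> vertex S" using g by (auto simp: inner_generic_def)
  then have "snd z / 2 < fst z \<bullet> vertex S" using zc unfolding cone_cell_def mem_Collect_eq by (meson less_asym)
  then have "inner_generic z" using z(1) z(3) nz g unfolding inner_generic_def by blast
  ultimately show "z \<in> slicing_chamber (region_of b) j"
    unfolding mem_slicing_chamber_iff[OF sep] using same_order_trans[OF so zg] cj by simp
qed

lemma maximal_slicing_chambers_eq: "maximal_slicing_chambers = {cell g |g :: (real^'n) \<times> real. inner_generic g}"
proof (intro set_eqI iffI)
  fix C :: "((real^'n) \<times> real) set" assume "C \<in> maximal_slicing_chambers"
  then obtain b j where C: "C = slicing_chamber (region_of b) j" "separating b" "C \<noteq> {}"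
    unfolding maximal_slicing_chambers_def sweep_regions_eq by blast
  then obtain g where g: "g \<in> slicing_chamber (region_of b) j" by blast
  then have "inner_generic g" by (simp add: mem_slicing_chamber_iff[OF C(2)])
  then show "C \<in> {cell g |g. inner_generic g}" using slicing_chamber_eq_cell[OF _ C(2) g] C(1) by blast
next
  fix C :: "((real^'n) \<times> real) set" assume "C \<in> {cell g |g. inner_generic g}"
  then obtain g where g: "inner_generic g" "C = cell g" by blast
  then have sep: "separating (fst g)" and n: "norm (fst g) = 1" by (auto simp: inner_generic_def generic_def)
  define j where "j = card (lower_positive (fst g) (snd g / 2))"
  have mem: "g \<in> slicing_chamber (region_of (fst g)) j"
    by (simp add: mem_slicing_chamber_iff[OF sep] g same_order_refl j_def)
  have "C = slicing_chamber (region_of (fst g)) j"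
    using slicing_chamber_eq_cell[OF g(1) sep mem] g(2) by simp
  moreover have "region_of (fst g) \<in> sweep_regions" unfolding sweep_regions_eq using sep n by blast
  moreover have "C \<noteq> {}" using inner_generic_in_cell[OF g(1)] g(2) by blast
  ultimately show "C \<in> maximal_slicing_chambers" unfolding maximal_slicing_chambers_def by blast
qed

definition outer_generic :: "(real^'n) \<times> real \<Rightarrow> bool" where
  "outer_generic g \<longleftrightarrow> generic g \<and> norm (fst g) = 1 \<and> 0 < snd g \<and> (\<forall>S. fst g \<bullet> vertex S < snd g / 2)"

lemma outer_piece_eq_cell:
  assumes g: "outer_generic g"
  shows "{(a, t). a \<in> region_of (fst g) \<and> last (levels a) < t/2} = cell g"
proof (intro set_eqI)
  have sep: "separating (fst g)" using g by (simp add: outer_generic_def generic_def)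
  fix z :: "(real^'a) \<times> real"
  have "z \<in> {(a, t). a \<in> region_of (fst g) \<and> last (levels a) < t/2} \<longleftrightarrow>
      norm (fst z) = 1 \<and> same_order (fst g) (fst z) \<and> 0 < snd z / 2 \<and> (\<forall>S. fst z \<bullet> vertex S < snd z / 2)"
    by (cases z) (simp only: mem_Collect_eq case_prod_conv last_levels_less_iff region_of_def fst_conv snd_conv conj_assoc)
  also have "\<dots> \<longleftrightarrow> z \<in> cell g"
    using g unfolding cell_def cone_cell_def mem_Collect_eq outer_generic_def zero_less_divide_iff by auto
  finally show "z \<in> {(a, t). a \<in> region_of (fst g) \<and> last (levels a) < t/2} \<longleftrightarrow> z \<in> cell g" .
qed

lemma outer_pieces_eq: "outer_pieces = {cell g |g :: (real^'n) \<times> real. outer_generic g}"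
proof (intro set_eqI iffI)
  fix C :: "((real^'n) \<times> real) set" assume "C \<in> outer_pieces"
  then obtain b where C: "C = {(a, t). a \<in> region_of b \<and> last (levels a) < t/2}" "separating b" "norm b = 1"
    unfolding outer_pieces_def sweep_regions_eq by blast
  \<comment> \<open>A level above all vertex values; it gives a point of the outer piece over
    \<open>b\<close>.\<close>
  define s where "s = 1 + (\<Sum>S\<in>UNIV. \<bar>b \<bullet> vertex S\<bar>)"
  have "b \<bullet> vertex S < s" for S
    using member_le_sum[of S UNIV "\<lambda>S. \<bar>b \<bullet> vertex S\<bar>"] by (simp add: s_def)
  moreover have "0 < s" unfolding s_def by (intro add_pos_nonneg sum_nonneg) simp_all
  ultimately have "outer_generic (b, 2 * s)"
    using C by (auto simp: outer_generic_def generic_def less_imp_neq)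
  from outer_piece_eq_cell[OF this] this show "C \<in> {cell g |g. outer_generic g}"
    unfolding C(1) fst_conv by blast
next
  fix C :: "((real^'n) \<times> real) set" assume "C \<in> {cell g |g. outer_generic g}"
  then obtain g where g: "outer_generic g" "C = cell g" by blast
  then have "region_of (fst g) \<in> sweep_regions"
    unfolding sweep_regions_eq by (auto simp: outer_generic_def generic_def)
  then show "C \<in> outer_pieces" unfolding outer_pieces_def g(2) outer_piece_eq_cell[OF g(1), symmetric] by blast
qed

section \<open>Reflection in \<open>t\<close>, finiteness and density of the pieces\<close>

definition flip :: "(real^'n) \<times> real \<Rightarrow> (real^'n) \<times> real" where
  "flip = (\<lambda>(a, t). (a, - t))"

lemma flip_simps [simp]: "fst (flip z) = fst z" "snd (flip z) = - snd z" "flip (flip z) = z"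
  by (auto simp: flip_def split: prod.splits)

lemma generic_flip:
  assumes "generic g" shows "generic (flip g)"
proof -
  have "fst g \<bullet> vertex S \<noteq> - (snd g / 2)" for S
  proof -
    have "fst g \<bullet> vertex (- S) \<noteq> snd g / 2" using assms unfolding generic_def by blast
    then show ?thesis by (simp add: vertex_Compl)
  qed
  then show ?thesis using assms by (simp add: generic_def)
qed

text \<open>A vertex lies below the level \<open>- t/2\<close> exactly if its antipode lies above
  \<open>t/2\<close>, so the reflection only permutes the defining inequalities.\<close>

lemma flip_in_cell:
  assumes "generic g" "z \<in> cell g" shows "flip z \<in> cell (flip g)"
proof -
  have zc: "z \<in> cone_cell g" and n: "norm (fst z) = 1" using assms(2) by (auto simp: cell_def)
  note z = cone_cell_generic[OF assms(1) zc]
  have key: "fst z \<bullet> vertex S < - (snd z / 2) \<longleftrightarrow> fst g \<bullet> vertex S < - (snd g / 2)" for S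
  proof -
    have "fst z \<bullet> vertex (- S) \<noteq> snd z / 2" "fst g \<bullet> vertex (- S) \<noteq> snd g / 2"
      using z(1) assms(1) unfolding generic_def by blast+
    then show ?thesis using z(2)[of "- S"] unfolding vertex_Compl inner_minus_right by linarith
  qed
  have ne: "fst z \<bullet> vertex S \<noteq> - (snd z / 2)" for S
    using generic_flip[OF z(1)] by (simp add: generic_def)
  have gt: "- (snd z / 2) < fst z \<bullet> vertex S" if "\<not> fst g \<bullet> vertex S < - (snd g / 2)" for S
    using key[of S] ne[of S] that by linarith
  have "same_order (fst g) (fst z)" using zc by (simp add: cone_cell_def)
  moreover have "snd z \<noteq> 0" "snd g \<noteq> 0" using z(1) assms(1) by (auto simp: generic_def)
  ultimately show ?thesis
    unfolding cell_def cone_cell_def mem_Collect_eq flip_simps minus_divide_left[symmetric]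
    using key gt z(3) n by auto
qed

lemma flip_cell:
  assumes "generic g" shows "(\<lambda>(a, t). (a, - t)) ` cell g = cell (flip g)"
  unfolding flip_def[symmetric]
proof
  show "flip ` cell g \<subseteq> cell (flip g)" using flip_in_cell[OF assms] by blast
  show "cell (flip g) \<subseteq> flip ` cell g"
    using flip_in_cell[OF generic_flip[OF assms]] by (metis flip_simps(3) image_eqI subsetI)
qed

text \<open>Outer pieces and reflections supply the cells above all levels and those with negative
  \<open>t\<close>, so that every generic point of the cylinder is covered.\<close>

lemma slicing_pieces_eq: "slicing_pieces = {cell g |g :: (real^'n) \<times> real. generic g \<and> norm (fst g) = 1}"
proof -
  let ?P = "{cell g |g :: (real^'n) \<times> real. generic g \<and> norm (fst g) = 1 \<and> 0 < snd g}"
  have io: "generic g \<and> norm (fst g) = 1 \<and> 0 < snd g \<longleftrightarrow> inner_generic g \<or> outer_generic g"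
    for g :: "(real^'n) \<times> real"
    unfolding inner_generic_def outer_generic_def generic_def by (metis linorder_less_linear)
  have P: "maximal_slicing_chambers \<union> outer_pieces = ?P"
    unfolding maximal_slicing_chambers_eq outer_pieces_eq io by blast
  have "(\<lambda>P. (\<lambda>(a, t). (a, - t)) ` P) ` ?P = {cell g |g :: (real^'n) \<times> real. generic g \<and> norm (fst g) = 1 \<and> snd g < 0}"
  proof (intro set_eqI iffI)
    fix C :: "((real^'n) \<times> real) set" assume "C \<in> (\<lambda>P. (\<lambda>(a, t). (a, - t)) ` P) ` ?P"
    then obtain g where g: "generic g" "norm (fst g) = 1" "0 < snd g" and "C = (\<lambda>(a, t). (a, - t)) ` cell g"
      by blast
    then have "C = cell (flip g)" using flip_cell by blast
    then show "C \<in> {cell g |g. generic g \<and> norm (fst g) = 1 \<and> snd g < 0}"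
      using generic_flip[OF g(1)] g by (intro CollectI exI[of _ "flip g"]) simp
  next
    fix C :: "((real^'n) \<times> real) set" assume "C \<in> {cell g |g. generic g \<and> norm (fst g) = 1 \<and> snd g < 0}"
    then obtain g where g: "generic g" "norm (fst g) = 1" "snd g < 0" "C = cell g" by blast
    have "C = (\<lambda>(a, t). (a, - t)) ` cell (flip g)" using flip_cell[OF generic_flip[OF g(1)]] g(4) by simp
    moreover have "cell (flip g) \<in> ?P"
      using generic_flip[OF g(1)] g(2,3) by (intro CollectI exI[of _ "flip g"]) simp
    ultimately show "C \<in> (\<lambda>P. (\<lambda>(a, t). (a, - t)) ` P) ` ?P" by (rule image_eqI)
  qed
  note N = this
  have e: "generic g \<and> norm (fst g) = 1 \<longleftrightarrow>
      generic g \<and> norm (fst g) = 1 \<and> 0 < snd g \<or> generic g \<and> norm (fst g) = 1 \<and> snd g < 0"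
    for g :: "(real^'n) \<times> real"
    unfolding generic_def by (metis linorder_less_linear)
  have "slicing_pieces = ?P \<union> {cell g |g :: (real^'n) \<times> real. generic g \<and> norm (fst g) = 1 \<and> snd g < 0}"
    unfolding slicing_pieces_def Let_def P N ..
  also have "\<dots> = {cell g |g :: (real^'n) \<times> real. (generic g \<and> norm (fst g) = 1 \<and> 0 < snd g) \<or>
      (generic g \<and> norm (fst g) = 1 \<and> snd g < 0)}" by blast
  finally show ?thesis by (simp only: e[symmetric])
qed

text \<open>A cell depends on \<open>g\<close> only through \<open>code g\<close>, which takes
  values in a finite type.\<close>

lemma finite_slicing_pieces: "finite (slicing_pieces :: ((real^'n) \<times> real) set set)"
proof -
  define code where "code g = ({(S, T). fst g \<bullet> vertex S < fst g \<bullet> vertex T}, {S. fst g \<bullet> vertex S < snd g / 2}, 0 < snd g)"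
    for g :: "(real^'n) \<times> real"
  have "cell g = cell h" if "code g = code h" for g h
  proof -
    have "fst g \<bullet> vertex S < fst g \<bullet> vertex T \<longleftrightarrow> fst h \<bullet> vertex S < fst h \<bullet> vertex T"
      "fst g \<bullet> vertex S < snd g / 2 \<longleftrightarrow> fst h \<bullet> vertex S < snd h / 2" "0 < snd g \<longleftrightarrow> 0 < snd h" for S T
      using that unfolding code_def by (auto simp: set_eq_iff)
    then show ?thesis unfolding cell_def cone_cell_def same_order_def by simp
  qed
  then have "cell g = cell (inv code (code g))" for g by (metis f_inv_into_f rangeI)
  then have "slicing_pieces \<subseteq> (\<lambda>c. cell (inv code c)) ` UNIV"
    unfolding slicing_pieces_eq by (auto simp: image_iff)
  then show ?thesis by (rule finite_subset) simp
qed

lemma pairwise_disjnt_slicing_pieces: "pairwise disjnt (slicing_pieces :: ((real^'n) \<times> real) set set)"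
  unfolding pairwise_def slicing_pieces_eq disjnt_iff using cell_eq by blast

lemma Union_slicing_pieces: "\<Union>slicing_pieces = {z :: (real^'n) \<times> real. generic z \<and> norm (fst z) = 1}"
proof (intro set_eqI iffI)
  fix z :: "(real^'n) \<times> real" assume "z \<in> \<Union>slicing_pieces"
  then obtain g where "generic g" "z \<in> cell g" unfolding slicing_pieces_eq by blast
  then show "z \<in> {z. generic z \<and> norm (fst z) = 1}" using cone_cell_generic(1)[of g z] by (simp add: cell_def)
next
  fix z :: "(real^'n) \<times> real" assume "z \<in> {z. generic z \<and> norm (fst z) = 1}"
  then show "z \<in> \<Union>slicing_pieces" unfolding slicing_pieces_eq using generic_in_cell[of z] by blast
qed

lemma generic_scaleR:
  assumes "generic z" "r > 0" shows "generic (r *\<^sub>R z)"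
  using cone_cell_generic(1)[OF assms(1) cone_cell_scaleR[OF generic_in_cone_cell[OF assms(1)] assms(2)]] .

text \<open>The points that are not generic lie on finitely many hyperplanes, a negligible set
  without interior.\<close>

lemma closure_generic: "closure {z :: (real^'n) \<times> real. generic z} = UNIV"
proof -
  have negl: "negligible {z :: (real^'n) \<times> real. c \<bullet> z = 0}" if "c \<noteq> 0" for c
    using negligible_hyperplane[of c 0] that by simp
  have "- {z :: (real^'n) \<times> real. generic z} \<subseteq>
     (\<Union>(S,T)\<in>{(S,T). S \<noteq> T}. {z. (vertex S - vertex T, 0) \<bullet> z = 0})
     \<union> (\<Union>S. {z. (vertex S, - 1 / 2) \<bullet> z = 0}) \<union> {z. (0, 1) \<bullet> z = 0}"
    by (auto simp: generic_def separating_def inner_prod_def inner_diff_right inner_commute del: equalityI)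
  moreover have "negligible \<dots>"
  proof -
    have "negligible (\<Union>(S,T)\<in>{(S :: 'n set, T). S \<noteq> T}. {z :: (real^'n) \<times> real. (vertex S - vertex T, 0) \<bullet> z = 0})"
    proof (rule negligible_Union)
      fix X assume "X \<in> (\<lambda>(S, T). {z :: (real^'n) \<times> real. (vertex S - vertex T, 0) \<bullet> z = 0}) ` {(S :: 'n set, T). S \<noteq> T}"
      then obtain S T :: "'n set" where "S \<noteq> T" and X: "X = {z :: (real^'n) \<times> real. (vertex S - vertex T, 0) \<bullet> z = 0}" by auto
      then have "vertex S - vertex T \<noteq> (0 :: real^'n)" using inj_vertex by (auto dest: injD)
      then show "negligible X" unfolding X by (intro negl) (simp add: prod_eq_iff)
    qed simp
    moreover have "negligible (\<Union>S :: 'n set. {z :: (real^'n) \<times> real. (vertex S, - 1 / 2) \<bullet> z = 0})"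
    proof (rule negligible_Union)
      fix X assume "X \<in> range (\<lambda>S :: 'n set. {z :: (real^'n) \<times> real. (vertex S, - 1 / 2) \<bullet> z = 0})"
      then obtain S :: "'n set" where X: "X = {z :: (real^'n) \<times> real. (vertex S, - 1 / 2) \<bullet> z = 0}" by auto
      show "negligible X" unfolding X by (intro negl) (simp add: prod_eq_iff)
    qed simp
    moreover have "negligible {z :: (real^'n) \<times> real. (0, 1) \<bullet> z = 0}"
      by (rule negl) (simp add: prod_eq_iff)
    ultimately show ?thesis by (intro negligible_Un)
  qed
  ultimately have "negligible (- {z :: (real^'n) \<times> real. generic z})" by (rule negligible_subset[rotated])
  then have "interior (- {z :: (real^'n) \<times> real. generic z}) = {}"
    using open_not_negligible interior_subset negligible_subset open_interior by metis
  then show ?thesis by (simp add: closure_interior)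
qed

text \<open>Generic approximations of a point need not have a unit first component; rescaling
  corrects this, keeps them generic and does not change the limit.\<close>

lemma sphere_subset_closure_slicing_pieces:
  "sphere 0 1 \<times> UNIV \<subseteq> closure (\<Union>slicing_pieces :: ((real^'n) \<times> real) set)"
proof
  fix z :: "(real^'n) \<times> real" assume z: "z \<in> sphere 0 1 \<times> UNIV"
  have "z \<in> closure {z. generic z}" by (simp add: closure_generic)
  then obtain x where x: "\<And>n. generic (x n)" "x \<longlonglongrightarrow> z" unfolding closure_sequential by blast
  let ?y = "\<lambda>n. inverse (norm (fst (x n))) *\<^sub>R x n"
  have nz: "norm (fst z) = 1" using z by auto
  have "?y \<longlonglongrightarrow> inverse (norm (fst z)) *\<^sub>R z"
    using nz by (intro tendsto_intros x(2)) auto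
  then have "?y \<longlonglongrightarrow> z" using nz by simp
  moreover have "?y n \<in> \<Union>slicing_pieces" for n
  proof -
    have "norm (fst (x n)) > 0" using x(1)[of n] separating_nonzero by (auto simp: generic_def)
    then show ?thesis unfolding Union_slicing_pieces using generic_scaleR[OF x(1)[of n]] by simp
  qed
  ultimately show "z \<in> closure (\<Union>slicing_pieces)" unfolding closure_sequential by (intro exI[of _ ?y]) blast
qed

section \<open>Rational expressions on the chambers\<close>

text \<open>The moment formula multiplied by the product of all \<open>(a $ j) ^ Suc M\<close>, with
  \<open>W\<close> as the set of vertices whose truncated powers are not zero. The factor
  \<open>(a $ i) ^ (M - k)\<close> is what remains of \<open>(a $ i) ^ M\<close> after clearing
  \<open>1 / (a $ i) ^ k\<close>.\<close>

definition numerator :: "nat \<Rightarrow> nat \<Rightarrow> 'n set set \<Rightarrow> real^'n \<Rightarrow> real \<Rightarrow> real" where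
  "numerator M n W a y = (\<Sum>i\<in>UNIV. (\<Sum>S\<in>W. (\<Prod>j\<in>UNIV. - 2 * corner S j) *
     (\<Sum>k\<le>M. fact M / fact (M - k) * corner S i ^ (M - k) * ((y - a \<bullet> vertex S) ^ (n + k) / fact (n + k)) * (a $ i) ^ (M - k)))
       * (\<Prod>j\<in>UNIV - {i}. (a $ j) ^ M))"

lemma moment_formula_eq_numerator:
  fixes a :: "real^'n"
  assumes W: "\<And>S. S \<in> W \<longleftrightarrow> a \<bullet> vertex S < y" and ne: "\<And>S. a \<bullet> vertex S \<noteq> y" and nz: "\<And>j. a $ j \<noteq> 0"
  shows "moment_formula M n a y = numerator M n W a y / (\<Prod>j\<in>UNIV. (a $ j) ^ Suc M)"
proof -
  show ?thesis
    unfolding moment_formula_def numerator_def inner_vertex[symmetric]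
  proof (subst sum_divide_distrib, rule sum.cong[OF refl])
    fix i :: 'n
    let ?\<sigma> = "\<lambda>S. \<Prod>j\<in>(UNIV :: 'n set). - 2 * corner S j"
    let ?s = "\<lambda>S. \<Sum>k\<le>M. fact M / fact (M - k) * corner S i ^ (M - k) *
        ((y - a \<bullet> vertex S) ^ (n + k) / fact (n + k)) * (a $ i) ^ (M - k)"
    let ?P = "\<Prod>j\<in>UNIV - {i}. (a $ j) ^ M"
    have ibp: "ibp_term M n (a $ i) (corner S i) (y - a \<bullet> vertex S) = (if S \<in> W then ?s S / (a $ i) ^ M else 0)" for S
    proof (cases "S \<in> W")
      case True
      then have "\<not> y - a \<bullet> vertex S < 0" using W[of S] by simp
      then have "ibp_term M n (a $ i) (corner S i) (y - a \<bullet> vertex S) = ?s S / (a $ i) ^ M"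
        unfolding ibp_term_def sum_divide_distrib trunc_pow_def
        using nz[of i] by (intro sum.cong) (auto simp: power_diff)
      then show ?thesis using True by simp
    next
      case False
      then have "y - a \<bullet> vertex S < 0" using W[of S] ne[of S] by (simp add: not_less less_le)
      then show ?thesis using False by (simp add: ibp_term_def trunc_pow_def)
    qed
    have "(\<Sum>S\<in>UNIV. ?\<sigma> S * ibp_term M n (a $ i) (corner S i) (y - a \<bullet> vertex S)) =
       (\<Sum>S\<in>UNIV. if S \<in> W then ?\<sigma> S * ?s S / (a $ i) ^ M else 0)"
      unfolding ibp by (intro sum.cong) auto
    also have "\<dots> = (\<Sum>S\<in>W. ?\<sigma> S * ?s S) / (a $ i) ^ M"
      unfolding sum_divide_distrib by (simp add: sum.If_cases)
    finally have L: "(\<Sum>S\<in>UNIV. ?\<sigma> S * ibp_term M n (a $ i) (corner S i) (y - a \<bullet> vertex S))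
      = (\<Sum>S\<in>W. ?\<sigma> S * ?s S) / (a $ i) ^ M" .
    have "(\<Prod>j\<in>UNIV. (a $ j) ^ Suc M) = (\<Prod>j\<in>UNIV. a $ j) * ((a $ i) ^ M * ?P)"
      unfolding power_Suc prod.distrib by (subst prod.remove[of UNIV i "\<lambda>j. (a $ j) ^ M"]) auto
    moreover have "?P \<noteq> 0" using nz by simp
    ultimately show "(\<Sum>S\<in>UNIV. ?\<sigma> S * ibp_term M n (a $ i) (corner S i) (y - a \<bullet> vertex S)) / (\<Prod>j\<in>UNIV. a $ j)
       = (\<Sum>S\<in>W. ?\<sigma> S * ?s S) * ?P / (\<Prod>j\<in>UNIV. (a $ j) ^ Suc M)"
      unfolding L using nz by (simp add: field_simps)
  qed
qed

lemma polyfun_inner_vertex [intro]: "polyfun (\<lambda>z. fst z \<bullet> vertex S)"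
  unfolding inner_vertex by (intro polyfun_sum polyfun_mult polyfun_nth polyfun_const)

lemma polyfun_numerator: "polyfun (\<lambda>z. numerator M n W (fst z) (c * snd z))"
  unfolding numerator_def
  by (intro polyfun_sum polyfun_mult polyfun_prod polyfun_power polyfun_divide_const polyfun_diff
      polyfun_const polyfun_nth polyfun_snd polyfun_inner_vertex)

lemma polyfun_denominator: "polyfun (\<lambda>z. \<Prod>j\<in>UNIV. (fst z $ j) ^ M)"
  by (intro polyfun_prod polyfun_power polyfun_nth)

definition below :: "(real^'n) \<times> real \<Rightarrow> 'n set set" where
  "below g = {S. fst g \<bullet> vertex S < snd g / 2}"

lemma below_cone_cell: "generic g \<Longrightarrow> z \<in> cone_cell g \<Longrightarrow> below z = below g"
  unfolding below_def using cone_cell_generic(2) by blast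

lemma generic_nth: "generic g \<Longrightarrow> fst g $ i \<noteq> 0"
  by (simp add: generic_def separating_nth_nonzero)

lemma slice_moment_generic:
  assumes "generic (a, t)"
  shows "slice_moment M (a :: real^'n) t = norm a * moment_formula M (CARD('n) - 1) a (t / 2)"
  using generic_nth[OF assms] assms
  by (intro slice_moment_formula) (auto simp: generic_def inner_vertex[symmetric])

lemma slice_moment_numerator:
  assumes "generic (a, t)"
  shows "slice_moment M (a :: real^'n) t =
    norm a * (numerator M (CARD('n) - 1) (below (a, t)) a (t / 2) / (\<Prod>j\<in>UNIV. (a $ j) ^ Suc M))"
  unfolding slice_moment_generic[OF assms]
  using generic_nth[OF assms] assms
  by (subst moment_formula_eq_numerator[where W = "below (a, t)"]) (auto simp: generic_def below_def)

lemma slab_moment_numerator: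
  assumes "generic (a, t)" "t > 0"
  shows "slab_moment M (a :: real^'n) t =
    (numerator M CARD('n) (below (a, t)) a (t / 2) - numerator M CARD('n) {S. - S \<notin> below (a, t)} a (- t / 2))
      / (\<Prod>j\<in>UNIV. (a $ j) ^ Suc M)"
proof -
  have nz: "a $ i \<noteq> 0" for i using generic_nth[OF assms(1)] by simp
  have ne: "a \<bullet> vertex S \<noteq> t / 2" for S using assms(1) by (simp add: generic_def)
  have ne': "a \<bullet> vertex S \<noteq> - t / 2" for S using ne[of "- S"] by (auto simp: vertex_Compl)
  \<comment> \<open>By antipodal symmetry the vertices below \<open>- t / 2\<close> are determined
    by those below \<open>t / 2\<close>, so both numerators are fixed on a cell.\<close>
  have "- S \<notin> below (a, t) \<longleftrightarrow> a \<bullet> vertex S < - t / 2" for S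
    using ne'[of S] by (simp add: below_def vertex_Compl) linarith
  then have "moment_formula M CARD('n) a (- t / 2) =
      numerator M CARD('n) {S. - S \<notin> below (a, t)} a (- t / 2) / (\<Prod>j\<in>UNIV. (a $ j) ^ Suc M)"
    using nz ne' by (intro moment_formula_eq_numerator) auto
  moreover have "moment_formula M CARD('n) a (t / 2) =
      numerator M CARD('n) (below (a, t)) a (t / 2) / (\<Prod>j\<in>UNIV. (a $ j) ^ Suc M)"
    using nz ne by (intro moment_formula_eq_numerator) (auto simp: below_def)
  ultimately show ?thesis
    using assms(2) by (simp only: slab_moment_formula[OF nz] less_imp_le diff_divide_distrib)
qed

lemma fraction_on_polyfun:
  assumes "polyfun f" "polyfun h" "\<And>z. z \<in> P \<Longrightarrow> h z \<noteq> 0" "\<And>z. z \<in> P \<Longrightarrow> F (fst z) (snd z) = f z / h z"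
  shows "\<exists>p q. fraction_on P F p q"
proof -
  obtain p q where "\<And>z. f z = poly_at p z" "\<And>z. h z = poly_at q z"
    using assms(1,2) unfolding polyfun_def by blast
  then have "fraction_on P F p q"
    unfolding fraction_on_def using assms(3,4) by (auto split: prod.splits)
  then show ?thesis by blast
qed

text \<open>The factor \<open>\<kappa>\<close> lets one statement serve moments
  (\<open>\<kappa> = 1\<close>) and volumes (\<open>M = 0\<close>,
  \<open>\<kappa> = 1 / CARD('n)\<close>).\<close>

lemma slice_fraction:
  fixes g :: "(real^'n) \<times> real"
  assumes "generic g"
  shows "\<exists>p q. fraction_on (cone_cell g) (\<lambda>a t. \<kappa> * slice_moment M a t / norm a) p q"
proof (rule fraction_on_polyfun)
  show "polyfun (\<lambda>z. \<kappa> * numerator M (CARD('n) - 1) (below g) (fst z) (1 / 2 * snd z))"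
    by (intro polyfun_mult polyfun_const polyfun_numerator)
  show "polyfun (\<lambda>z :: (real^'n) \<times> real. \<Prod>j\<in>UNIV. (fst z $ j) ^ Suc M)" by (rule polyfun_denominator)
  fix z assume z: "z \<in> cone_cell g"
  then have gen: "generic (fst z, snd z)" using cone_cell_generic(1)[OF assms] by simp
  show "(\<Prod>j\<in>UNIV. (fst z $ j) ^ Suc M) \<noteq> 0" using generic_nth[OF gen] by simp
  have "norm (fst z) \<noteq> 0" using gen separating_nonzero by (auto simp: generic_def)
  then show "\<kappa> * slice_moment M (fst z) (snd z) / norm (fst z) =
      \<kappa> * numerator M (CARD('n) - 1) (below g) (fst z) (1 / 2 * snd z) / (\<Prod>j\<in>UNIV. (fst z $ j) ^ Suc M)"
    unfolding slice_moment_numerator[OF gen] prod.collapse below_cone_cell[OF assms z] by simp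
qed

lemma slab_fraction:
  fixes g :: "(real^'n) \<times> real"
  assumes "generic g"
  shows "\<exists>p q. fraction_on (cone_cell g) (\<lambda>a t. \<kappa> * slab_moment M a t) p q"
proof (cases "0 < snd g")
  case True
  show ?thesis
  proof (rule fraction_on_polyfun)
    show "polyfun (\<lambda>z. \<kappa> * (numerator M CARD('n) (below g) (fst z) (1 / 2 * snd z)
        - numerator M CARD('n) {S. - S \<notin> below g} (fst z) (- 1 / 2 * snd z)))"
      by (intro polyfun_mult polyfun_diff polyfun_const polyfun_numerator)
    show "polyfun (\<lambda>z :: (real^'n) \<times> real. \<Prod>j\<in>UNIV. (fst z $ j) ^ Suc M)" by (rule polyfun_denominator)
    fix z assume z: "z \<in> cone_cell g"
    then have gen: "generic (fst z, snd z)" using cone_cell_generic(1)[OF assms] by simp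
    have pos: "0 < snd z" using cone_cell_generic(3)[OF assms z] True by simp
    show "(\<Prod>j\<in>UNIV. (fst z $ j) ^ Suc M) \<noteq> 0" using generic_nth[OF gen] by simp
    show "\<kappa> * slab_moment M (fst z) (snd z) =
      \<kappa> * (numerator M CARD('n) (below g) (fst z) (1 / 2 * snd z)
        - numerator M CARD('n) {S. - S \<notin> below g} (fst z) (- 1 / 2 * snd z)) / (\<Prod>j\<in>UNIV. (fst z $ j) ^ Suc M)"
      unfolding slab_moment_numerator[OF gen pos] prod.collapse below_cone_cell[OF assms z] by simp
  qed
next
  case False
  show ?thesis
  proof (rule fraction_on_polyfun[of "\<lambda>_. 0" "\<lambda>_. 1"])
    fix z assume "z \<in> cone_cell g"
    then have "snd z < 0" using False by (simp add: cone_cell_def)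
    then show "\<kappa> * slab_moment M (fst z) (snd z) = 0 / 1" by (simp add: slab_moment_negative)
  qed auto
qed

lemma piecewise_rational_slicing_pieces:
  assumes "\<And>g :: (real^'n) \<times> real. generic g \<Longrightarrow> \<exists>p q. fraction_on (cell g) F p q"
  shows "piecewise_rational (sphere 0 1 \<times> UNIV) slicing_pieces F"
  unfolding piecewise_rational_def
proof (intro conjI ballI)
  show "\<Union>slicing_pieces \<subseteq> (sphere 0 1 \<times> UNIV :: ((real^'n) \<times> real) set)"
    unfolding Union_slicing_pieces by auto
  fix P :: "((real^'n) \<times> real) set" assume "P \<in> slicing_pieces"
  then show "\<exists>p q. fraction_on P F p q" using assms unfolding slicing_pieces_eq by blast
qed (rule finite_slicing_pieces pairwise_disjnt_slicing_pieces sphere_subset_closure_slicing_pieces)+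

lemma piecewise_rational_slice:
  "piecewise_rational (sphere (0 :: real^'n) 1 \<times> UNIV) slicing_pieces (\<lambda>a t. \<kappa> * slice_moment M a t)"
proof (rule piecewise_rational_slicing_pieces)
  fix g :: "(real^'n) \<times> real" assume "generic g"
  from slice_fraction[OF this, of \<kappa> M] obtain p q where
    "fraction_on (cone_cell g) (\<lambda>a t. \<kappa> * slice_moment M a t / norm a) p q" by blast
  \<comment> \<open>On the cell the division by \<open>norm a\<close> disappears, since
    \<open>norm a = 1\<close> there.\<close>
  then have "fraction_on (cell g) (\<lambda>a t. \<kappa> * slice_moment M a t) p q"
    unfolding fraction_on_def cell_def by fastforce
  then show "\<exists>p q. fraction_on (cell g) (\<lambda>a t. \<kappa> * slice_moment M a t) p q" by blast
qed

lemma piecewise_rational_slab: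
  "piecewise_rational (sphere (0 :: real^'n) 1 \<times> UNIV) slicing_pieces (\<lambda>a t. \<kappa> * slab_moment M a t)"
proof (rule piecewise_rational_slicing_pieces)
  fix g :: "(real^'n) \<times> real" assume "generic g"
  from slab_fraction[OF this, of \<kappa> M] obtain p q where
    "fraction_on (cone_cell g) (\<lambda>a t. \<kappa> * slab_moment M a t) p q" by blast
  then have "fraction_on (cell g) (\<lambda>a t. \<kappa> * slab_moment M a t) p q"
    unfolding fraction_on_def cell_def by blast
  then show "\<exists>p q. fraction_on (cell g) (\<lambda>a t. \<kappa> * slab_moment M a t) p q" by blast
qed

section \<open>Homogeneity and non-vanishing\<close>

text \<open>The \<open>k\<close>-th summand scales by \<open>r ^ (n + k) / r ^ k\<close>, whatever
  \<open>k\<close> is: this is the reason why \<open>M\<close> has no influence on the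
  degree.\<close>

lemma ibp_term_scale:
  assumes "r > 0"
  shows "ibp_term M n (r * \<alpha>) v (r * y) = r ^ n * ibp_term M n \<alpha> v y"
proof -
  have t: "trunc_pow k (r * y) = r ^ k * trunc_pow k y" for k
    using assms by (simp add: trunc_pow_def mult_less_0_iff power_mult_distrib)
  show ?thesis unfolding ibp_term_def sum_distrib_left
    using assms by (intro sum.cong) (auto simp: t power_add power_mult_distrib)
qed

lemma moment_formula_scale:
  fixes a :: "real^'n"
  assumes "r > 0"
  shows "r ^ CARD('n) * moment_formula M n (r *\<^sub>R a) (r * s) = r ^ n * moment_formula M n a s"
proof -
  have s: "r * s - (\<Sum>j\<in>UNIV. (r *\<^sub>R a) $ j * corner S j) = r * (s - (\<Sum>j\<in>UNIV. a $ j * corner S j))" for S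
    by (simp add: right_diff_distrib sum_distrib_left mult_ac)
  have p: "(\<Prod>j\<in>UNIV. (r *\<^sub>R a) $ j) = r ^ CARD('n) * (\<Prod>j\<in>UNIV. a $ j)"
    by (simp add: prod.distrib)
  let ?\<sigma> = "\<lambda>S. \<Prod>j\<in>(UNIV :: 'n set). - 2 * corner S j"
  let ?P = "\<Prod>j\<in>UNIV. a $ j"
  let ?t = "\<lambda>i. \<Sum>S\<in>UNIV. ?\<sigma> S * ibp_term M n (a $ i) (corner S i) (s - (\<Sum>j\<in>UNIV. a $ j * corner S j))"
  have t: "(\<Sum>S\<in>UNIV. ?\<sigma> S * ibp_term M n ((r *\<^sub>R a) $ i) (corner S i)
      (r * s - (\<Sum>j\<in>UNIV. (r *\<^sub>R a) $ j * corner S j))) = r ^ n * ?t i" for i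
    unfolding s unfolding vector_scaleR_component real_scaleR_def ibp_term_scale[OF assms] sum_distrib_left
    by (intro sum.cong refl) (rule mult.left_commute)
  have "moment_formula M n (r *\<^sub>R a) (r * s) = (\<Sum>i\<in>UNIV. r ^ n * ?t i / (r ^ CARD('n) * ?P))"
    unfolding moment_formula_def t p ..
  then have "r ^ CARD('n) * moment_formula M n (r *\<^sub>R a) (r * s) =
      (\<Sum>i\<in>UNIV. r ^ CARD('n) * (r ^ n * ?t i / (r ^ CARD('n) * ?P)))"
    by (simp only: sum_distrib_left)
  also have "\<dots> = (\<Sum>i\<in>UNIV. r ^ n * (?t i / ?P))"
  proof (intro sum.cong refl)
    have "r ^ CARD('n) \<noteq> 0" using assms by simp
    then show "r ^ CARD('n) * (r ^ n * ?t i / (r ^ CARD('n) * ?P)) = r ^ n * (?t i / ?P)" for i by simp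
  qed
  also have "\<dots> = r ^ n * moment_formula M n a s"
    unfolding moment_formula_def by (rule sum_distrib_left[symmetric])
  finally show ?thesis .
qed

text \<open>Differentiating once in each variable \<open>a\<^sub>j\<close> extracts the mixed coefficient.\<close>
lemma mixed_coefficient_zero:
  fixes w :: "'s \<Rightarrow> real" and x :: "'s \<Rightarrow> 'i \<Rightarrow> real"
  assumes "finite J" "finite W" "card J \<le> m"
    and "\<And>a y. (\<Sum>S\<in>W. w S * (y - (\<Sum>j\<in>J. a j * x S j)) ^ m) = 0"
  shows "(\<Sum>S\<in>W. w S * (\<Prod>j\<in>J. x S j)) = 0"
  using assms
proof (induction J arbitrary: w m rule: finite_induct)
  case empty
  \<comment> \<open>Without variables left, \<open>y = 1\<close> turns every power into
    \<open>1\<close>.\<close>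
  then show ?case using empty.prems(3)[of 1] by simp
next
  case (insert i J)
  \<comment> \<open>The exponent is positive because it is at least the number of variables, so one
    more derivative can be taken.\<close>
  obtain m' where m: "m = Suc m'" using insert.prems(2) insert.hyps by (cases m) auto
  have "(\<Sum>S\<in>W. (w S * x S i) * (y - (\<Sum>j\<in>J. a j * x S j)) ^ m') = 0" for a y
  proof -
    have z: "(\<Sum>S\<in>W. w S * (y - (\<Sum>j\<in>J. a j * x S j) - u * x S i) ^ m) = 0" for u
    proof -
      have "(\<Sum>j\<in>J. (a(i := u)) j * x S j) = (\<Sum>j\<in>J. a j * x S j)" for S
        using insert.hyps by (intro sum.cong) auto
      then show ?thesis using insert.prems(3)[of y "a(i := u)"] insert.hyps by (simp add: algebra_simps)
    qed
    have "((\<lambda>u. \<Sum>S\<in>W. w S * (y - (\<Sum>j\<in>J. a j * x S j) - u * x S i) ^ m) has_field_derivative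
       (\<Sum>S\<in>W. w S * (of_nat m * (y - (\<Sum>j\<in>J. a j * x S j)) ^ m' * - x S i))) (at 0)"
    proof (intro DERIV_sum DERIV_cmult)
      fix S
      let ?c = "y - (\<Sum>j\<in>J. a j * x S j)"
      have "((\<lambda>u. ?c - u * x S i) has_field_derivative - x S i) (at 0)"
        by (auto intro!: derivative_eq_intros)
      from DERIV_power[OF this, of m]
      show "((\<lambda>u. (?c - u * x S i) ^ m) has_field_derivative of_nat m * ?c ^ m' * - x S i) (at 0)"
        by (simp add: m mult_ac)
    qed
    then have "((\<lambda>u. 0) has_field_derivative
       (\<Sum>S\<in>W. w S * (of_nat m * (y - (\<Sum>j\<in>J. a j * x S j)) ^ m' * - x S i))) (at 0)"
      unfolding z .
    then have "(\<Sum>S\<in>W. w S * (of_nat m * (y - (\<Sum>j\<in>J. a j * x S j)) ^ m' * - x S i)) = 0"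
      using DERIV_const by (rule DERIV_unique)
    also have "(\<Sum>S\<in>W. w S * (of_nat m * (y - (\<Sum>j\<in>J. a j * x S j)) ^ m' * - x S i))
       = - of_nat m * (\<Sum>S\<in>W. (w S * x S i) * (y - (\<Sum>j\<in>J. a j * x S j)) ^ m')"
      unfolding sum_distrib_left by (intro sum.cong) (simp_all add: mult_ac)
    finally show ?thesis by (simp add: m)
  qed
  then have "(\<Sum>S\<in>W. (w S * x S i) * (\<Prod>j\<in>J. x S j)) = 0"
    using insert.prems insert.hyps m by (intro insert.IH[of m' "\<lambda>S. w S * x S i"]) auto
  then show ?case using insert.hyps by (simp add: mult_ac)
qed

text \<open>For \<open>M > 0\<close> all summands with index other than \<open>i\<close> contain
  \<open>(a $ i) ^ M = 0\<close>, and in summand \<open>i\<close> only \<open>k = M\<close>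
  survives. For \<open>M = 0\<close> the \<open>CARD('n)\<close> summands coincide. In both cases
  one pure power of order \<open>n + M\<close> per vertex remains.\<close>

lemma numerator_on_coordinate_hyperplane:
  fixes a :: "real^'n"
  assumes "a $ i = 0"
  shows "\<exists>\<kappa>. \<kappa> \<noteq> 0 \<and> (\<forall>W y. numerator M n W a y =
    \<kappa> * (\<Sum>S\<in>W. (\<Prod>j\<in>UNIV. - 2 * corner S j) * (y - a \<bullet> vertex S) ^ (n + M)) * (\<Prod>j\<in>UNIV - {i}. (a $ j) ^ M))"
proof (cases "M = 0")
  case True
  show ?thesis
  proof (intro exI[of _ "real CARD('n) / fact n"] conjI allI)
    show "numerator M n W a y = real CARD('n) / fact n *
        (\<Sum>S\<in>W. (\<Prod>j\<in>UNIV. - 2 * corner S j) * (y - a \<bullet> vertex S) ^ (n + M)) * (\<Prod>j\<in>UNIV - {i}. (a $ j) ^ M)" for W y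
      unfolding True numerator_def by (simp add: sum_divide_distrib[symmetric])
  qed simp
next
  case False
  show ?thesis
  proof (intro exI[of _ "fact M / fact (n + M)"] conjI allI)
    fix W y
    let ?\<sigma> = "\<lambda>S. \<Prod>j\<in>(UNIV :: 'n set). - 2 * corner S j"
    let ?t = "\<lambda>i'. (\<Sum>S\<in>W. ?\<sigma> S *
     (\<Sum>k\<le>M. fact M / fact (M - k) * corner S i' ^ (M - k) * ((y - a \<bullet> vertex S) ^ (n + k) / fact (n + k)) * (a $ i') ^ (M - k)))
       * (\<Prod>j\<in>UNIV - {i'}. (a $ j) ^ M)"
    define t where "t = ?t"
    have t0: "t i' = 0" if "i' \<noteq> i" for i'
    proof -
      have "(\<Prod>j\<in>UNIV - {i'}. (a $ j) ^ M) = 0"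
        using that assms False by (intro prod_zero) (auto intro!: bexI[of _ i])
      then show ?thesis unfolding t_def by simp
    qed
    have "numerator M n W a y = (\<Sum>i'\<in>UNIV. t i')" unfolding numerator_def t_def ..
    also have "\<dots> = (\<Sum>i'\<in>{i}. t i')" using t0 by (intro sum.mono_neutral_right) auto
    also have "\<dots> = ?t i" by (simp only: t_def sum.insert sum.empty finite.emptyI empty_iff not_False_eq_True add_0_right)
    finally have *: "numerator M n W a y = ?t i" .
    have **: "(\<Sum>k\<le>M. fact M / fact (M - k) * corner S i ^ (M - k) * ((y - a \<bullet> vertex S) ^ (n + k) / fact (n + k)) * (a $ i) ^ (M - k))
        = fact M / fact (n + M) * (y - a \<bullet> vertex S) ^ (n + M)" for S
    proof -
      have "(\<Sum>k\<le>M. fact M / fact (M - k) * corner S i ^ (M - k) * ((y - a \<bullet> vertex S) ^ (n + k) / fact (n + k)) * (a $ i) ^ (M - k))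
        = (\<Sum>k\<in>{M}. fact M / fact (M - k) * corner S i ^ (M - k) * ((y - a \<bullet> vertex S) ^ (n + k) / fact (n + k)) * (a $ i) ^ (M - k))"
        using assms by (intro sum.mono_neutral_right) (auto simp: power_0_left)
      then show ?thesis by simp
    qed
    show "numerator M n W a y = fact M / fact (n + M) *
        (\<Sum>S\<in>W. ?\<sigma> S * (y - a \<bullet> vertex S) ^ (n + M)) * (\<Prod>j\<in>UNIV - {i}. (a $ j) ^ M)"
      unfolding * ** by (simp add: sum_distrib_left mult_ac)
  qed simp
qed

text \<open>If the numerator vanishes identically, then setting \<open>a\<^sub>i = 0\<close> and taking the mixed coefficient of
  the remaining variables shows that the vertices below the slice have \<open>i\<close>-th coordinates summing to \<open>0\<close>.\<close>
lemma numerator_zero_imp_balanced: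
  fixes W :: "'n::finite set set"
  assumes "\<And>a y. numerator M (CARD('n) - 1) W a y = 0"
  shows "(\<Sum>S\<in>W. corner S i) = 0"
proof -
  let ?\<sigma> = "\<lambda>S. \<Prod>j\<in>(UNIV :: 'n set). - 2 * corner S j"
  let ?J = "UNIV - {i}"
  \<comment> \<open>The exponent \<open>n + M\<close> for \<open>n = CARD('n) - 1\<close>; it is at
    least \<open>card ?J\<close>, as one derivative in each remaining variable requires.\<close>
  define m where "m = CARD('n) - 1 + M"
  define h where "h z = (\<Sum>S\<in>W. ?\<sigma> S * (snd z - (\<Sum>j\<in>?J. fst z $ j * corner S j)) ^ m)" for z :: "(real^'n) \<times> real"
  have pf: "polyfun h"
    unfolding h_def by (intro polyfun_sum polyfun_mult polyfun_power polyfun_diff polyfun_const polyfun_nth polyfun_snd)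
  \<comment> \<open>Positive coordinates allow the factor
    \<open>(\<Prod>j\<in>?J. (a $ j) ^ M)\<close> to be cancelled. The polynomial identity then
    extends from this open set to all \<open>z\<close>.\<close>
  have "h z = 0" if z: "\<And>j. fst z $ j > 0" for z
  proof -
    define a where "a = (\<chi> j. if j = i then 0 else fst z $ j)"
    have "a $ i = 0" by (simp add: a_def)
    from numerator_on_coordinate_hyperplane[OF this, of M "CARD('n) - 1"] obtain \<kappa> where \<kappa>: "\<kappa> \<noteq> 0" and
      num: "\<forall>W y. numerator M (CARD('n) - 1) W a y = \<kappa> * (\<Sum>S\<in>W. ?\<sigma> S * (y - a \<bullet> vertex S) ^ m) * (\<Prod>j\<in>?J. (a $ j) ^ M)"
      unfolding m_def by blast
    have p: "(\<Prod>j\<in>?J. (a $ j) ^ M) \<noteq> 0" using z by (simp add: a_def less_imp_neq[THEN not_sym])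
    have "\<kappa> * (\<Sum>S\<in>W. ?\<sigma> S * (snd z - a \<bullet> vertex S) ^ m) * (\<Prod>j\<in>?J. (a $ j) ^ M) = 0"
      using num[rule_format, of W "snd z"] assms[of a "snd z"] by (simp only:)
    then have "(\<Sum>S\<in>W. ?\<sigma> S * (snd z - a \<bullet> vertex S) ^ m) = 0"
      using \<kappa> p by (simp only: mult_eq_0_iff) blast
    moreover have "a \<bullet> vertex S = (\<Sum>j\<in>?J. fst z $ j * corner S j)" for S
      unfolding inner_vertex by (subst sum.remove[of _ i]) (auto simp: a_def intro!: sum.cong)
    ultimately show ?thesis by (simp add: h_def)
  qed
  moreover have "open {z :: (real^'n) \<times> real. \<forall>j. fst z $ j > 0}"
  proof -
    have "{z :: (real^'n) \<times> real. \<forall>j. fst z $ j > 0} = (\<Inter>j. {z. fst z $ j > 0})" by auto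
    then show ?thesis by (auto intro!: open_INT open_Collect_less continuous_intros)
  qed
  moreover have "(\<chi> j. 1, 0) \<in> {z :: (real^'n) \<times> real. \<forall>j. fst z $ j > 0}" by simp
  ultimately have h0: "h z = 0" for z
    using polyfun_zero_on_open[OF pf, of "{z. \<forall>j. fst z $ j > 0}" "(\<chi> j. 1, 0)" z] by blast
  have "(\<Sum>S\<in>W. ?\<sigma> S * (\<Prod>j\<in>?J. corner S j)) = 0"
  proof (rule mixed_coefficient_zero)
    show "card ?J \<le> m" by (simp add: m_def card_Diff_singleton)
    show "(\<Sum>S\<in>W. ?\<sigma> S * (y - (\<Sum>j\<in>?J. a j * corner S j)) ^ m) = 0" for a y
      using h0[of "(\<chi> j. a j, y)"] by (simp add: h_def)
  qed auto
  \<comment> \<open>Each \<open>j\<close> other than \<open>i\<close> contributes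
    \<open>- 2 * (1/4) = - 1/2\<close>, the same for every vertex; only the sign at \<open>i\<close>
    still depends on \<open>S\<close>.\<close>
  moreover have "?\<sigma> S * (\<Prod>j\<in>?J. corner S j) = (\<Prod>j\<in>?J. - 1 / 2) * - 2 * corner S i" for S
  proof -
    have "?\<sigma> S * (\<Prod>j\<in>?J. corner S j) = - 2 * corner S i * (\<Prod>j\<in>?J. - 2 * corner S j * corner S j)"
      unfolding prod.distrib[of "\<lambda>j. - 2 * corner S j" "corner S" ?J]
      by (subst prod.remove[of UNIV i "\<lambda>j. - 2 * corner S j"]) (auto simp only: finite UNIV_I mult.assoc)
    also have "(\<Prod>j\<in>?J. - 2 * corner S j * corner S j) = (\<Prod>j\<in>?J. - 1 / 2)"
      by (intro prod.cong) (auto simp: corner_def)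
    finally show ?thesis by (simp add: mult_ac)
  qed
  ultimately have "(\<Prod>j\<in>?J. - 1 / 2) * - 2 * (\<Sum>S\<in>W. corner S i) = (0::real)"
    unfolding sum_distrib_left by simp
  then show ?thesis by simp
qed

lemma below_not_balanced:
  fixes g :: "(real^'n) \<times> real"
  assumes "inner_generic g"
  shows "\<exists>i. (\<Sum>S\<in>below g. corner S i) \<noteq> 0"
proof (rule ccontr)
  assume "\<not> ?thesis"
  then have bal: "(\<Sum>S\<in>below g. corner S i) = 0" for i by simp
  have "(\<Sum>S\<in>below g. fst g \<bullet> vertex S) = (\<Sum>j\<in>UNIV. fst g $ j * (\<Sum>S\<in>below g. corner S j))"
    unfolding inner_vertex sum_distrib_left by (rule sum.swap)
  then have b0: "(\<Sum>S\<in>below g. fst g \<bullet> vertex S) = 0" by (simp add: bal)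
  \<comment> \<open>Antipodal vertices cancel, so the values at all vertices sum to
    \<open>0\<close>.\<close>
  have "(\<Sum>S\<in>UNIV. fst g \<bullet> vertex S) = (\<Sum>S\<in>UNIV. fst g \<bullet> vertex (- S))"
    by (rule sum.reindex_bij_witness[of _ uminus uminus]) auto
  then have "(\<Sum>S\<in>UNIV. fst g \<bullet> vertex S) = 0" by (simp add: vertex_Compl sum_negf)
  then have "(\<Sum>S\<in>- below g. fst g \<bullet> vertex S) = 0"
    using b0 sum.union_disjoint[of "below g" "- below g" "\<lambda>S. fst g \<bullet> vertex S"] by simp
  moreover have "(\<Sum>S\<in>- below g. fst g \<bullet> vertex S) > 0"
  proof (rule sum_pos)
    obtain S where "snd g / 2 < fst g \<bullet> vertex S" using assms by (auto simp: inner_generic_def)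
    then have "S \<in> - below g" by (simp add: below_def)
    then show "- below g \<noteq> {}" by blast
    fix S assume "S \<in> - below g"
    then have "snd g / 2 \<le> fst g \<bullet> vertex S" by (simp add: below_def)
    moreover have "0 < snd g" using assms by (simp add: inner_generic_def)
    ultimately show "0 < fst g \<bullet> vertex S" by linarith
  qed simp
  ultimately show False by simp
qed

text \<open>Vanishing on the open cell makes the numerator vanish as a polynomial, hence also at
  vectors with \<open>a $ i = 0\<close>, which lie in no cell; there
  \<open>numerator_zero_imp_balanced\<close> applies.\<close>

lemma slice_moment_nonzero:
  fixes g :: "(real^'n) \<times> real"
  assumes g: "inner_generic g"
  shows "\<exists>z\<in>cone_cell g. slice_moment M (fst z) (snd z) \<noteq> 0"
proof (rule ccontr)
  assume "\<not> ?thesis"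
  then have zero: "slice_moment M (fst z) (snd z) = 0" if "z \<in> cone_cell g" for z using that by blast
  have gen: "generic g" using g by (simp add: inner_generic_def)
  let ?f = "\<lambda>z. numerator M (CARD('n) - 1) (below g) (fst z) (1 / 2 * snd z)"
  have "?f z = 0" if z: "z \<in> cone_cell g" for z
  proof -
    have genz: "generic (fst z, snd z)" using cone_cell_generic(1)[OF gen z] by simp
    have "norm (fst z) \<noteq> 0" using genz separating_nonzero by (auto simp: generic_def)
    moreover have "(\<Prod>j\<in>UNIV. (fst z $ j) ^ Suc M) \<noteq> 0" using generic_nth[OF genz] by simp
    ultimately show ?thesis
      using zero[OF z] unfolding slice_moment_numerator[OF genz] prod.collapse below_cone_cell[OF gen z] by simp
  qed
  then have "?f z = 0" for z
    by (rule polyfun_zero_on_open[OF polyfun_numerator open_cone_cell generic_in_cone_cell[OF gen]])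
  then have "numerator M (CARD('n) - 1) (below g) a y = 0" for a y
    using \<open>\<And>z. ?f z = 0\<close>[of "(a, 2 * y)"] by simp
  then have "(\<Sum>S\<in>below g. corner S i) = 0" for i by (rule numerator_zero_imp_balanced)
  then show False using below_not_balanced[OF g] by blast
qed

text \<open>Truncated powers of order \<open>CARD('n) - 1\<close> stand over a product of
  \<open>CARD('n)\<close> coordinates, which gives homogeneity \<open>-1\<close> once
  \<open>norm a\<close> is divided out.\<close>

lemma slice_degree_minus_1:
  fixes g :: "(real^'n) \<times> real"
  assumes g: "inner_generic g" and "\<kappa> \<noteq> 0"
  shows "slice_degree (cell g) (\<lambda>a t. \<kappa> * slice_moment M a t) (- 1)"
proof -
  have gen: "generic g" using g by (simp add: inner_generic_def)
  obtain p q where pq: "fraction_on (cone_cell g) (\<lambda>a t. \<kappa> * slice_moment M a t / norm a) p q"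
    using slice_fraction[OF gen] by blast
  obtain z where z: "z \<in> cone_cell g" "slice_moment M (fst z) (snd z) \<noteq> 0"
    using slice_moment_nonzero[OF g] by blast
  have "has_rational_degree (cone_cell g) (\<lambda>a t. \<kappa> * slice_moment M a t / norm a) (int 0 - int 1)"
  proof (rule has_rational_degree_homogeneous[OF open_cone_cell _ pq])
    show "r *\<^sub>R z \<in> cone_cell g" if "z \<in> cone_cell g" "r > 0" for r z using that by (rule cone_cell_scaleR)
    show "(fst z, snd z) \<in> cone_cell g" using z by simp
    show "\<kappa> * slice_moment M (fst z) (snd z) / norm (fst z) \<noteq> 0"
      using z assms(2) cone_cell_generic(1)[OF gen z(1)] separating_nonzero[of "fst z"] by (auto simp: generic_def)
    fix r :: real and a t assume at: "(a, t) \<in> cone_cell g" and r: "r > 0"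
    have gat: "generic (a, t)" "generic (r *\<^sub>R a, r * t)"
      using cone_cell_generic(1)[OF gen at] generic_scaleR[OF _ r, of "(a, t)"] by auto
    have na: "norm a \<noteq> 0" using gat(1) separating_nonzero by (auto simp: generic_def)
    let ?m = "moment_formula M (CARD('n) - 1)"
    have "r ^ CARD('n) * ?m (r *\<^sub>R a) (r * (t / 2)) = r ^ (CARD('n) - 1) * ?m a (t / 2)"
      by (rule moment_formula_scale[OF r])
    moreover have "r ^ CARD('n) = r ^ (CARD('n) - 1) * r"
      by (metis power_minus_mult zero_less_card_finite)
    ultimately have "r * ?m (r *\<^sub>R a) (r * (t / 2)) = ?m a (t / 2)" using r by simp
    then show "r ^ 1 * (\<kappa> * slice_moment M (r *\<^sub>R a) (r * t) / norm (r *\<^sub>R a)) = r ^ 0 * (\<kappa> * slice_moment M a t / norm a)"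
      using na r by (simp add: slice_moment_generic[OF gat(1)] slice_moment_generic[OF gat(2)] mult_ac)
  qed
  then show ?thesis by (simp add: slice_degree_def cone_over_cell[OF gen])
qed

text \<open>The truncated powers now have order \<open>CARD('n)\<close>, equal to the number of
  coordinates in the denominator, and the powers of \<open>r\<close> cancel.\<close>

lemma slab_degree_0:
  fixes g :: "(real^'n) \<times> real"
  assumes g: "inner_generic g"
  shows "slab_degree (cell g) (\<lambda>a t. \<kappa> * slab_moment M a t) 0"
proof -
  have gen: "generic g" using g by (simp add: inner_generic_def)
  let ?F = "\<lambda>a t. \<kappa> * slab_moment M a t"
  have "has_rational_degree (cone_cell g) ?F 0"
  \<comment> \<open>The vanishing case does occur: for odd \<open>M\<close> the integrand is odd and
    the slab is symmetric about the origin.\<close>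
  proof (cases "\<exists>a t. (a, t) \<in> cone_cell g \<and> ?F a t \<noteq> 0")
    case False
    then show ?thesis
      using generic_in_cone_cell[OF gen] by (intro has_rational_degree_zero open_cone_cell) auto
  next
    case True
    then obtain a0 t0 where at0: "(a0, t0) \<in> cone_cell g" "?F a0 t0 \<noteq> 0" by blast
    obtain p q where pq: "fraction_on (cone_cell g) ?F p q" using slab_fraction[OF gen] by blast
    have "has_rational_degree (cone_cell g) ?F (int 0 - int 0)"
    proof (rule has_rational_degree_homogeneous[OF open_cone_cell _ pq _ at0])
      show "r *\<^sub>R z \<in> cone_cell g" if "z \<in> cone_cell g" "r > 0" for r z using that by (rule cone_cell_scaleR)
      fix r :: real and a t assume at: "(a, t) \<in> cone_cell g" and r: "r > 0"
      have gat: "generic (a, t)" using cone_cell_generic(1)[OF gen at] .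
      have nz: "a $ i \<noteq> 0" "(r *\<^sub>R a) $ i \<noteq> 0" for i using generic_nth[OF gat, of i] r by auto
      have t: "0 < t" using cone_cell_generic(3)[OF gen at] g by (simp add: inner_generic_def)
      have eq: "moment_formula M CARD('n) (r *\<^sub>R a) (r * s) = moment_formula M CARD('n) a s" for s
        using moment_formula_scale[OF r, of M "CARD('n)" a s] r by simp
      have "slab_moment M (r *\<^sub>R a) (r * t) = slab_moment M a t"
        using slab_moment_formula[OF nz(1), of t M] slab_moment_formula[OF nz(2), of "r * t" M] t r
          eq[of "t / 2"] eq[of "- t / 2"] by simp
      then show "r ^ 0 * ?F (r *\<^sub>R a) (r * t) = r ^ 0 * ?F a t" by simp
    qed
    then show ?thesis by simp
  qed
  then show ?thesis by (simp add: slab_degree_def cone_over_cell[OF gen])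
qed

theorem theorem1p4:
  fixes M :: nat
  shows
    "(let D = sphere (0::real^'n) 1 \<times> (UNIV::real set); \<P> = slicing_pieces in
        piecewise_rational D \<P> slice_volume \<and>
        piecewise_rational D \<P> slab_volume \<and>
        piecewise_rational D \<P> (slice_moment M) \<and>
        piecewise_rational D \<P> (slab_moment M)) \<and>
     (CARD('n) \<in> {2,3,4} \<and> M \<in> {1,2,3,4} \<longrightarrow>
        (\<forall>C \<in> (maximal_slicing_chambers :: ((real^'n) \<times> real) set set).
           (\<exists>k. slice_degree C slice_volume k \<and> slice_degree C (slice_moment M) k) \<and>
           (\<exists>k. slab_degree C slab_volume k \<and> slab_degree C (slab_moment M) k)))"
proof -
  let ?c = "1 / real CARD('n)"
  have vol: "slice_volume = (\<lambda>(a :: real^'n) t. ?c * slice_moment 0 a t)"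
    "slab_volume = (\<lambda>(a :: real^'n) t. ?c * slab_moment 0 a t)"
    by (intro ext; simp add: slice_volume_eq slab_volume_eq)+
  have mom: "slice_moment M = (\<lambda>(a :: real^'n) t. 1 * slice_moment M a t)"
    "slab_moment M = (\<lambda>(a :: real^'n) t. 1 * slab_moment M a t)"
    by simp_all
  have "slice_degree C slice_volume (- 1) \<and> slice_degree C (slice_moment M) (- 1) \<and>
      slab_degree C slab_volume 0 \<and> slab_degree C (slab_moment M) 0"
    if C: "C \<in> (maximal_slicing_chambers :: ((real^'n) \<times> real) set set)" for C
  proof -
    obtain g where g: "inner_generic g" "C = cell g"
      using C unfolding maximal_slicing_chambers_eq by blast
    show ?thesis
      unfolding g(2) vol
      using slice_degree_minus_1[OF g(1), of ?c 0] slice_degree_minus_1[OF g(1), of 1 M]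
        slab_degree_0[OF g(1), of ?c 0] slab_degree_0[OF g(1), of 1 M] by simp
  qed
  moreover have "piecewise_rational (sphere (0::real^'n) 1 \<times> UNIV) slicing_pieces slice_volume"
    "piecewise_rational (sphere (0::real^'n) 1 \<times> UNIV) slicing_pieces slab_volume"
    "piecewise_rational (sphere (0::real^'n) 1 \<times> UNIV) slicing_pieces (slice_moment M)"
    "piecewise_rational (sphere (0::real^'n) 1 \<times> UNIV) slicing_pieces (slab_moment M)"
    unfolding vol using piecewise_rational_slice[of ?c 0] piecewise_rational_slab[of ?c 0]
      piecewise_rational_slice[of 1 M] piecewise_rational_slab[of 1 M] by simp_all
  ultimately show ?thesis unfolding Let_def by blast
qed

end
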